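(* Let $n,m\ge 0$ be integers and $\nu,\mu,\lambda$ partitions with $\ell(\nu)\le n$, $\ell(\mu)\le m$ and $\lambda_{n+1}<m+1$. With the notation of the context, \[ \chi_{\mu,\nu,\lambda}^{n,m}(q)=(-1)^{r(m+n)}\sum_{(\sigma,\tau,A)\in \Theta}(-1)^{|\sigma|+|\tau|+\sum_{i=1}^r A_i}\,\frac{q^{\Delta^{\sigma,\tau,A}(\mu,\nu,\lambda)}}{(q)_\infty^{n+m}}, \] where $\Theta$ is the set of triples $(\sigma,\tau,A)$ with $\sigma\in S_n$, $\tau\in S_m$, and $A=(A_1,\dots,A_r)$ given by $A_{r-i+1}=-L_{s_i}$ ($1\le i\le r$) for some integers $s_r>\cdots>s_1>n-r$, with $L_k=\lambda_k-k+n-m+1$; $|\sigma|,|\tau|$ denote the numbers of inversions; and \[ \Delta^{\sigma,\tau,A}(\mu,\nu,\lambda)=\sum_{i=1}^r A_i \left(\frac{A_i+1}2+N_{\sigma(i)}-M_{\tau(i)}\right) -\sum_{i=r+1}^n (P_{i-r}+1)(N_{\sigma(i)}-N_{i-r})- \sum_{i=r+1}^m Q_{i-r}(M_{\tau(i)}-M_{i-r}). \]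
   Context: Partitions are weakly decreasing sequences of nonnegative integers with finitely many nonzero parts; $\lambda_k=0$ for $k>\ell(\lambda)$, $\lambda'$ is the transposed partition, and $(i,j)\in\lambda$ means $1\le j\le\lambda_i$. Let $\mathcal{A}$ be the set of arrays $a=(a_{i,j})_{i,j\ge1}$ with entries in $\mathbb{Z}_{\ge0}\cup\{\infty\}$ such that $a_{i,j}\ge a_{i+1,j}$ and $a_{i,j}\ge a_{i,j+1}$ for all $i,j$; $a_{n+1,m+1}=0$; for each $i$, $a_{i,j}=\nu_i$ for all sufficiently large $j$; for each $j$, $a_{i,j}=\mu_j$ for all sufficiently large $i$; and $a_{i,j}=\infty$ if and only if $(i,j)\in\lambda$. The weight of $a$ is \[|a|=\sum_{i-n\le j-m,\ (i,j)\notin\lambda}(a_{i,j}-\nu_i)+\sum_{i-n>j-m,\ (i,j)\notin\lambda}(a_{i,j}-\mu_j),\] and $\chi^{n,m}_{\mu,\nu,\lambda}(q)=\sum_{a\in\mathcal{A}}q^{|a|}$ (formal power series in $q$). Let $(q)_\infty=\prod_{k\ge1}(1-q^k)$. Let $r=\min\{t\ge 0\mid \lambda_{n-t}\ge m-t\}$ with the convention $\lambda_0=+\infty$, so $0\le r\le\min(n,m)$. Define $\pi_i=\lambda_i-(m-r)$ for $1\le i\le n-r$ and $\kappa_j=\lambda'_j-(n-r)$ for $1\le j\le m-r$, and set $N_i=\nu_i+n-i$ ($1\le i\le n$), $M_j=\mu_j+m-j$ ($1\le j\le m$), $P_i=\pi_i+(n-r)-i$ ($1\le i\le n-r$), $Q_j=\kappa_j+(m-r)-j$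 ($1\le j\le m-r$). *)

theory Defs
  imports
    "HOL-Analysis.Analysis"
    "HOL-Computational_Algebra.Formal_Laurent_Series"
    "HOL-Combinatorics.Permutations"
begin

text \<open>
  Partitions, permutations and arrays are indexed from 1, so the value of a partition at index 0 is
  irrelevant and never used.
\<close>

definition is_partition :: "(nat \<Rightarrow> nat) \<Rightarrow> bool" where
  "is_partition p \<longleftrightarrow> (\<forall>i\<ge>1. p (Suc i) \<le> p i) \<and> finite {i. 1 \<le> i \<and> p i \<noteq> 0}"

definition partition_length :: "(nat \<Rightarrow> nat) \<Rightarrow> nat" where
  "partition_length p = card {i. 1 \<le> i \<and> p i \<noteq> 0}"

definition transposed :: "(nat \<Rightarrow> nat) \<Rightarrow> nat \<Rightarrow> nat" where
  "transposed p j = card {i. 1 \<le> i \<and> j \<le> p i}"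

definition diagram :: "(nat \<Rightarrow> nat) \<Rightarrow> (nat \<times> nat) set" where
  "diagram p = {(i, j). 1 \<le> i \<and> 1 \<le> j \<and> j \<le> p i}"

definition inversions :: "nat \<Rightarrow> (nat \<Rightarrow> nat) \<Rightarrow> nat" where
  "inversions n \<sigma> = card {(i, j). 1 \<le> i \<and> i < j \<and> j \<le> n \<and> \<sigma> j < \<sigma> i}"

text \<open>
  Extensionality fixes the irrelevant values at index 0, so that distinct functions in the set
  below are distinct arrays.
\<close>

definition pit_arrays ::
  "nat \<Rightarrow> nat \<Rightarrow> (nat \<Rightarrow> nat) \<Rightarrow> (nat \<Rightarrow> nat) \<Rightarrow> (nat \<Rightarrow> nat) \<Rightarrow> (nat \<times> nat \<Rightarrow> enat) set"
where
  "pit_arrays n m \<mu> \<nu> lam = {a \<in> extensional ({1..} \<times> {1..}).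
     (\<forall>i\<ge>1. \<forall>j\<ge>1. a (i + 1, j) \<le> a (i, j) \<and> a (i, j + 1) \<le> a (i, j)) \<and>
     a (n + 1, m + 1) = 0 \<and>
     (\<forall>i\<ge>1. \<forall>\<^sub>F j in sequentially. a (i, j) = enat (\<nu> i)) \<and>
     (\<forall>j\<ge>1. \<forall>\<^sub>F i in sequentially. a (i, j) = enat (\<mu> j)) \<and>
     (\<forall>i\<ge>1. \<forall>j\<ge>1. a (i, j) = \<infinity> \<longleftrightarrow> (i, j) \<in> diagram lam)}"

text \<open>
  For an array in the set above, all entries outside the diagram are finite, and both families have
  nonnegative terms, only finitely many of which are nonzero (entries with \<open>i > n\<close> and \<open>j > m\<close>
  vanish). So the infinite sums over the discrete type \<open>int\<close> are the ordinary finite ones.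
\<close>

definition array_weight ::
  "nat \<Rightarrow> nat \<Rightarrow> (nat \<Rightarrow> nat) \<Rightarrow> (nat \<Rightarrow> nat) \<Rightarrow> (nat \<Rightarrow> nat) \<Rightarrow> (nat \<times> nat \<Rightarrow> enat) \<Rightarrow> int"
where
  "array_weight n m \<mu> \<nu> lam a =
     (\<Sum>\<^sub>\<infinity>(i, j) \<in> {(i, j). 1 \<le> i \<and> 1 \<le> j \<and> int i - int n \<le> int j - int m \<and> (i, j) \<notin> diagram lam}.
        int (the_enat (a (i, j))) - int (\<nu> i)) +
     (\<Sum>\<^sub>\<infinity>(i, j) \<in> {(i, j). 1 \<le> i \<and> 1 \<le> j \<and> int i - int n > int j - int m \<and> (i, j) \<notin> diagram lam}.
        int (the_enat (a (i, j))) - int (\<mu> j))"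

lemma decreasing_ge_limit:
  fixes f :: "nat \<Rightarrow> enat"
  assumes dec: "\<forall>j\<ge>1. f (j + 1) \<le> f j" and lim: "\<forall>\<^sub>F j in sequentially. f j = c" and "1 \<le> j"
  shows "c \<le> f j"
proof -
  obtain K where K: "\<forall>k\<ge>K. f k = c"
    using lim by (auto simp: eventually_sequentially)
  have "f (j + d) \<le> f j" for d
  proof (induction d)
    case (Suc d)
    have "f (j + d + 1) \<le> f (j + d)"
      using dec \<open>1 \<le> j\<close> by simp
    then show ?case
      using Suc.IH order_trans by fastforce
  qed simp
  from this[of K] show ?thesis
    using K by simp
qed

lemma array_weight_nonneg:
  assumes a: "a \<in> pit_arrays n m \<mu> \<nu> lam"
  shows "0 \<le> array_weight n m \<mu> \<nu> lam a"
proof -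
  have bounds: "\<nu> i \<le> the_enat (a (i, j)) \<and> \<mu> j \<le> the_enat (a (i, j))"
    if "1 \<le> i" "1 \<le> j" "(i, j) \<notin> diagram lam" for i j
  proof -
    have row: "enat (\<nu> i) \<le> a (i, j)"
      using a that by (intro decreasing_ge_limit[of "\<lambda>j. a (i, j)"]) (auto simp: pit_arrays_def)
    have col: "enat (\<mu> j) \<le> a (i, j)"
      using a that by (intro decreasing_ge_limit[of "\<lambda>i. a (i, j)"]) (auto simp: pit_arrays_def)
    have "a (i, j) \<noteq> \<infinity>"
      using a that by (auto simp: pit_arrays_def)
    then show ?thesis
      using row col by (cases "a (i, j)") auto
  qed
  show ?thesis
    unfolding array_weight_def
    by (intro add_nonneg_nonneg infsum_nonneg) (use bounds in \<open>auto split: prod.splits\<close>)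
qed

text \<open>The infinite sum and the infinite product are taken in the \<open>q\<close>-adic topology.\<close>

definition pit_character ::
  "nat \<Rightarrow> nat \<Rightarrow> (nat \<Rightarrow> nat) \<Rightarrow> (nat \<Rightarrow> nat) \<Rightarrow> (nat \<Rightarrow> nat) \<Rightarrow> rat fps"
where
  "pit_character n m \<mu> \<nu> lam =
     (\<Sum>\<^sub>\<infinity>a \<in> pit_arrays n m \<mu> \<nu> lam. fps_X ^ nat (array_weight n m \<mu> \<nu> lam a))"

definition q_infinity :: "rat fps" where
  "q_infinity = (\<Prod>k. 1 - fps_X ^ (k + 1))"

text \<open>
  The convention \<open>lam\<^sub>0 = \<infinity>\<close> forces the minimum to be at most \<open>n\<close> (take \<open>t = n\<close>), and truncating
  \<open>m - t\<close> at 0 does not change the condition.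
\<close>

definition pit_rank :: "nat \<Rightarrow> nat \<Rightarrow> (nat \<Rightarrow> nat) \<Rightarrow> nat" where
  "pit_rank n m lam =
     (LEAST t. enat (m - t) \<le> (if n - t = 0 then \<infinity> else enat (lam (n - t))))"

definition shifted_part :: "nat \<Rightarrow> (nat \<Rightarrow> nat) \<Rightarrow> nat \<Rightarrow> int" where
  "shifted_part n \<nu> i = int (\<nu> i) + int n - int i"

definition pit_P :: "nat \<Rightarrow> nat \<Rightarrow> (nat \<Rightarrow> nat) \<Rightarrow> nat \<Rightarrow> int" where
  "pit_P n m lam i = (let r = int (pit_rank n m lam); \<pi> = int (lam i) - (int m - r)
     in \<pi> + (int n - r) - int i)"

definition pit_Q :: "nat \<Rightarrow> nat \<Rightarrow> (nat \<Rightarrow> nat) \<Rightarrow> nat \<Rightarrow> int" where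
  "pit_Q n m lam j = (let r = int (pit_rank n m lam); \<kappa> = int (transposed lam j) - (int n - r)
     in \<kappa> + (int m - r) - int j)"

definition pit_L :: "nat \<Rightarrow> nat \<Rightarrow> (nat \<Rightarrow> nat) \<Rightarrow> nat \<Rightarrow> int" where
  "pit_L n m lam k = int (lam k) - int k + int n - int m + 1"

text \<open>The tuple \<open>(A\<^sub>1, \<dots>, A\<^sub>r)\<close> is an extensional function on \<open>{1..r}\<close>.\<close>

definition pit_Theta ::
  "nat \<Rightarrow> nat \<Rightarrow> (nat \<Rightarrow> nat) \<Rightarrow> ((nat \<Rightarrow> nat) \<times> (nat \<Rightarrow> nat) \<times> (nat \<Rightarrow> int)) set"
where
  "pit_Theta n m lam = (let r = pit_rank n m lam in
     {(\<sigma>, \<tau>, A). \<sigma> permutes {1..n} \<and> \<tau> permutes {1..m} \<and> A \<in> extensional {1..r} \<and>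
        (\<exists>s :: nat \<Rightarrow> nat. strict_mono_on {1..r} s \<and>
           (\<forall>i\<in>{1..r}. n - r < s i \<and> A (r - i + 1) = - pit_L n m lam (s i)))})"

text \<open>
  The term \<open>A\<^sub>i (A\<^sub>i + 1) / 2\<close> is split off so that the exponent is visibly an integer; the
  division by 2 is exact.
\<close>

definition pit_Delta ::
  "nat \<Rightarrow> nat \<Rightarrow> (nat \<Rightarrow> nat) \<Rightarrow> (nat \<Rightarrow> nat) \<Rightarrow> (nat \<Rightarrow> nat) \<Rightarrow>
   (nat \<Rightarrow> nat) \<Rightarrow> (nat \<Rightarrow> nat) \<Rightarrow> (nat \<Rightarrow> int) \<Rightarrow> int"
where
  "pit_Delta n m \<mu> \<nu> lam \<sigma> \<tau> A = (let r = pit_rank n m lam; N = shifted_part n \<nu>; M = shifted_part m \<mu> in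
     (\<Sum>i=1..r. A i * (A i + 1) div 2 + A i * (N (\<sigma> i) - M (\<tau> i)))
     - (\<Sum>i=r+1..n. (pit_P n m lam (i - r) + 1) * (N (\<sigma> i) - N (i - r)))
     - (\<Sum>i=r+1..m. pit_Q n m lam (i - r) * (M (\<tau> i) - M (i - r))))"

end

theory Submission
  imports Defs
begin

text \<open>
  Cut an array along its main diagonal, the one through \<open>(n, m)\<close>. It has \<open>r\<close> finite entries
  \<open>\<alpha>\<^sub>1 > \<dots> > \<alpha>\<^sub>r\<close> (made strict by a shift). Consecutive diagonals of either half interlace, so summing a
  determinant over one diagonal is, by multilinearity and column operations, again a determinant.
  Starting far away, where the diagonal is \<open>\<nu>\<close> or \<open>\<mu>\<close>, the sum over each half with fixed \<open>\<alpha>\<close>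
  becomes a determinant with columns \<open>1/(q)\<^bsub>\<alpha> - N\<^esub>\<close> and, for every row that leaves the infinite region, \<open>q\<^bsup>-P N\<^esup>/(q)\<^sub>\<infinity>\<close>.

  In the sum over \<open>\<alpha>\<close> of the product of the two determinants, Euler's identities turn the one-dimensional sum
  \<open>\<Sum>\<^sub>\<alpha> q\<^bsup>\<alpha> - N\<^esup>/((q)\<^bsub>\<alpha> - N\<^esub> (q)\<^bsub>\<alpha> - M\<^esub>)\<close> into \<open>(q)\<^sub>\<infinity>\<^bsup>-2\<^esup> \<Sum>\<^sub>A (-1)\<^bsup>A\<^esup> q\<^bsup>A(A+1)/2 + A(N - M)\<^esup>\<close>.
  The summand for a tuple \<open>A\<close> is a product of two determinants, which vanishes unless the entries of \<open>A\<close> are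
  distinct and different from all \<open>Q\<^sub>j\<close>. The complement of the \<open>Q\<^sub>j\<close> in the naturals is the set of the \<open>-L\<^sub>s\<close>
  with \<open>s > n - r\<close>. All sums are taken for real \<open>0 < q < 1\<close>, where they converge absolutely, and
  the result is transferred to formal series by comparing coefficients.
\<close>

section \<open>Determinants and multiple sums\<close>

text \<open>The terms with \<open>A\<close> outside the index set do not vanish one by one. They
  cancel only in the sum over \<tau>, because an entry equal to some Q_j repeats a column of the
  second determinant; so \<sigma> and \<tau> stay inside determinants until the tuples have been cut
  down. That only the Q_j are excluded, and that P + 1 but Q occur in the exponent, has one cause:
  the main diagonal is weighed against \<nu>. Its factor q^(\<alpha> - N) enters the first
  determinant and raises the exponents there from P to P + 1, while the second determinant keeps Q.
  A column q^(A N) with A \<ge> 0 never equals a column q^(-(P + 1) N). Euler's series for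
  1/(q)_(\<alpha> - M) stays valid, with value 0, for \<alpha> < M, since the product that it
  expands then has a zero factor. So \<alpha> can be summed without the constraint \<alpha> \<ge> M,
  and this sum produces the factor (q)_A that cancels the denominator of the series. The sign
  (-1)^(r(m+n)) comes from moving the r finite columns in front of the n - r, respectively m - r,
  infinite ones.\<close>

lemma has_sum_times_real:
  fixes f :: "'a \<Rightarrow> real" and g :: "'b \<Rightarrow> real"
  assumes "(f has_sum a) A" and "(g has_sum b) B"
  shows "((\<lambda>(x, y). f x * g y) has_sum a * b) (A \<times> B)"
proof (rule has_sum_SigmaI)
  show "((\<lambda>y. case (x, y) of (x, y) \<Rightarrow> f x * g y) has_sum f x * b) B" for x
    using has_sum_cmult_right[OF assms(2)] by simp
  show "((\<lambda>x. f x * b) has_sum a * b) A"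
    using has_sum_cmult_left[OF assms(1)] by simp
  have f: "(\<lambda>x. norm (f x)) summable_on A" and g: "(\<lambda>x. norm (g x)) summable_on B"
    using assms[THEN has_sum_imp_summable] by (metis summable_on_iff_abs_summable_on_real)+
  have "(\<lambda>p. norm (case p of (x, y) \<Rightarrow> f x * g y)) summable_on A \<times> B"
    unfolding Infinite_Sum.abs_summable_on_Sigma_iff using f g
    by (auto simp: abs_mult infsum_cmult_right' infsum_nonneg intro!: summable_on_cmult_right summable_on_cmult_left)
  then show "(\<lambda>(x, y). f x * g y) summable_on A \<times> B"
    by (metis summable_on_iff_abs_summable_on_real)
qed

lemma has_sum_prod_PiE_real:
  fixes f :: "'a \<Rightarrow> 'b \<Rightarrow> real"
  assumes "finite A" and "\<And>x. x \<in> A \<Longrightarrow> (f x has_sum s x) (B x)"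
  shows "((\<lambda>g. \<Prod>x\<in>A. f x (g x)) has_sum (\<Prod>x\<in>A. s x)) (PiE A B)"
  using assms
proof (induction A rule: finite_induct)
  case empty
  then show ?case by (simp add: has_sum_finite_iff)
next
  case (insert x F)
  have inj: "inj_on (\<lambda>(y, g). g(x := y)) (B x \<times> PiE F B)"
    using insert.hyps by (intro inj_combinator)
  have img: "(\<lambda>(y, g). g(x := y)) ` (B x \<times> PiE F B) = PiE (insert x F) B"
    by (simp add: PiE_insert_eq)
  have "((\<lambda>(y, g). f x y * (\<Prod>z\<in>F. f z (g z))) has_sum s x * (\<Prod>z\<in>F. s z)) (B x \<times> PiE F B)"
    using insert by (intro has_sum_times_real) auto
  also have "?this \<longleftrightarrow> (((\<lambda>g. \<Prod>z\<in>insert x F. f z (g z)) \<circ> (\<lambda>(y, g). g(x := y)))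
      has_sum s x * (\<Prod>z\<in>F. s z)) (B x \<times> PiE F B)"
  proof (intro has_sum_cong)
    fix p assume "p \<in> B x \<times> PiE F B"
    have "(\<Prod>z\<in>F. f z (snd p z)) = (\<Prod>z\<in>F. f z (((snd p)(x := fst p)) z))"
      using insert.hyps by (intro prod.cong) auto
    then show "(case p of (y, g) \<Rightarrow> f x y * (\<Prod>z\<in>F. f z (g z))) =
        ((\<lambda>g. \<Prod>z\<in>insert x F. f z (g z)) \<circ> (\<lambda>(y, g). g(x := y))) p"
      using insert.hyps by (simp add: case_prod_beta)
  qed
  also have "\<dots> \<longleftrightarrow> ((\<lambda>g. \<Prod>z\<in>insert x F. f z (g z)) has_sum s x * (\<Prod>z\<in>F. s z)) (PiE (insert x F) B)"
    using has_sum_reindex[OF inj] unfolding img by (rule sym)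
  finally show ?case
    by (simp only: prod.insert[OF insert.hyps])
qed

lemma has_sum_sum_real:
  fixes f :: "'i \<Rightarrow> 'a \<Rightarrow> real"
  assumes "\<And>i. i \<in> I \<Longrightarrow> (f i has_sum s i) A"
  shows "((\<lambda>x. \<Sum>i\<in>I. f i x) has_sum (\<Sum>i\<in>I. s i)) A"
  using assms
proof (induction I rule: infinite_finite_induct)
  case (insert i I)
  then show ?case
    using has_sum_add[of "f i" A "s i" "\<lambda>x. \<Sum>i\<in>I. f i x" "\<Sum>i\<in>I. s i"] by simp
qed (simp_all add: has_sum_0)

text \<open>The first argument of \<open>c\<close> is the column: \<open>c(k := x)\<close> exchanges
  a whole column, and each column can be summed over a variable of its own.\<close>

definition ldet :: "nat \<Rightarrow> (nat \<Rightarrow> nat \<Rightarrow> real) \<Rightarrow> real" where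
  "ldet n c = (\<Sum>\<sigma> | \<sigma> permutes {1..n}. of_int (sign \<sigma>) * (\<Prod>j = 1..n. c j (\<sigma> j)))"

lemma ldet_cong:
  assumes "\<And>j i. j \<in> {1..n} \<Longrightarrow> i \<in> {1..n} \<Longrightarrow> c j i = d j i"
  shows "ldet n c = ldet n d"
  unfolding ldet_def
proof (rule sum.cong[OF refl])
  fix \<sigma> assume "\<sigma> \<in> {\<sigma>. \<sigma> permutes {1..n}}"
  then have "\<sigma> j \<in> {1..n}" if "j \<in> {1..n}" for j
    using permutes_in_image that by (metis mem_Collect_eq)
  then have "(\<Prod>j = 1..n. c j (\<sigma> j)) = (\<Prod>j = 1..n. d j (\<sigma> j))"
    by (intro prod.cong refl assms)
  then show "of_int (sign \<sigma>) * (\<Prod>j = 1..n. c j (\<sigma> j)) = of_int (sign \<sigma>) * (\<Prod>j = 1..n. d j (\<sigma> j))"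
    by simp
qed

lemma ldet_permute:
  assumes "\<pi> permutes {1..n}"
  shows "ldet n (\<lambda>j. c (\<pi> j)) = of_int (sign \<pi>) * ldet n c"
proof -
  have "ldet n (\<lambda>j. c (\<pi> j)) =
      (\<Sum>\<sigma> | \<sigma> permutes {1..n}. of_int (sign (\<sigma> \<circ> \<pi>)) * (\<Prod>j = 1..n. c (\<pi> j) ((\<sigma> \<circ> \<pi>) j)))"
    unfolding ldet_def by (rule sum_permutations_compose_right[OF assms])
  also have "\<dots> = (\<Sum>\<sigma> | \<sigma> permutes {1..n}. of_int (sign \<pi>) * (of_int (sign \<sigma>) * (\<Prod>j = 1..n. c j (\<sigma> j))))"
  proof (rule sum.cong[OF refl])
    fix \<sigma> assume "\<sigma> \<in> {\<sigma>. \<sigma> permutes {1..n}}"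
    then have "sign (\<sigma> \<circ> \<pi>) = sign \<sigma> * sign \<pi>"
      using assms by (intro sign_compose) (auto intro: permutes_imp_permutation)
    moreover have "(\<Prod>j = 1..n. c (\<pi> j) (\<sigma> (\<pi> j))) = (\<Prod>j = 1..n. c j (\<sigma> j))"
      using prod.permute[OF assms, of "\<lambda>j. c j (\<sigma> j)"] by (simp add: o_def)
    ultimately show "of_int (sign (\<sigma> \<circ> \<pi>)) * (\<Prod>j = 1..n. c (\<pi> j) ((\<sigma> \<circ> \<pi>) j)) =
        of_int (sign \<pi>) * (of_int (sign \<sigma>) * (\<Prod>j = 1..n. c j (\<sigma> j)))"
      by simp
  qed
  finally show ?thesis
    by (simp add: ldet_def sum_distrib_left)
qed

lemma ldet_zero:
  assumes "j \<in> {1..n}" "k \<in> {1..n}" "j \<noteq> k" "\<And>i. i \<in> {1..n} \<Longrightarrow> c j i = c k i"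
  shows "ldet n c = 0"
proof -
  have "ldet n c = ldet n (\<lambda>l. c (Transposition.transpose j k l))"
    using assms by (intro ldet_cong) (auto simp: Transposition.transpose_def)
  also have "\<dots> = - ldet n c"
    using assms by (subst ldet_permute) (auto intro: permutes_swap_id simp: sign_swap_id)
  finally show ?thesis
    by simp
qed

lemma ldet_scale:
  "ldet n (\<lambda>j i. u j * w i * c j i) = (\<Prod>j = 1..n. u j) * (\<Prod>i = 1..n. w i) * ldet n c"
  unfolding ldet_def sum_distrib_left
proof (rule sum.cong[OF refl])
  fix \<sigma> assume "\<sigma> \<in> {\<sigma>. \<sigma> permutes {1..n}}"
  then have "(\<Prod>j = 1..n. w (\<sigma> j)) = (\<Prod>i = 1..n. w i)"
    using prod.permute[of \<sigma> "{1..n}" w] by (simp only: o_def mem_Collect_eq)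
  then show "of_int (sign \<sigma>) * (\<Prod>j = 1..n. u j * w (\<sigma> j) * c j (\<sigma> j)) =
      (\<Prod>j = 1..n. u j) * (\<Prod>i = 1..n. w i) * (of_int (sign \<sigma>) * (\<Prod>j = 1..n. c j (\<sigma> j)))"
    by (simp only: prod.distrib mult_ac)
qed

lemma ldet_diff_column:
  assumes k: "k \<in> {1..n}"
  shows "ldet n (c(k := \<lambda>i. x i - y i)) = ldet n (c(k := x)) - ldet n (c(k := y))"
proof -
  have *: "(\<Prod>j = 1..n. (c(k := x)) j (\<sigma> j)) = x (\<sigma> k) * (\<Prod>j\<in>{1..n} - {k}. c j (\<sigma> j))" for \<sigma> x
    using k by (subst prod.remove[of _ k]) auto
  show ?thesis
    unfolding ldet_def * by (simp add: sum_subtractf[symmetric] algebra_simps)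
qed

text \<open>The largest index \<open>b\<close> is added last, when columns \<open>b\<close> and
  \<open>Suc b\<close> are both still the original ones. The determinant that the subtraction brings
  in therefore has two equal columns.\<close>

lemma ldet_column_differences:
  assumes "finite J" "J \<subseteq> {1..<n}"
  shows "ldet n (\<lambda>j i. if j \<in> J then c j i - c (Suc j) i else c j i) = ldet n c"
  using assms
proof (induction J rule: finite_linorder_max_induct)
  case empty
  then show ?case by simp
next
  case (insert b J)
  define d where "d = (\<lambda>j i. if j \<in> J then c j i - c (Suc j) i else c j i)"
  have b: "b \<notin> J" "Suc b \<notin> J" "b \<in> {1..<n}"
    using insert by fastforce+
  have d': "(\<lambda>j i. if j \<in> insert b J then c j i - c (Suc j) i else c j i) = d(b := \<lambda>i. c b i - c (Suc b) i)"
    by (auto simp: d_def fun_eq_iff)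
  have "ldet n (d(b := \<lambda>i. c b i - c (Suc b) i)) = ldet n (d(b := c b)) - ldet n (d(b := c (Suc b)))"
    by (rule ldet_diff_column) (use b in simp)
  moreover have "ldet n (d(b := c (Suc b))) = 0"
  proof (rule ldet_zero[of b n "Suc b"])
    show "(d(b := c (Suc b))) b i = (d(b := c (Suc b))) (Suc b) i" for i
      using b by (simp add: d_def)
  qed (use b in auto)
  moreover have "d(b := c b) = d"
    using b by (simp add: d_def fun_eq_iff)
  moreover have "ldet n d = ldet n c"
    using insert by (simp add: d_def)
  ultimately show ?case
    unfolding d' by simp
qed

text \<open>Multilinearity for infinite sums. In each Leibniz term a column \<open>k\<close> in
  \<open>K\<close> contributes one factor, which depends on \<open>Z k\<close> alone, so the sum
  over the product set splits into one-dimensional sums.\<close>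

lemma has_sum_ldet:
  assumes "K \<subseteq> {1..n}"
    and "\<And>k i. k \<in> K \<Longrightarrow> i \<in> {1..n} \<Longrightarrow> (w k i has_sum c k i) (B k)"
  shows "((\<lambda>Z. ldet n (\<lambda>k i. if k \<in> K then w k i (Z k) else c k i)) has_sum ldet n c) (PiE K B)"
  unfolding ldet_def
proof (intro has_sum_sum_real has_sum_cmult_right)
  fix \<sigma> assume "\<sigma> \<in> {\<sigma>. \<sigma> permutes {1..n}}"
  then have \<sigma>: "\<sigma> j \<in> {1..n}" if "j \<in> {1..n}" for j
    using permutes_in_image that by (metis mem_Collect_eq)
  have split: "(\<Prod>j = 1..n. f j) = (\<Prod>j\<in>K. f j) * (\<Prod>j\<in>{1..n} - K. f j)" for f :: "nat \<Rightarrow> real"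
    using assms(1) by (subst prod.subset_diff[of K]) (auto simp: mult.commute)
  have fin: "finite K"
    using assms(1) finite_subset by blast
  have "((\<lambda>Z. (\<Prod>j\<in>K. w j (\<sigma> j) (Z j)) * (\<Prod>j\<in>{1..n} - K. c j (\<sigma> j))) has_sum
      (\<Prod>j\<in>K. c j (\<sigma> j)) * (\<Prod>j\<in>{1..n} - K. c j (\<sigma> j))) (PiE K B)"
    using assms \<sigma> by (intro has_sum_cmult_left has_sum_prod_PiE_real fin) blast
  moreover have "(\<Prod>j = 1..n. if j \<in> K then w j (\<sigma> j) (Z j) else c j (\<sigma> j)) =
      (\<Prod>j\<in>K. w j (\<sigma> j) (Z j)) * (\<Prod>j\<in>{1..n} - K. c j (\<sigma> j))" for Z
    unfolding split by (intro arg_cong2[of _ _ _ _ "(*)"] prod.cong) auto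
  ultimately show "((\<lambda>Z. \<Prod>j = 1..n. if j \<in> K then w j (\<sigma> j) (Z j) else c j (\<sigma> j)) has_sum
      (\<Prod>j = 1..n. c j (\<sigma> j))) (PiE K B)"
    by (simp only: split[of "\<lambda>j. c j (\<sigma> j)"])
qed

section \<open>q-series\<close>

locale q_parameter =
  fixes q :: real
  assumes q_pos: "0 < q" and q_less_1: "q < 1"
begin

definition qpoch :: "nat \<Rightarrow> real" where
  "qpoch d = (\<Prod>i<d. 1 - q ^ Suc i)"

definition qpoch_inf :: real where
  "qpoch_inf = (\<Prod>i. 1 - q ^ Suc i)"

text \<open>
  Both functions below weight a partition \<open>p\<close> by \<open>q\<^bsup>|p|\<^esup>\<close>: \<open>hq d\<close> sums over partitions with parts at
  most \<open>d\<close>, and \<open>gauss D d\<close> over those that in addition have fewer than \<open>D\<close> parts. Both vanish for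
  negative \<open>d\<close>.
\<close>

definition hq :: "int \<Rightarrow> real" where
  "hq d = (if d < 0 then 0 else 1 / qpoch (nat d))"

definition gauss :: "nat \<Rightarrow> int \<Rightarrow> real" where
  "gauss D d = (if d < 0 then 0 else (\<Prod>i<nat d. (1 - q ^ (D + i)) / (1 - q ^ Suc i)))"

lemma q_power_less_1: "0 < k \<Longrightarrow> q ^ k < 1"
  using q_pos q_less_1 by (metis power_Suc_less_one gr0_implies_Suc)

lemma q_powi_add: "q powi (a + b) = q powi a * q powi b"
  using q_pos by (simp add: power_int_add)

lemma q_powi_of_nat_mult: "q powi (int a * int b) = q ^ (a * b)"
  by (simp only: of_nat_mult[symmetric] power_int_of_nat)

lemma q_powi_mult_diff: "q powi (int a * (int b - c)) = q ^ (a * b) * q powi (int a * (- c))"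
proof -
  have "int a * (int b - c) = int a * int b + int a * (- c)"
    by (simp add: right_diff_distrib)
  then show ?thesis
    by (simp only: q_powi_add q_powi_of_nat_mult)
qed

lemma qpoch_pos: "0 < qpoch d"
  unfolding qpoch_def by (intro prod_pos) (simp add: q_power_less_1 del: power_Suc)

lemma qpoch_nonzero [simp]: "qpoch d \<noteq> 0"
  using qpoch_pos[of d] by simp

lemma qpoch_0 [simp]: "qpoch 0 = 1"
  by (simp add: qpoch_def)

lemma qpoch_Suc: "qpoch (Suc d) = qpoch d * (1 - q ^ Suc d)"
  by (simp add: qpoch_def)

lemma q_summable: "summable (\<lambda>i. q ^ Suc i)"
  using summable_geometric[of q] q_pos q_less_1 by (simp add: summable_Suc_iff)

lemma qpoch_tendsto: "qpoch \<longlonglongrightarrow> qpoch_inf" and qpoch_inf_nonzero: "qpoch_inf \<noteq> 0"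
proof -
  have "convergent_prod (\<lambda>i. 1 + - (q ^ Suc i))"
  proof (rule summable_imp_convergent_prod_real)
    show "summable (\<lambda>k. \<bar>- (q ^ Suc k)\<bar>)"
      using q_summable q_pos by (simp add: abs_mult power_abs)
    show "- (q ^ Suc k) \<noteq> -1" for k
      using q_power_less_1[of "Suc k"] by simp
  qed
  then have c: "convergent_prod (\<lambda>i. 1 - q ^ Suc i)"
    by simp
  show "qpoch_inf \<noteq> 0"
    unfolding qpoch_inf_def using q_power_less_1 by (intro prodinf_nonzero c) (metis less_irrefl right_minus_eq zero_less_Suc)
  have "(\<lambda>n. qpoch (Suc n)) \<longlonglongrightarrow> qpoch_inf"
    using convergent_prod_LIMSEQ[OF c] unfolding qpoch_def qpoch_inf_def lessThan_Suc_atMost .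
  then show "qpoch \<longlonglongrightarrow> qpoch_inf"
    by (rule LIMSEQ_imp_Suc)
qed

lemma qpoch_inf_pos: "0 < qpoch_inf"
proof -
  have "0 \<le> qpoch_inf"
    by (rule LIMSEQ_le_const[OF qpoch_tendsto]) (use qpoch_pos less_imp_le in blast)
  then show ?thesis
    using qpoch_inf_nonzero by simp
qed

section \<open>Partial sums of \<open>hq\<close> and of Gaussian binomial coefficients\<close>

lemma hq_nonneg: "0 \<le> hq d"
  using qpoch_pos by (simp add: hq_def less_imp_le)

text \<open>For d \<ge> 0 both sides weight the partitions with largest part exactly d + 1; the
  factor in front of \<open>hq\<close> is one copy of that part. At d = -1 both sides are 1.\<close>

lemma hq_step: "hq (d + 1) - hq d = q powi (d + 1) * hq (d + 1)"
proof (cases "d < 0")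
  case True
  show ?thesis
  proof (cases "d = -1")
    case False
    then show ?thesis
      using True by (simp add: hq_def)
  qed (simp add: hq_def)
next
  case False
  then obtain k where d: "d = int k"
    by (metis nonneg_int_cases not_less)
  have nz: "1 - q ^ Suc k \<noteq> 0"
    using q_power_less_1[of "Suc k"] by simp
  have h: "hq d = 1 / qpoch k" "hq (d + 1) = 1 / (qpoch k * (1 - q ^ Suc k))"
    by (simp_all add: hq_def d nat_add_distrib qpoch_Suc del: power_Suc)
  have p: "q powi (d + 1) = q ^ Suc k"
    by (metis d of_nat_Suc add.commute power_int_of_nat)
  show ?thesis
    unfolding h p using nz by (simp add: field_simps del: power_Suc)
qed

lemma hq_sum: "(\<Sum>z\<le>y. q powi (int z - int N) * hq (int z - int N)) = hq (int y - int N)"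
proof (induction y)
  case 0
  then show ?case by (cases "N = 0") (simp_all add: hq_def)
next
  case (Suc y)
  then show ?case
    using hq_step[of "int y - int N"] by (simp add: algebra_simps)
qed

lemma hq_tendsto: "(\<lambda>y. hq (int y - int N)) \<longlonglongrightarrow> 1 / qpoch_inf"
proof -
  have "(\<lambda>d. 1 / qpoch d) \<longlonglongrightarrow> 1 / qpoch_inf"
    by (intro tendsto_intros qpoch_tendsto qpoch_inf_nonzero)
  moreover have "(\<lambda>d. hq (int (d + N) - int N)) = (\<lambda>d. 1 / qpoch d)"
    by (simp add: hq_def)
  ultimately have "(\<lambda>d. hq (int (d + N) - int N)) \<longlonglongrightarrow> 1 / qpoch_inf"
    by simp
  then show ?thesis
    by (rule LIMSEQ_offset[where f = "\<lambda>y. hq (int y - int N)" and k = N])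
qed

lemma hq_has_sum: "((\<lambda>z. q powi (int z - int N) * hq (int z - int N)) has_sum 1 / qpoch_inf) UNIV"
proof (rule sums_nonneg_imp_has_sum)
  show "(\<lambda>z. q powi (int z - int N) * hq (int z - int N)) sums (1 / qpoch_inf)"
    unfolding sums_def_le hq_sum by (rule hq_tendsto)
  show "0 \<le> q powi (int z - int N) * hq (int z - int N)" for z
    using q_pos hq_nonneg by simp
qed

lemma gauss_0: "gauss 0 d = (if d = 0 then 1 else 0)"
proof -
  have "(\<Prod>i<nat d. (1 - q ^ i) / (1 - q ^ Suc i)) = 0" if "0 < d"
    using that by (intro prod_zero) (auto intro!: bexI[of _ 0])
  then show ?thesis
    by (auto simp: gauss_def)
qed

text \<open>\<open>gauss D d\<close> is the Gaussian binomial coefficient of D + d - 1 over d, and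
  this is its Pascal rule. Removing a part d + 1 also lowers the number of parts, which is why
  \<open>D\<close> drops here while \<open>hq_step\<close> returns to \<open>hq\<close>.\<close>

lemma gauss_step: "gauss (Suc D) (d + 1) - gauss (Suc D) d = q powi (d + 1) * gauss D (d + 1)"
proof (cases "d < 0")
  case True
  show ?thesis
  proof (cases "d = -1")
    case False
    then show ?thesis
      using True by (simp add: gauss_def)
  qed (simp add: gauss_def)
next
  case False
  then obtain k where d: "d = int k"
    by (metis nonneg_int_cases not_less)
  define R where "R = (\<Prod>i<k. (1 - q ^ (Suc D + i)) / (1 - q ^ Suc i))"
  have nz: "1 - q ^ Suc i \<noteq> 0" for i
    using q_power_less_1[of "Suc i"] by simp
  have shift: "(\<Prod>i<Suc k. 1 - q ^ (D + i)) = (1 - q ^ D) * (\<Prod>i<k. 1 - q ^ (Suc D + i))"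
    by (subst prod.lessThan_Suc_shift) simp
  have g0: "gauss (Suc D) d = R" and g1: "gauss (Suc D) (d + 1) = R * ((1 - q ^ (Suc D + k)) / (1 - q ^ Suc k))"
    by (simp_all add: gauss_def d R_def nat_add_distrib)
  have g2: "gauss D (d + 1) = R * ((1 - q ^ D) / (1 - q ^ Suc k))"
    unfolding gauss_def d R_def prod_dividef using shift by (simp add: nat_add_distrib)
  have p: "q powi (d + 1) = q ^ Suc k"
    by (metis d of_nat_Suc add.commute power_int_of_nat)
  show ?thesis
  proof -
    have "R * ((1 - q ^ (Suc D + k)) / (1 - q ^ Suc k)) - R = R * (((1 - q ^ (Suc D + k)) - (1 - q ^ Suc k)) / (1 - q ^ Suc k))"
    proof -
      have "R * (a / b) - R = R * ((a - b) / b)" if "b \<noteq> 0" for a b :: real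
        using that by (simp add: field_simps)
      then show ?thesis
        using nz[of k] by blast
    qed
    also have "(1 - q ^ (Suc D + k)) - (1 - q ^ Suc k) = q ^ Suc k * (1 - q ^ D)"
      by (simp add: power_add algebra_simps)
    finally show ?thesis
      unfolding g0 g1 g2 p by simp
  qed
qed

lemma gauss_sum: "(\<Sum>z\<le>y. q powi (int z - int N) * gauss D (int z - int N)) = gauss (Suc D) (int y - int N)"
proof (induction y)
  case 0
  then show ?case by (cases "N = 0") (simp_all add: gauss_def)
next
  case (Suc y)
  then show ?case
    using gauss_step[of D "int y - int N"] by (simp add: algebra_simps)
qed

lemma gauss_tendsto: "(\<lambda>D. gauss D d) \<longlonglongrightarrow> hq d"
proof (cases "d < 0")
  case False
  have "(\<lambda>D. \<Prod>i<nat d. (1 - q ^ (D + i)) / (1 - q ^ Suc i)) \<longlonglongrightarrow> (\<Prod>i<nat d. (1 - 0) / (1 - q ^ Suc i))"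
  proof (intro tendsto_intros)
    show "(\<lambda>D. q ^ (D + i)) \<longlonglongrightarrow> 0" for i
      using LIMSEQ_ignore_initial_segment[OF LIMSEQ_realpow_zero[of q], of i] q_pos q_less_1 by simp
    show "1 - q ^ Suc i \<noteq> 0" for i
      using q_power_less_1[of "Suc i"] by simp
  qed
  then show ?thesis
    using False by (simp add: gauss_def hq_def qpoch_def prod_dividef)
qed (simp add: gauss_def hq_def)

text \<open>Euler's first series, the sum of z^d/(q)_d with value 1/(z;q)_inf, at z = q^(A+1). Since
  1/(q)_(d-1) = (1 - q^d)/(q)_d, multiplying the series for A by q^(A+1) shifts it into the same
  series with weights 1 - q^d. The difference has weights q^d and is the series for A + 1.\<close>

lemma has_sum_powers_over_qpoch: "((\<lambda>d. q ^ (Suc A * d) / qpoch d) has_sum qpoch A / qpoch_inf) UNIV"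
proof (rule sums_nonneg_imp_has_sum)
  show "(\<lambda>d. q ^ (Suc A * d) / qpoch d) sums (qpoch A / qpoch_inf)"
  proof (induction A)
    case 0
    show ?case
      using has_sum_imp_sums[OF hq_has_sum[of 0]] by (simp add: hq_def)
  next
    case (Suc A)
    define f where "f d = q ^ (Suc A * d) / qpoch d" for d
    have "(\<lambda>d. q ^ Suc A * f d) sums (q ^ Suc A * (qpoch A / qpoch_inf))"
      using Suc f_def by (intro sums_mult) simp
    also have "(\<lambda>d. q ^ Suc A * f d) = (\<lambda>d. f (Suc d) * (1 - q ^ Suc d))"
    proof
      fix d
      have "1 - q ^ Suc d \<noteq> 0"
        using q_power_less_1[of "Suc d"] by simp
      then show "q ^ Suc A * f d = f (Suc d) * (1 - q ^ Suc d)"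
        by (simp add: f_def qpoch_Suc power_add)
    qed
    \<comment> \<open>The shift leaves out only the term d = 0, which vanishes because 1 - q^0 =
      0.\<close>
    finally have "(\<lambda>d. f d * (1 - q ^ d)) sums (q ^ Suc A * (qpoch A / qpoch_inf) + 0)"
      using sums_Suc[of "\<lambda>d. f d * (1 - q ^ d)"] by simp
    with Suc have "(\<lambda>d. f d - f d * (1 - q ^ d)) sums
        (qpoch A / qpoch_inf - (q ^ Suc A * (qpoch A / qpoch_inf) + 0))"
      unfolding f_def by (rule sums_diff)
    moreover have "f d - f d * (1 - q ^ d) = q ^ (Suc (Suc A) * d) / qpoch d" for d
    proof -
      have "f d - f d * (1 - q ^ d) = f d * q ^ d"
        by (simp add: right_diff_distrib)
      then show ?thesis
        by (simp add: f_def power_add mult_ac)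
    qed
    ultimately show ?case
      by (simp add: qpoch_Suc algebra_simps diff_divide_distrib)
  qed
  show "0 \<le> q ^ (Suc A * d) / qpoch d" for d
    using q_pos qpoch_pos[of d] by simp
qed

text \<open>The substitution \<alpha> = N + d: the factor q^(\<alpha> - N) raises the power from A d
  to (A + 1) d, and the terms with \<alpha> < N vanish with \<open>hq\<close>.\<close>

lemma has_sum_powers_hq:
  "((\<lambda>\<alpha>. q ^ (A * \<alpha>) * (q powi (int \<alpha> - int N) * hq (int \<alpha> - int N))) has_sum q ^ (A * N) * qpoch A / qpoch_inf) UNIV"
    (is "(?f has_sum _) _")
proof -
  have "((\<lambda>d. q ^ (A * N) * (q ^ (Suc A * d) / qpoch d)) has_sum q ^ (A * N) * (qpoch A / qpoch_inf)) UNIV"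
    by (intro has_sum_cmult_right has_sum_powers_over_qpoch)
  also have "(\<lambda>d. q ^ (A * N) * (q ^ (Suc A * d) / qpoch d)) = ?f \<circ> (\<lambda>d. N + d)"
    by (auto simp: fun_eq_iff o_def hq_def power_add algebra_simps)
  finally have "(?f has_sum q ^ (A * N) * (qpoch A / qpoch_inf)) (range (\<lambda>d. N + d))"
    by (subst has_sum_reindex) (auto simp: inj_on_def o_def)
  also have "?this \<longleftrightarrow> (?f has_sum q ^ (A * N) * (qpoch A / qpoch_inf)) UNIV"
  proof (rule has_sum_cong_neutral)
    fix x assume "x \<in> UNIV - range (\<lambda>d. N + d)"
    then have "x < N"
      by (metis DiffE le_add_diff_inverse not_le rangeI)
    then show "?f x = 0"
      by (simp add: hq_def)
  qed auto
  finally show ?thesis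
    by simp
qed

text \<open>Euler's second series is the sum of (-1)^A q^(A(A-1)/2) z^A/(q)_A. At z = q^(d+1) the
  power of q is A(A+1)/2 + A d, and this is the part of the numerator that is free of d.\<close>

definition theta_coeff :: "nat \<Rightarrow> real" where
  "theta_coeff A = (-1) ^ A * q ^ (A * (A + 1) div 2)"

lemma triangle_Suc: "Suc A * (Suc A + 1) div 2 = A * (A + 1) div 2 + Suc A"
  by simp

lemma theta_coeff_Suc: "theta_coeff (Suc A) = - (q ^ Suc A) * theta_coeff A"
  unfolding theta_coeff_def triangle_Suc by (simp add: power_add)

lemma theta_summable: "summable (\<lambda>A. norm (theta_coeff A * q powi (int A * c)))"
\<comment> \<open>Consecutive terms have a quotient of modulus q^(A + 1 + c), which is at most q as
  soon as A \<ge> -c.\<close>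
proof (rule summable_ratio_test[of q "nat (- c)"])
  fix A assume A: "nat (- c) \<le> A"
  have "\<bar>q ^ Suc A * q powi c\<bar> = q powi (int (Suc A) + c)"
    using q_pos by (simp only: q_powi_add power_int_of_nat) simp
  also have "\<dots> \<le> q powi 1"
    using A q_pos q_less_1 by (intro power_int_decreasing) auto
  finally have le: "\<bar>q ^ Suc A * q powi c\<bar> \<le> q"
    by simp
  have "theta_coeff (Suc A) * q powi (int (Suc A) * c) =
      - (q ^ Suc A * q powi c) * (theta_coeff A * q powi (int A * c))"
    by (simp add: theta_coeff_Suc distrib_right q_powi_add)
  then show "norm (norm (theta_coeff (Suc A) * q powi (int (Suc A) * c))) \<le>
      q * norm (norm (theta_coeff A * q powi (int A * c)))"
    using mult_right_mono[OF le abs_ge_zero, of "theta_coeff A * q powi (int A * c)"]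
    by (simp only: real_norm_def abs_mult abs_minus_cancel abs_idempotent)
qed (use q_less_1 in auto)

lemma theta_summable_on: "(\<lambda>A. norm (theta_coeff A * q powi (int A * c))) summable_on UNIV"
  using theta_summable by (intro summable_nonneg_imp_summable_on) auto

lemma qpoch_inf_le: "qpoch_inf \<le> qpoch d"
proof (rule LIMSEQ_le_const2[OF qpoch_tendsto])
  have "qpoch (d + k) \<le> qpoch d" for k
  proof (induction k)
    case (Suc k)
    have "qpoch (d + Suc k) \<le> qpoch (d + k) * 1"
      using qpoch_pos q_pos by (simp only: add_Suc_right qpoch_Suc) (intro mult_left_mono, auto simp: less_imp_le)
    then show ?case
      using Suc by simp
  qed simp
  then show "\<exists>N. \<forall>n\<ge>N. qpoch n \<le> qpoch d"
    by (metis le_add_diff_inverse)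
qed

text \<open>Euler's expansion of the entire function \<open>\<Prod>\<^sub>k (1 - z q\<^sup>k)\<close> at the points \<open>z = q\<^bsup>d+1\<^esup>\<close>.\<close>

lemma euler_summable: "summable (\<lambda>A. norm (theta_coeff A * q powi (int A * d) / qpoch A))"
proof (rule summable_comparison_test')
  show "summable (\<lambda>A. norm (theta_coeff A * q powi (int A * d)) * (1 / qpoch_inf))"
    by (intro summable_mult2 theta_summable)
  show "norm (norm (theta_coeff A * q powi (int A * d) / qpoch A)) \<le>
      norm (theta_coeff A * q powi (int A * d)) * (1 / qpoch_inf)" if "0 \<le> A" for A
    using qpoch_inf_le[of A] qpoch_inf_pos qpoch_pos[of A]
    by (simp add: frac_le)
qed

definition euler :: "int \<Rightarrow> real" where
  "euler d = (\<Sum>A. theta_coeff A * q powi (int A * d) / qpoch A)"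

lemma euler_sums: "(\<lambda>A. theta_coeff A * q powi (int A * d) / qpoch A) sums euler d"
  unfolding euler_def using summable_norm_cancel[OF euler_summable] by (rule summable_sums)

text \<open>The functional equation (z;q)_inf = (1 - z)(zq;q)_inf at z = q^(d+1). It is read off
  from the series: term A + 1 for d minus term A + 1 for d + 1 equals -q^(d+1) times term A for d +
  1.\<close>

lemma euler_step: "euler d = (1 - q powi (d + 1)) * euler (d + 1)"
proof -
  define f where "f d A = theta_coeff A * q powi (int A * d) / qpoch A" for d A
  have step: "f d (Suc A) - f (d + 1) (Suc A) = - (q powi (d + 1)) * f (d + 1) A" for A
  proof -
    have nz: "1 - q ^ Suc A \<noteq> 0"
      using q_power_less_1[of "Suc A"] by simp
    have "f (d + 1) (Suc A) = f d (Suc A) * q ^ Suc A"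
      unfolding f_def distrib_left q_powi_add by (simp add: power_int_of_nat del: of_nat_Suc power_Suc)
    then have "f d (Suc A) - f (d + 1) (Suc A) = f d (Suc A) * (1 - q ^ Suc A)"
      by (simp add: algebra_simps)
    also have "\<dots> = theta_coeff (Suc A) * q powi (int (Suc A) * d) / qpoch A"
      using nz by (simp add: f_def qpoch_Suc del: power_Suc of_nat_Suc)
    also have "\<dots> = - (q powi (d + 1)) * f (d + 1) A"
      by (simp add: f_def theta_coeff_Suc distrib_left distrib_right q_powi_add)
    finally show ?thesis .
  qed
  have "(\<lambda>A. - (q powi (d + 1)) * f (d + 1) A) sums (- (q powi (d + 1)) * euler (d + 1))"
    using euler_sums f_def by (intro sums_mult) simp
  then have "(\<lambda>A. f d A - f (d + 1) A) sums (- (q powi (d + 1)) * euler (d + 1) + (f d 0 - f (d + 1) 0))"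
    unfolding step[symmetric] by (rule sums_Suc)
  moreover have "(\<lambda>A. f d A - f (d + 1) A) sums (euler d - euler (d + 1))"
    unfolding f_def by (intro sums_diff euler_sums)
  ultimately have "euler d - euler (d + 1) = - (q powi (d + 1)) * euler (d + 1) + (f d 0 - f (d + 1) 0)"
    by (rule sums_unique2[symmetric])
  then show ?thesis
    by (simp add: f_def algebra_simps)
qed

text \<open>Fixes the constant that the functional equation leaves open. The series for d = 0
  dominates all those with d \<ge> 0, and only its term A = 0 survives in the limit.\<close>

lemma euler_tendsto: "(\<lambda>n. euler (int n)) \<longlonglongrightarrow> 1"
proof -
  define a where "a n A = theta_coeff A * q powi (int A * int n) / qpoch A" for n A
  have "(\<lambda>n. \<Sum>A. a n A) \<longlonglongrightarrow> (\<Sum>A. if A = 0 then 1 else 0)"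
  proof (rule conjunct2[OF conjunct2[OF tannerys_theorem]])
    show "(\<lambda>n. a n A) \<longlonglongrightarrow> (if A = 0 then 1 else 0)" for A
    proof (cases "A = 0")
      case False
      have "(\<lambda>n. theta_coeff A * (q ^ A) ^ n / qpoch A) \<longlonglongrightarrow> theta_coeff A * 0 / qpoch A"
        using False q_pos q_power_less_1[of A] by (intro tendsto_intros LIMSEQ_realpow_zero) auto
      moreover have "a n A = theta_coeff A * (q ^ A) ^ n / qpoch A" for n
        unfolding a_def by (simp only: of_nat_mult[symmetric] power_int_of_nat power_mult)
      ultimately show ?thesis
        using False by simp
    qed (simp add: a_def theta_coeff_def)
    show "\<forall>\<^sub>F (A, n) in sequentially \<times>\<^sub>F sequentially. norm (a n A) \<le> norm (theta_coeff A * q powi (int A * 0) / qpoch A)"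
    proof (rule always_eventually, safe)
      fix A n
      have "q powi (int A * int n) \<le> 1"
        using q_pos q_less_1 by (simp only: of_nat_mult[symmetric] power_int_of_nat) (simp add: power_le_one)
      then show "norm (a n A) \<le> norm (theta_coeff A * q powi (int A * 0) / qpoch A)"
        using q_pos qpoch_pos[of A] by (simp add: a_def abs_mult divide_right_mono mult_left_le)
    qed
    show "summable (\<lambda>A. norm (theta_coeff A * q powi (int A * 0) / qpoch A))"
      by (rule euler_summable)
  qed auto
  then show ?thesis
    unfolding euler_def a_def[symmetric] using suminf_finite[of "{0}" "\<lambda>A. if A = 0 then 1 else 0 :: real"]
    by (simp only: finite.intros sum.insert) simp
qed

text \<open>At d = -1 the factor 1 - q^(d+1) of the functional equation is 0, and this zero
  propagates to all smaller d. For d \<ge> 0 the product of \<open>euler d\<close> and (q)_d does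
  not depend on d, and its limit is (q)_inf.\<close>

lemma euler_eq: "euler d = qpoch_inf * hq d"
proof (cases "d < 0")
  case True
  have "euler (- int (Suc k)) = 0" for k
  proof (induction k)
    case 0
    show ?case using euler_step[of "-1"] by simp
  next
    case (Suc k)
    then show ?case using euler_step[of "- int (Suc (Suc k))"] by (simp add: algebra_simps)
  qed
  from this[of "nat (- d) - 1"] True show ?thesis
    by (simp add: hq_def)
next
  case False
  have const: "euler (int k) * qpoch k = euler 0" for k
  proof (induction k)
    case (Suc k)
    have "q powi (int k + 1) = q ^ Suc k"
      by (metis of_nat_Suc add.commute power_int_of_nat)
    then have "euler (int k) = (1 - q ^ Suc k) * euler (int (Suc k))"
      using euler_step[of "int k"] by (simp add: algebra_simps)
    then show ?case using Suc by (simp only: qpoch_Suc mult_ac)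
  qed simp
  have "(\<lambda>k. euler (int k) * qpoch k) \<longlonglongrightarrow> 1 * qpoch_inf"
    by (intro tendsto_mult euler_tendsto qpoch_tendsto)
  then have "euler 0 = qpoch_inf"
    unfolding const by (simp add: LIMSEQ_const_iff)
  moreover obtain k where d: "d = int k"
    using False by (metis nonneg_int_cases not_less)
  moreover have "euler (int k) = euler 0 / qpoch k"
    using const[of k] qpoch_nonzero[of k] by (metis nonzero_mult_div_cancel_right)
  ultimately show ?thesis
    by (simp add: hq_def)
qed

lemma hq_has_sum_powers:
  "((\<lambda>A. theta_coeff A * q powi (int A * d) / qpoch A) has_sum qpoch_inf * hq d) UNIV"
  using norm_summable_imp_has_sum[OF euler_summable euler_sums] by (simp add: euler_eq)

text \<open>The second \<open>hq\<close> is replaced by Euler's second series. Summing over \<alpha>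
  first, Euler's first series yields (q)_A, which cancels the denominator. The interchange is
  justified by q^(A \<alpha>) \<le> 1, which bounds the double series by a product of two convergent
  ones.\<close>

lemma has_sum_hq_hq:
  "((\<lambda>\<alpha>. q powi (int \<alpha> - int N) * hq (int \<alpha> - int N) * hq (int \<alpha> - int M)) has_sum
    (\<Sum>\<^sub>\<infinity>A. theta_coeff A * q powi (int A * (int N - int M))) / qpoch_inf ^ 2) UNIV"
proof -
  define g where "g \<alpha> = q powi (int \<alpha> - int N) * hq (int \<alpha> - int N)" for \<alpha> :: nat
  define u where "u A = theta_coeff A * q powi (int A * (- int M)) / qpoch A" for A
  define f where "f = (\<lambda>(\<alpha>, A). q ^ (A * \<alpha>) * g \<alpha> * u A)"
  have g: "(g has_sum 1 / qpoch_inf) UNIV" "\<And>\<alpha>. 0 \<le> g \<alpha>"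
    unfolding g_def using hq_has_sum hq_nonneg q_pos by auto
  have "(\<lambda>A. norm (u A)) summable_on UNIV"
    unfolding u_def using euler_summable[of "- int M"] by (intro summable_nonneg_imp_summable_on) auto
  then have u: "((\<lambda>A. norm (u A)) has_sum (\<Sum>\<^sub>\<infinity>A. norm (u A))) UNIV"
    by simp
  have "(\<lambda>(\<alpha>, A). g \<alpha> * norm (u A)) summable_on UNIV \<times> UNIV"
    using has_sum_times_real[OF g(1) u] by (rule has_sum_imp_summable)
  then have "(\<lambda>p. norm (f p)) summable_on UNIV \<times> UNIV"
  proof (rule summable_on_comparison_test)
    fix p :: "nat \<times> nat"
    obtain \<alpha> A where p: "p = (\<alpha>, A)" by (cases p)
    have "q ^ (A * \<alpha>) \<le> 1"
      using q_pos q_less_1 by (simp add: power_le_one)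
    then have "q ^ (A * \<alpha>) * (g \<alpha> * norm (u A)) \<le> 1 * (g \<alpha> * norm (u A))"
      using g(2)[of \<alpha>] by (intro mult_right_mono) auto
    then show "norm (f p) \<le> (case p of (\<alpha>, A) \<Rightarrow> g \<alpha> * norm (u A))"
      using g(2)[of \<alpha>] q_pos by (simp add: f_def p abs_mult)
  qed auto
  then have f: "f summable_on UNIV \<times> UNIV"
    by (metis summable_on_iff_abs_summable_on_real)
  have inner1: "((\<lambda>A. f (\<alpha>, A)) has_sum g \<alpha> * (qpoch_inf * hq (int \<alpha> - int M))) UNIV" for \<alpha>
  proof -
    have "f (\<alpha>, A) = g \<alpha> * (theta_coeff A * q powi (int A * (int \<alpha> - int M)) / qpoch A)" for A
    proof -
      show ?thesis
        unfolding q_powi_mult_diff[of A \<alpha>]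
        by (simp add: f_def u_def)
    qed
    then show ?thesis
      using has_sum_cmult_right[OF hq_has_sum_powers, of "g \<alpha>" "int \<alpha> - int M"] by simp
  qed
  have inner2: "((\<lambda>\<alpha>. f (\<alpha>, A)) has_sum theta_coeff A * q powi (int A * (int N - int M)) / qpoch_inf) UNIV" for A
  proof -
    have "((\<lambda>\<alpha>. q ^ (A * \<alpha>) * g \<alpha> * u A) has_sum q ^ (A * N) * qpoch A / qpoch_inf * u A) UNIV"
      unfolding g_def by (intro has_sum_cmult_left has_sum_powers_hq)
    then show ?thesis
      unfolding q_powi_mult_diff[of A N]
      by (simp add: f_def u_def mult_ac)
  qed
  have "((\<lambda>\<alpha>. g \<alpha> * (qpoch_inf * hq (int \<alpha> - int M))) has_sum infsum f (UNIV \<times> UNIV)) UNIV"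
    by (rule has_sum_SigmaD[OF has_sum_infsum[OF f]]) (rule inner1)
  moreover have "((\<lambda>A. theta_coeff A * q powi (int A * (int N - int M)) / qpoch_inf) has_sum infsum f (UNIV \<times> UNIV)) UNIV"
  proof (rule has_sum_SigmaD)
    have "((\<lambda>(A, \<alpha>). f (\<alpha>, A)) has_sum infsum f (UNIV \<times> UNIV)) (UNIV \<times> UNIV)"
    proof -
      have "((\<lambda>p. f (prod.swap p)) has_sum infsum f (UNIV \<times> UNIV)) UNIV"
        using has_sum_infsum[OF f] has_sum_reindex_bij_betw[OF bij_swap, of f] by simp
      moreover have "(\<lambda>p. f (prod.swap p)) = (\<lambda>(A, \<alpha>). f (\<alpha>, A))"
        by auto
      ultimately show ?thesis
        by simp
    qed
    then show "((\<lambda>(A, \<alpha>). f (\<alpha>, A)) has_sum infsum f (UNIV \<times> UNIV)) (Sigma UNIV (\<lambda>_. UNIV))" .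
  qed (use inner2 in simp)
  then have "((\<lambda>A. theta_coeff A * q powi (int A * (int N - int M)) / qpoch_inf * qpoch_inf) has_sum
      infsum f (UNIV \<times> UNIV) * qpoch_inf) UNIV"
    by (rule has_sum_cmult_left)
  then have "(\<Sum>\<^sub>\<infinity>A. theta_coeff A * q powi (int A * (int N - int M))) = infsum f (UNIV \<times> UNIV) * qpoch_inf"
    using qpoch_inf_nonzero by (intro infsumI) simp
  then have "infsum f (UNIV \<times> UNIV) = (\<Sum>\<^sub>\<infinity>A. theta_coeff A * q powi (int A * (int N - int M))) / qpoch_inf"
    using qpoch_inf_nonzero by simp
  ultimately have "((\<lambda>\<alpha>. g \<alpha> * (qpoch_inf * hq (int \<alpha> - int M)) * (1 / qpoch_inf)) has_sum
      (\<Sum>\<^sub>\<infinity>A. theta_coeff A * q powi (int A * (int N - int M))) / qpoch_inf * (1 / qpoch_inf)) UNIV"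
    by (intro has_sum_cmult_left) simp
  then show ?thesis
    using qpoch_inf_nonzero by (simp add: g_def power2_eq_square mult.assoc)
qed

end

section \<open>Half arrays\<close>

text \<open>
  The part of an array on and above its main diagonal (the one through \<open>(n, m)\<close>) is stored as
  \<open>b k i\<close>: the entry of row \<open>i\<close> on the \<open>k\<close>-th diagonal to the right of the main one, shifted by
  \<open>n - i\<close> so that columns become strict. Row \<open>i\<close> leaves the infinite region at diagonal \<open>s i\<close>, and
  \<open>b k i\<close> is the junk value 0 for \<open>k < s i\<close>. Dropping the main diagonal replaces \<open>s i\<close> by the truncated
  difference \<open>s i - 1\<close>. The part below the main diagonal is stored in the same way after transposition.
\<close>

definition staircase :: "nat \<Rightarrow> (nat \<Rightarrow> nat) \<Rightarrow> bool" where
  "staircase n s \<longleftrightarrow> (\<forall>i\<in>{1..<n}. s (Suc i) \<le> s i - 1)"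

definition admissible :: "nat \<Rightarrow> (nat \<Rightarrow> nat) \<Rightarrow> (nat \<Rightarrow> nat) \<Rightarrow> bool" where
  "admissible n s Y \<longleftrightarrow> (\<forall>i. i \<notin> {1..n} \<or> 0 < s i \<longrightarrow> Y i = 0) \<and>
     (\<forall>i\<in>{1..<n}. s i = 0 \<longrightarrow> Y (Suc i) < Y i)"

text \<open>\<open>b k i\<close> stands for the cell in row i and column i + k + m - n. The third
  condition thus compares neighbours in a row and the fourth neighbours in a column:
  \<open>b k (Suc i)\<close> lies directly below \<open>b (Suc k) i\<close>, and the shift by n - i
  makes that inequality strict.\<close>

definition half_chains :: "nat \<Rightarrow> (nat \<Rightarrow> nat) \<Rightarrow> (nat \<Rightarrow> nat) \<Rightarrow> (nat \<Rightarrow> nat \<Rightarrow> nat) set" where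
  "half_chains n s Y = {b. b 0 = Y \<and>
     (\<forall>k i. i \<notin> {1..n} \<or> k < s i \<longrightarrow> b k i = 0) \<and>
     (\<forall>k. \<forall>i\<in>{1..n}. s i \<le> k \<longrightarrow> b (Suc k) i \<le> b k i) \<and>
     (\<forall>k. \<forall>i\<in>{1..<n}. s i \<le> Suc k \<longrightarrow> b k (Suc i) < b (Suc k) i)}"

definition half_arrays :: "nat \<Rightarrow> (nat \<Rightarrow> nat) \<Rightarrow> (nat \<Rightarrow> nat) \<Rightarrow> (nat \<Rightarrow> nat) \<Rightarrow> (nat \<Rightarrow> nat \<Rightarrow> nat) set" where
  "half_arrays n s N Y = {b \<in> half_chains n s Y. \<forall>i\<in>{1..n}. \<forall>\<^sub>F k in sequentially. b k i = N i}"

text \<open>These sets exhaust \<open>half_arrays\<close> as \<open>D\<close> grows and admit an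
  induction on \<open>D\<close> that starts from an array equal to \<open>N\<close> on every
  diagonal.\<close>

definition half_arrays_upto ::
    "nat \<Rightarrow> (nat \<Rightarrow> nat) \<Rightarrow> (nat \<Rightarrow> nat) \<Rightarrow> nat \<Rightarrow> (nat \<Rightarrow> nat) \<Rightarrow> (nat \<Rightarrow> nat \<Rightarrow> nat) set" where
  "half_arrays_upto n s N D Y = {b \<in> half_chains n s Y. \<forall>i\<in>{1..n}. \<forall>k\<ge>D. b k i = N i}"

text \<open>The diagonals that may follow \<open>Y\<close>. The bound is \<open>1 < s i\<close>
  because \<open>Z\<close> is diagonal 1; a row with \<open>s i = 1\<close> has an infinite left
  neighbour and hence no upper bound.\<close>

definition half_steps :: "nat \<Rightarrow> (nat \<Rightarrow> nat) \<Rightarrow> (nat \<Rightarrow> nat) \<Rightarrow> (nat \<Rightarrow> nat) set" where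
  "half_steps n s Y = {Z. (\<forall>i. i \<notin> {1..n} \<or> 1 < s i \<longrightarrow> Z i = 0) \<and>
     (\<forall>i\<in>{1..n}. s i = 0 \<longrightarrow> Z i \<le> Y i) \<and> (\<forall>i\<in>{1..<n}. s i \<le> 1 \<longrightarrow> Y (Suc i) < Z i)}"

definition half_cells :: "nat \<Rightarrow> (nat \<Rightarrow> nat) \<Rightarrow> (nat \<times> nat) set" where
  "half_cells n s = {(k, i). 1 \<le> k \<and> i \<in> {1..n} \<and> s i \<le> k}"

definition half_weight :: "nat \<Rightarrow> (nat \<Rightarrow> nat) \<Rightarrow> (nat \<Rightarrow> nat) \<Rightarrow> (nat \<Rightarrow> nat \<Rightarrow> nat) \<Rightarrow> int" where
  "half_weight n s N b = (\<Sum>\<^sub>\<infinity>(k, i)\<in>half_cells n s. int (b k i) - int (N i))"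

section \<open>Removing the main diagonal from a half array\<close>

lemma half_chains_Suc_iff:
  assumes "admissible n s Y"
  shows "b \<in> half_chains n s Y \<longleftrightarrow>
    b 0 = Y \<and> b 1 \<in> half_steps n s Y \<and> b \<circ> Suc \<in> half_chains n (\<lambda>i. s i - 1) (b 1)"
    (is "?L \<longleftrightarrow> ?R")
proof
  assume ?L
  then show ?R
    using assms unfolding half_chains_def half_steps_def
    by (auto simp: less_diff_conv le_diff_conv)
next
  assume R: ?R
  have 1: "b k i = 0" if "i \<notin> {1..n} \<or> k < s i" for k i
    using R that assms unfolding half_chains_def admissible_def
    by (cases k) (auto simp: less_diff_conv)
  have 2: "b (Suc k) i \<le> b k i" if "i \<in> {1..n}" "s i \<le> k" for k i
    using R that unfolding half_chains_def half_steps_def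
    by (cases k) (auto simp: le_diff_conv)
  have 3: "b k (Suc i) < b (Suc k) i" if "i \<in> {1..<n}" "s i \<le> Suc k" for k i
    using R that unfolding half_chains_def half_steps_def
    by (cases k) (auto simp: le_diff_conv)
  show ?L
    unfolding half_chains_def mem_Collect_eq
    by (intro conjI allI ballI impI) (simp_all only: R 1 2 3)
qed

lemma half_arrays_Suc_iff:
  assumes "admissible n s Y"
  shows "b \<in> half_arrays n s N Y \<longleftrightarrow>
    b 0 = Y \<and> b 1 \<in> half_steps n s Y \<and> b \<circ> Suc \<in> half_arrays n (\<lambda>i. s i - 1) N (b 1)"
  using half_chains_Suc_iff[OF assms, of b]
  unfolding half_arrays_def by (auto simp: eventually_sequentially_Suc[of "\<lambda>k. b k _ = N _"])

lemma half_arrays_upto_Suc_iff: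
  assumes "admissible n s Y"
  shows "b \<in> half_arrays_upto n s N (Suc D) Y \<longleftrightarrow>
    b 0 = Y \<and> b 1 \<in> half_steps n s Y \<and> b \<circ> Suc \<in> half_arrays_upto n (\<lambda>i. s i - 1) N D (b 1)"
proof -
  have "(\<forall>k\<ge>Suc D. b k i = N i) \<longleftrightarrow> (\<forall>k\<ge>D. b (Suc k) i = N i)" for i
    by (metis Suc_le_D Suc_le_mono)
  then show ?thesis
    using half_chains_Suc_iff[OF assms, of b] unfolding half_arrays_upto_def by auto
qed

text \<open>Strict decrease comes from Z_(i+1) \<le> Y_(i+1) < Z_i. The first inequality is
  available because the staircase condition makes row i + 1 finite already on the main diagonal when
  row i is finite on the next one.\<close>

lemma half_steps_admissible:
  assumes "staircase n s" "Z \<in> half_steps n s Y"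
  shows "admissible n (\<lambda>i. s i - 1) Z"
  unfolding admissible_def
proof (intro conjI allI ballI impI)
  show "Z i = 0" if "i \<notin> {1..n} \<or> 0 < s i - 1" for i
  proof -
    have "i \<notin> {1..n} \<or> 1 < s i"
      using that by auto
    then show ?thesis
      using assms(2) unfolding half_steps_def by blast
  qed
next
  fix i assume i: "i \<in> {1..<n}" "s i - 1 = 0"
  moreover have "s (Suc i) \<le> s i - 1"
    using assms(1) i unfolding staircase_def by blast
  ultimately have "s (Suc i) = 0"
    by simp
  then have "Z (Suc i) \<le> Y (Suc i)"
    using assms(2) i by (simp add: half_steps_def)
  also have "\<dots> < Z i"
    using assms(2) i by (simp add: half_steps_def)
  finally show "Z (Suc i) < Z i" .
qed

lemma half_arrays_eq_UN: "half_arrays n s N Y = (\<Union>D. half_arrays_upto n s N D Y)"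
proof (intro equalityI subsetI)
  fix b assume b: "b \<in> half_arrays n s N Y"
  then have "\<forall>\<^sub>F k in sequentially. \<forall>i\<in>{1..n}. b k i = N i"
    unfolding half_arrays_def by (intro eventually_ball_finite) auto
  then show "b \<in> (\<Union>D. half_arrays_upto n s N D Y)"
    using b by (auto simp: half_arrays_def half_arrays_upto_def eventually_sequentially)
next
  fix b assume "b \<in> (\<Union>D. half_arrays_upto n s N D Y)"
  then show "b \<in> half_arrays n s N Y"
    unfolding half_arrays_def half_arrays_upto_def by (auto simp: eventually_sequentially)
qed

text \<open>Makes the natural subtraction of n - i in \<open>array_of\<close> exact.\<close>

lemma half_arrays_limit_le:
  assumes "b \<in> half_arrays n s N Y" "i \<in> {1..n}" "s i \<le> k"
  shows "N i \<le> b k i"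
proof -
  have "\<forall>\<^sub>F j in sequentially. b j i = N i"
    using assms by (simp add: half_arrays_def)
  then obtain K where K: "\<And>j. K \<le> j \<Longrightarrow> b j i = N i"
    unfolding eventually_sequentially by blast
  have "b (k + d) i \<le> b k i" for d
  proof (induction d)
    case (Suc d)
    have "b (Suc (k + d)) i \<le> b (k + d) i"
      using assms by (auto simp: half_arrays_def half_chains_def)
    then show ?case
      using Suc by simp
  qed simp
  from this[of K] show ?thesis
    by (simp add: K)
qed

lemma half_weight_summable:
  assumes "b \<in> half_arrays n s N Y"
  shows "(\<lambda>(k, i). int (b k i) - int (N i)) summable_on half_cells n s"
proof -
  have "\<forall>\<^sub>F k in sequentially. \<forall>i\<in>{1..n}. b k i = N i"
    using assms unfolding half_arrays_def by (intro eventually_ball_finite) auto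
  then obtain K where K: "\<And>k i. K \<le> k \<Longrightarrow> i \<in> {1..n} \<Longrightarrow> b k i = N i"
    unfolding eventually_sequentially by blast
  have "finite (half_cells n s \<inter> {..<K} \<times> {1..n})"
    by simp
  moreover have "k < K" if "(k, i) \<in> half_cells n s" "b k i \<noteq> N i" for k i
    using K[of k i] that by (metis (no_types, lifting) case_prodD half_cells_def mem_Collect_eq not_le)
  ultimately show ?thesis
    by (intro has_sum_imp_summable[OF has_sum_finite_neutralI[OF _ _ _ refl,
          of "half_cells n s \<inter> {..<K} \<times> {1..n}"]]) (auto simp: half_cells_def)
qed

lemma half_weight_Suc:
  assumes "b \<in> half_arrays n s N Y" "admissible n s Y"
  shows "half_weight n s N b =
    (\<Sum>i | i \<in> {1..n} \<and> s i \<le> 1. int (b 1 i) - int (N i)) + half_weight n (\<lambda>i. s i - 1) N (b \<circ> Suc)"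
proof -
  define f where "f = (\<lambda>(k, i). int (b k i) - int (N i))"
  define A where "A = Pair (1::nat) ` {i. i \<in> {1..n} \<and> s i \<le> 1}"
  define g :: "nat \<times> nat \<Rightarrow> nat \<times> nat" where "g = (\<lambda>(k, i). (Suc k, i))"
  have inj: "inj_on g X" for X
    by (auto simp: g_def inj_on_def)
  have cells: "half_cells n s = A \<union> g ` half_cells n (\<lambda>i. s i - 1)"
  proof (intro equalityI subsetI)
    fix p assume "p \<in> half_cells n s"
    then obtain k i where p: "p = (k, i)" "1 \<le> k" "i \<in> {1..n}" "s i \<le> k"
      by (auto simp: half_cells_def)
    show "p \<in> A \<union> g ` half_cells n (\<lambda>i. s i - 1)"
    proof (cases "k = 1")
      case False
      then have "p = g (k - 1, i)" "(k - 1, i) \<in> half_cells n (\<lambda>i. s i - 1)"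
        using p by (auto simp: g_def half_cells_def)
      then show ?thesis by blast
    qed (use p in \<open>auto simp: A_def\<close>)
  qed (auto simp: A_def g_def half_cells_def)
  have sum: "f summable_on half_cells n s"
    using half_weight_summable[OF assms(1)] by (simp add: f_def)
  have b': "b \<circ> Suc \<in> half_arrays n (\<lambda>i. s i - 1) N (b 1)"
    using assms half_arrays_Suc_iff by blast
  have fg: "f \<circ> g = (\<lambda>(k, i). int ((b \<circ> Suc) k i) - int (N i))"
    by (auto simp: f_def g_def)
  have "f summable_on g ` half_cells n (\<lambda>i. s i - 1)"
    using half_weight_summable[OF b'] by (subst summable_on_reindex[OF inj]) (simp add: fg)
  moreover have "finite A"
    by (simp add: A_def)
  moreover have "A \<inter> g ` half_cells n (\<lambda>i. s i - 1) = {}"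
    by (auto simp: A_def g_def half_cells_def)
  ultimately have "infsum f (half_cells n s) = infsum f A + infsum f (g ` half_cells n (\<lambda>i. s i - 1))"
    unfolding cells by (intro infsum_Un_disjoint) auto
  also have "infsum f (g ` half_cells n (\<lambda>i. s i - 1)) = half_weight n (\<lambda>i. s i - 1) N (b \<circ> Suc)"
    by (subst infsum_reindex[OF inj]) (simp add: fg half_weight_def)
  also have "infsum f A = (\<Sum>i | i \<in> {1..n} \<and> s i \<le> 1. int (b 1 i) - int (N i))"
    unfolding A_def by (subst infsum_finite, simp, subst sum.reindex) (auto simp: inj_on_def f_def)
  finally show ?thesis
    by (simp add: half_weight_def f_def)
qed

lemma half_weight_0:
  assumes "\<And>k i. i \<in> {1..n} \<Longrightarrow> b k i = N i"
  shows "half_weight n s N b = 0"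
  unfolding half_weight_def by (rule infsum_0) (use assms in \<open>auto simp: half_cells_def\<close>)

text \<open>The induction step over diagonals, shared by the arrays that settle by a fixed diagonal
  and by all arrays. Sequences are grouped by their entry at 1, and nonnegativity turns the iterated
  sum into a sum over the whole set.\<close>

lemma has_sum_first_step:
  fixes f f' :: "(nat \<Rightarrow> 'a) \<Rightarrow> real"
  assumes X: "\<And>b. b \<in> X \<longleftrightarrow> b 0 = Y \<and> b 1 \<in> S \<and> b \<circ> Suc \<in> X' (b 1)"
    and X': "\<And>Z b. b \<in> X' Z \<Longrightarrow> b 0 = Z"
    and f: "\<And>b. b \<in> X \<Longrightarrow> f b = g (b 1) * f' (b \<circ> Suc)"
    and nonneg: "\<And>Z b. Z \<in> S \<Longrightarrow> b \<in> X' Z \<Longrightarrow> 0 \<le> g Z * f' b"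
    and inner: "\<And>Z. Z \<in> S \<Longrightarrow> (f' has_sum G Z) (X' Z)"
    and outer: "((\<lambda>Z. g Z * G Z) has_sum s) S"
  shows "(f has_sum s) X"
proof -
  have inner': "((\<lambda>b. case (Z, b) of (Z, b) \<Rightarrow> g Z * f' b) has_sum g Z * G Z) (X' Z)" if "Z \<in> S" for Z
    using has_sum_cmult_right[OF inner[OF that]] by simp
  have "((\<lambda>(Z, b). g Z * f' b) has_sum s) (Sigma S X')"
  proof (rule has_sum_SigmaI[OF inner' outer])
    show "(\<lambda>(Z, b). g Z * f' b) summable_on Sigma S X'"
      using inner' nonneg has_sum_imp_summable[OF outer]
      by (intro summable_on_SigmaI[where g = "\<lambda>Z. g Z * G Z"]) auto
  qed
  also have "?this \<longleftrightarrow> (f has_sum s) X"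
  proof (rule has_sum_reindex_bij_witness[of _ "\<lambda>b. (b 1, b \<circ> Suc)" "\<lambda>(Z, b). case_nat Y b"])
    fix p assume p: "p \<in> Sigma S X'"
    then obtain Z b where p': "p = (Z, b)" "Z \<in> S" "b \<in> X' Z"
      by auto
    have c: "case_nat Y b 1 = Z" "case_nat Y b \<circ> Suc = b"
      using X'[OF p'(3)] by (auto simp: fun_eq_iff)
    show "((case p of (Z, b) \<Rightarrow> case_nat Y b) 1, (case p of (Z, b) \<Rightarrow> case_nat Y b) \<circ> Suc) = p"
      using c p' by simp
    show mem: "(case p of (Z, b) \<Rightarrow> case_nat Y b) \<in> X"
      using c p' by (simp add: X)
    show "f (case p of (Z, b) \<Rightarrow> case_nat Y b) = (case p of (Z, b) \<Rightarrow> g Z * f' b)"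
      using f[OF mem] c p' by simp
  next
    fix b assume b: "b \<in> X"
    then show "(b 1, b \<circ> Suc) \<in> Sigma S X'"
      by (simp add: X)
    have "case_nat Y (b \<circ> Suc) k = b k" for k
      using b X by (cases k) auto
    then show "(case (b 1, b \<circ> Suc) of (Z, b) \<Rightarrow> case_nat Y b) = b"
      by auto
  qed simp
  finally show ?thesis .
qed

text \<open>Monotone convergence: every finite subset of the union already lies in a single
  \<open>X D\<close>.\<close>

lemma has_sum_increasing_union:
  fixes f :: "'a \<Rightarrow> real"
  assumes mono: "\<And>D. X D \<subseteq> X (Suc D)"
    and nonneg: "\<And>x. x \<in> (\<Union>D. X D) \<Longrightarrow> 0 \<le> f x"
    and sums: "\<And>D. (f has_sum s D) (X D)"
    and lim: "s \<longlonglongrightarrow> S"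
  shows "(f has_sum S) (\<Union>D. X D)"
proof -
  have mono': "X D \<subseteq> X E" if "D \<le> E" for D E
    by (rule lift_Suc_mono_le[of X, OF mono that])
  have le: "s D \<le> s E" if "D \<le> E" for D E
    using has_sum_mono2[OF sums sums mono'[OF that]] nonneg by blast
  have bound: "s D \<le> S" for D
    by (rule LIMSEQ_le_const[OF lim]) (use le in blast)
  have fin: "sum f F \<le> S" if F: "finite F" "F \<subseteq> (\<Union>D. X D)" for F
  proof -
    have "\<exists>D. F \<subseteq> X D"
      using F
    proof (induction F rule: finite_induct)
      case (insert x F)
      then obtain D E where "F \<subseteq> X D" "x \<in> X E"
        by auto
      then have "insert x F \<subseteq> X (max D E)"
        using mono'[of D "max D E"] mono'[of E "max D E"] by auto
      then show ?case by blast
    qed simp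
    then obtain D where D: "F \<subseteq> X D" by blast
    have "sum f F \<le> s D"
      using has_sum_mono2[OF has_sum_finite[OF F(1)] sums D] nonneg by blast
    then show ?thesis
      using bound[of D] by simp
  qed
  have summable: "f summable_on (\<Union>D. X D)"
  proof (rule nonneg_bounded_partial_sums_imp_summable_on[of _ _ S])
    show "\<forall>\<^sub>F F in finite_subsets_at_top (\<Union>D. X D). sum f F \<le> S"
      using fin by (intro eventually_finite_subsets_at_top_weakI)
  qed (use nonneg in auto)
  have "infsum f (\<Union>D. X D) \<le> S"
    by (rule infsum_le_finite_sums[OF summable fin])
  moreover have "S \<le> infsum f (\<Union>D. X D)"
  proof (rule LIMSEQ_le_const2[OF lim], intro exI allI impI)
    show "s D \<le> infsum f (\<Union>D. X D)" for D
      using has_sum_mono2[OF sums has_sum_infsum[OF summable], of D] nonneg by blast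
  qed
  ultimately have "infsum f (\<Union>D. X D) = S"
    by (rule antisym)
  then show ?thesis
    using has_sum_infsum[OF summable] by (simp only:)
qed

section \<open>Permutations and tuples\<close>

definition pairs_below :: "nat \<Rightarrow> (nat \<times> nat) set" where
  "pairs_below n = {(i, j). 1 \<le> i \<and> i < j \<and> j \<le> n}"

lemma finite_pairs_below: "finite (pairs_below n)"
  by (rule finite_subset[of _ "{1..n} \<times> {1..n}"]) (auto simp: pairs_below_def)

lemma inversions_power:
  "(-1 :: int) ^ inversions n \<sigma> = (\<Prod>(i, j)\<in>pairs_below n. if \<sigma> j < \<sigma> i then -1 else 1)"
proof -
  have "{(i, j). 1 \<le> i \<and> i < j \<and> j \<le> n \<and> \<sigma> j < \<sigma> i} = {p \<in> pairs_below n. \<sigma> (snd p) < \<sigma> (fst p)}"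
    by (auto simp: pairs_below_def)
  then have "(-1 :: int) ^ inversions n \<sigma> = (\<Prod>p\<in>{p \<in> pairs_below n. \<sigma> (snd p) < \<sigma> (fst p)}. -1)"
    by (simp add: inversions_def)
  also have "\<dots> = (\<Prod>p\<in>pairs_below n. if \<sigma> (snd p) < \<sigma> (fst p) then -1 else 1)"
    by (rule prod.inter_filter[OF finite_pairs_below])
  finally show ?thesis
    by (simp add: case_prod_beta')
qed

text \<open>The composition reverses a pair if and only if exactly one of these happens: \<tau>
  reverses the pair, or \<sigma> reverses its image. The sorted image \<open>f \<tau>\<close> is a
  bijection on pairs, so the factors of \<sigma> over the images are its factors over all
  pairs.\<close>

lemma inversions_compose:
  assumes \<tau>: "\<tau> permutes {1..n}" and \<sigma>: "\<sigma> permutes {1..n}"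
  shows "(-1 :: int) ^ inversions n (\<sigma> \<circ> \<tau>) = (-1) ^ inversions n \<sigma> * (-1) ^ inversions n \<tau>"
proof -
  define sg :: "(nat \<Rightarrow> nat) \<Rightarrow> nat \<times> nat \<Rightarrow> int" where "sg \<sigma> = (\<lambda>(i, j). if \<sigma> j < \<sigma> i then -1 else 1)" for \<sigma>
  define f where "f \<tau> = (\<lambda>(i, j). (min (\<tau> i) (\<tau> j), max (\<tau> i) (\<tau> j)))" for \<tau> :: "nat \<Rightarrow> nat"
  have inj: "\<tau> i = \<tau> j \<longleftrightarrow> i = j" "\<sigma> i = \<sigma> j \<longleftrightarrow> i = j" for i j
    using permutes_inj[OF \<tau>] permutes_inj[OF \<sigma>] by (auto dest: injD)
  have mem: "f \<tau> p \<in> pairs_below n" if t: "\<tau> permutes {1..n}" and tp: "p \<in> pairs_below n" for \<tau> p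
  proof -
    obtain i j where p: "p = (i, j)" "1 \<le> i" "i < j" "j \<le> n"
      using tp by (auto simp: pairs_below_def)
    have "\<tau> i \<in> {1..n}" "\<tau> j \<in> {1..n}"
      using permutes_in_image[OF t] p by auto
    moreover have "\<tau> i \<noteq> \<tau> j"
      using permutes_inj[OF t] p by (auto dest: injD)
    ultimately show ?thesis
      by (auto simp: p f_def pairs_below_def)
  qed
  have inv: "f (inv \<tau>) (f \<tau> p) = p" if t: "\<tau> permutes {1..n}" and tp: "p \<in> pairs_below n" for \<tau> p
  proof -
    obtain i j where p: "p = (i, j)" "i < j"
      using tp by (auto simp: pairs_below_def)
    then show ?thesis
      using permutes_inverses[OF t] by (cases "\<tau> i < \<tau> j") (auto simp: f_def)
  qed
  have bij: "bij_betw (f \<tau>) (pairs_below n) (pairs_below n)"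
  proof (rule bij_betw_byWitness[where f' = "f (inv \<tau>)"])
    show "\<forall>p\<in>pairs_below n. f (inv \<tau>) (f \<tau> p) = p"
      using inv[OF \<tau>] by blast
    show "\<forall>p\<in>pairs_below n. f \<tau> (f (inv \<tau>) p) = p"
      using inv[OF permutes_inv[OF \<tau>]] inv_inv_eq[OF permutes_bij[OF \<tau>]] by simp
  qed (use mem[OF \<tau>] mem[OF permutes_inv[OF \<tau>]] in auto)
  have "sg (\<sigma> \<circ> \<tau>) p = sg \<tau> p * sg \<sigma> (f \<tau> p)" if tp: "p \<in> pairs_below n" for p
  proof -
    obtain i j where p: "p = (i, j)" "i < j"
      using tp by (auto simp: pairs_below_def)
    have "\<tau> i \<noteq> \<tau> j" "\<sigma> (\<tau> i) \<noteq> \<sigma> (\<tau> j)"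
      using p inj by auto
    then show ?thesis
      by (cases "\<tau> i < \<tau> j") (auto simp: p sg_def f_def)
  qed
  then have "(\<Prod>p\<in>pairs_below n. sg (\<sigma> \<circ> \<tau>) p) = (\<Prod>p\<in>pairs_below n. sg \<tau> p) * (\<Prod>p\<in>pairs_below n. sg \<sigma> (f \<tau> p))"
    by (simp add: prod.distrib)
  also have "(\<Prod>p\<in>pairs_below n. sg \<sigma> (f \<tau> p)) = (\<Prod>p\<in>pairs_below n. sg \<sigma> p)"
    by (rule prod.reindex_bij_betw[OF bij])
  finally show ?thesis
    by (simp add: inversions_power sg_def mult.commute)
qed

text \<open>The inversions are (a, b) and, for every c strictly between, (a, c) and (c, b): an odd
  number.\<close>

lemma inversions_transpose:
  assumes "1 \<le> a" "a < b" "b \<le> n"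
  shows "(-1 :: int) ^ inversions n (Transposition.transpose a b) = -1"
proof -
  have "{(i, j). 1 \<le> i \<and> i < j \<and> j \<le> n \<and> Transposition.transpose a b j < Transposition.transpose a b i} =
      insert (a, b) (Pair a ` {a<..<b} \<union> (\<lambda>i. (i, b)) ` {a<..<b})"
    using assms by (auto simp: Transposition.transpose_def split: if_splits)
  moreover have "card (Pair a ` {a<..<b} \<union> (\<lambda>i. (i, b)) ` {a<..<b}) = card {a<..<b} + card {a<..<b}"
    by (subst card_Un_disjoint) (auto simp: card_image inj_on_def)
  moreover have "(a, b) \<notin> Pair a ` {a<..<b} \<union> (\<lambda>i. (i, b)) ` {a<..<b}"
    by auto
  ultimately have "inversions n (Transposition.transpose a b) = Suc (card {a<..<b} + card {a<..<b})"
    unfolding inversions_def by simp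
  then show ?thesis
    by (simp add: power_add[symmetric] mult_2[symmetric] del: card_greaterThanLessThan)
qed

text \<open>Both sides are multiplicative and equal -1 on transpositions, which generate all
  permutations.\<close>

lemma sign_eq_inversions:
  assumes "\<sigma> permutes {1..n}"
  shows "sign \<sigma> = (-1) ^ inversions n \<sigma>"
proof -
  show ?thesis
    using assms finite_atLeastAtMost[of 1 n]
  proof (induction \<sigma> rule: permutes_induct)
    case id
    have "{(i, j). 1 \<le> i \<and> i < j \<and> j \<le> n \<and> id j < id i} = {}"
      by auto
    then have "inversions n id = 0"
      by (simp only: inversions_def card.empty)
    then show ?case by (simp only: sign_id power_0)
  next
    case (swap a b p)
    have t: "Transposition.transpose a b permutes {1..n}"
      using swap by (intro permutes_swap_id)
    have A: "(-1 :: int) ^ inversions n (Transposition.transpose a b) = -1"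
      using swap inversions_transpose[of a b n] inversions_transpose[of b a n]
      by (cases "a < b") (auto simp: Transposition.transpose_commute)
    have B: "sign (Transposition.transpose a b \<circ> p) = sign (Transposition.transpose a b) * sign p"
      using swap t by (intro sign_compose) (auto intro: permutes_imp_permutation)
    have C: "sign (Transposition.transpose a b) = -1"
      using swap by (simp add: sign_swap_id)
    have D: "(-1 :: int) ^ inversions n (Transposition.transpose a b \<circ> p) =
        (-1) ^ inversions n (Transposition.transpose a b) * (-1) ^ inversions n p"
      using swap t by (intro inversions_compose)
    show ?case
      by (simp only: A B C D swap.IH)
  qed
qed

text \<open>The rows that are finite on the main diagonal are the last r, whereas the formula puts
  the entries of \<open>A\<close> at the indices 1 to r. This permutation moves the last r columns
  to the front.\<close>

definition rotation :: "nat \<Rightarrow> nat \<Rightarrow> nat \<Rightarrow> nat" where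
  "rotation r n l = (if l \<in> {1..r} then l + (n - r) else if l \<in> {r<..n} then l - r else l)"

lemma rotation_permutes:
  assumes "r \<le> n"
  shows "rotation r n permutes {1..n}"
proof (rule bij_imp_permutes)
  show "bij_betw (rotation r n) {1..n} {1..n}"
    by (rule bij_betw_byWitness[where f' = "rotation (n - r) n"])
      (use assms in \<open>auto simp: rotation_def\<close>)
qed (use assms in \<open>auto simp: rotation_def\<close>)

lemma sign_rotation:
  assumes "r \<le> n"
  shows "sign (rotation r n) = (-1) ^ (r * (n - r))"
proof -
  have "{(i, j). 1 \<le> i \<and> i < j \<and> j \<le> n \<and> rotation r n j < rotation r n i} = {1..r} \<times> {r<..n}"
    using assms by (auto simp: rotation_def split: if_splits)
  then have "inversions n (rotation r n) = r * (n - r)"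
    by (simp add: inversions_def card_cartesian_product)
  then show ?thesis
    using sign_eq_inversions[OF rotation_permutes[OF assms]] by simp
qed

section \<open>Sorting tuples and summing over them\<close>

definition decreasing_tuples :: "nat \<Rightarrow> (nat \<Rightarrow> nat) set" where
  "decreasing_tuples r = {\<alpha> \<in> {1..r} \<rightarrow>\<^sub>E UNIV. \<forall>i\<in>{1..<r}. \<alpha> (Suc i) < \<alpha> i}"

lemma strict_antimono_on_interval:
  fixes N :: "nat \<Rightarrow> nat"
  assumes "\<And>i. i \<in> {1..<n} \<Longrightarrow> N (Suc i) < N i" "1 \<le> i" "i < j" "j \<le> n"
  shows "N j < N i"
  using assms(3,4)
proof (induction j)
  case (Suc j)
  show ?case
  proof (cases "i = j")
    case True
    then show ?thesis using assms(1)[of j] assms(2) Suc.prems by simp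
  next
    case False
    then have "N j < N i"
      using Suc by simp
    moreover have "N (Suc j) < N j"
      using assms(1)[of j] assms(2) Suc.prems False by simp
    ultimately show ?thesis by simp
  qed
qed simp

lemma decreasing_tuplesD:
  assumes "\<alpha> \<in> decreasing_tuples r" "1 \<le> i" "i < j" "j \<le> r"
  shows "\<alpha> j < \<alpha> i"
  using assms(1) by (intro strict_antimono_on_interval[OF _ assms(2-4)]) (simp add: decreasing_tuples_def)

lemma decreasing_tuples_inj:
  assumes "\<alpha> \<in> decreasing_tuples r"
  shows "inj_on \<alpha> {1..r}"
proof (rule linorder_inj_onI')
  fix i j assume "i \<in> {1..r}" "j \<in> {1..r}" "i < j"
  then show "\<alpha> i \<noteq> \<alpha> j"
    using decreasing_tuplesD[OF assms, of i j] by simp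
qed

lemma permutes_increasing_id:
  assumes \<sigma>: "\<sigma> permutes {1..n}" and mono: "\<And>j. j \<in> {1..<n} \<Longrightarrow> \<sigma> j < \<sigma> (Suc j)"
  shows "\<sigma> = id"
proof (rule permutes_natset_ge[OF \<sigma>])
  have "j \<le> \<sigma> j" if "1 \<le> j" "j \<le> n" for j
    using that
  proof (induction j rule: dec_induct)
    case base
    then show ?case using permutes_in_image[OF \<sigma>, of 1] by simp
  next
    case (step k)
    then show ?case using mono[of k] by simp
  qed
  then show "\<forall>j\<in>{1..n}. j \<le> \<sigma> j"
    by simp
qed

lemma decreasing_tuple_with_image:
  assumes "finite G" "card G = r"
  obtains \<alpha> where "\<alpha> \<in> decreasing_tuples r" "\<alpha> ` {1..r} = G"
proof
  define xs where "xs = sorted_list_of_set G"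
  have xs: "length xs = r" "set xs = G" "sorted_wrt (<) xs"
    using assms by (auto simp: xs_def)
  define \<alpha> where "\<alpha> = (\<lambda>i\<in>{1..r}. xs ! (r - i))"
  show "\<alpha> \<in> decreasing_tuples r"
    using xs by (auto simp: decreasing_tuples_def \<alpha>_def intro!: sorted_wrt_nth_less[OF xs(3)])
  show "\<alpha> ` {1..r} = G"
  proof (intro equalityI subsetI)
    fix x assume "x \<in> G"
    then obtain k where "k < r" "x = xs ! k"
      using xs by (metis in_set_conv_nth)
    then have "x = \<alpha> (r - k)" "r - k \<in> {1..r}"
      by (auto simp: \<alpha>_def)
    then show "x \<in> \<alpha> ` {1..r}"
      by blast
  qed (use xs in \<open>auto simp: \<alpha>_def\<close>)
qed

text \<open>Two ways of sorting an injective tuple differ by a permutation that preserves the order,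
  hence by the identity.\<close>

lemma bij_betw_permuted_decreasing_tuples:
  "bij_betw (\<lambda>(\<alpha>, \<pi>). \<alpha> \<circ> \<pi>) (decreasing_tuples r \<times> {\<pi>. \<pi> permutes {1..r}})
     {\<gamma> \<in> {1..r} \<rightarrow>\<^sub>E UNIV. inj_on \<gamma> {1..r}}"
    (is "bij_betw ?f ?A ?B")
proof (rule bij_betwI')
  fix x y assume xy: "x \<in> ?A" "y \<in> ?A"
  then obtain \<alpha> \<pi> \<beta> \<rho> where x: "x = (\<alpha>, \<pi>)" "y = (\<beta>, \<rho>)" and \<alpha>: "\<alpha> \<in> decreasing_tuples r"
    and \<beta>: "\<beta> \<in> decreasing_tuples r" and \<pi>: "\<pi> permutes {1..r}" and \<rho>: "\<rho> permutes {1..r}"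
    by auto
  show "(?f x = ?f y) = (x = y)"
  proof
    assume "?f x = ?f y"
    then have eq: "\<alpha> (\<pi> i) = \<beta> (\<rho> i)" for i
      using x by (metis case_prod_conv comp_apply)
    define \<sigma> where "\<sigma> = \<rho> \<circ> inv \<pi>"
    have \<sigma>: "\<sigma> permutes {1..r}"
      unfolding \<sigma>_def using \<pi> \<rho> by (intro permutes_compose permutes_inv)
    have \<alpha>\<beta>: "\<alpha> j = \<beta> (\<sigma> j)" for j
      using eq[of "inv \<pi> j"] permutes_inverses(1)[OF \<pi>] by (simp add: \<sigma>_def)
    have "\<sigma> = id"
    proof (rule permutes_increasing_id[OF \<sigma>])
      fix j assume j: "j \<in> {1..<r}"
      have img: "\<sigma> j \<in> {1..r}" "\<sigma> (Suc j) \<in> {1..r}"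
        using permutes_in_image[OF \<sigma>] j by auto
      have "\<beta> (\<sigma> (Suc j)) < \<beta> (\<sigma> j)"
        using decreasing_tuplesD[OF \<alpha>, of j "Suc j"] j by (simp add: \<alpha>\<beta>)
      then show "\<sigma> j < \<sigma> (Suc j)"
        using decreasing_tuplesD[OF \<beta>, of "\<sigma> (Suc j)" "\<sigma> j"] img by (cases "\<sigma> (Suc j)" "\<sigma> j" rule: linorder_cases) auto
    qed
    then have "\<alpha> = \<beta>"
      using \<alpha>\<beta> by auto
    moreover have "\<pi> i = \<rho> i" for i
    proof -
      have "\<sigma> (\<pi> i) = \<rho> i"
        using permutes_inverses(2)[OF \<pi>] by (simp add: \<sigma>_def)
      then show ?thesis
        using \<open>\<sigma> = id\<close> by simp
    qed
    ultimately show "x = y"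
      by (auto simp: x)
  qed simp
next
  fix x assume "x \<in> ?A"
  then obtain \<alpha> \<pi> where x: "x = (\<alpha>, \<pi>)" and \<alpha>: "\<alpha> \<in> decreasing_tuples r" and \<pi>: "\<pi> permutes {1..r}"
    by auto
  have "inj_on (\<alpha> \<circ> \<pi>) {1..r}"
    using decreasing_tuples_inj[OF \<alpha>] permutes_inj_on[OF \<pi>] permutes_image[OF \<pi>] by (simp add: comp_inj_on)
  moreover have "\<alpha> \<circ> \<pi> \<in> {1..r} \<rightarrow>\<^sub>E UNIV"
    using \<alpha> permutes_not_in[OF \<pi>] by (auto simp: decreasing_tuples_def PiE_def extensional_def)
  ultimately show "?f x \<in> ?B"
    by (simp add: x)
next
  fix \<gamma> assume "\<gamma> \<in> ?B"
  then have \<gamma>: "\<gamma> \<in> {1..r} \<rightarrow>\<^sub>E UNIV" "inj_on \<gamma> {1..r}"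
    by auto
  then obtain \<alpha> where \<alpha>: "\<alpha> \<in> decreasing_tuples r" "\<alpha> ` {1..r} = \<gamma> ` {1..r}"
    using decreasing_tuple_with_image[of "\<gamma> ` {1..r}" r] by (auto simp: card_image)
  define \<pi> where "\<pi> i = (if i \<in> {1..r} then the_inv_into {1..r} \<alpha> (\<gamma> i) else i)" for i
  have bij\<alpha>: "bij_betw \<alpha> {1..r} (\<gamma> ` {1..r})"
    using \<alpha> decreasing_tuples_inj by (auto simp: bij_betw_def)
  have "bij_betw (the_inv_into {1..r} \<alpha> \<circ> \<gamma>) {1..r} {1..r}"
    using \<gamma>(2) bij_betw_the_inv_into[OF bij\<alpha>] by (intro bij_betw_trans[of \<gamma>]) (auto simp: bij_betw_def)
  then have "bij_betw \<pi> {1..r} {1..r}"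
    by (rule bij_betw_cong[THEN iffD1, rotated]) (auto simp: \<pi>_def)
  then have \<pi>: "\<pi> permutes {1..r}"
    by (rule bij_imp_permutes) (auto simp: \<pi>_def)
  have "\<alpha> (\<pi> i) = \<gamma> i" for i
  proof (cases "i \<in> {1..r}")
    case True
    then show ?thesis
      using f_the_inv_into_f_bij_betw[OF bij\<alpha>] by (auto simp: \<pi>_def)
  next
    case False
    then show ?thesis
      using \<alpha>(1) \<gamma>(1) by (auto simp: \<pi>_def decreasing_tuples_def PiE_def extensional_def)
  qed
  then show "\<exists>x\<in>?A. \<gamma> = ?f x"
    using \<alpha>(1) \<pi> by (intro bexI[of _ "(\<alpha>, \<pi>)"]) auto
qed

text \<open>Each decreasing tuple has r! rearrangements, all with the same value of
  \<open>F\<close>, and tuples with a repetition contribute 0. The point is to pass to the sum over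
  all tuples, which factorizes.\<close>

lemma has_sum_decreasing_tuples:
  fixes F :: "(nat \<Rightarrow> nat) \<Rightarrow> real"
  assumes sum: "(F has_sum S) ({1..r} \<rightarrow>\<^sub>E UNIV)"
    and sym: "\<And>\<pi> Z. \<pi> permutes {1..r} \<Longrightarrow> F (Z \<circ> \<pi>) = F Z"
    and noninj: "\<And>Z. Z \<in> {1..r} \<rightarrow>\<^sub>E UNIV \<Longrightarrow> \<not> inj_on Z {1..r} \<Longrightarrow> F Z = 0"
  shows "(F has_sum S / fact r) (decreasing_tuples r)"
proof -
  have "(F has_sum S) {\<gamma> \<in> {1..r} \<rightarrow>\<^sub>E UNIV. inj_on \<gamma> {1..r}}"
    using sum by (rule has_sum_cong_neutral[THEN iffD1, rotated -1]) (use noninj in auto)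
  then have "((\<lambda>x. F (case x of (\<alpha>, \<pi>) \<Rightarrow> \<alpha> \<circ> \<pi>)) has_sum S) (decreasing_tuples r \<times> {\<pi>. \<pi> permutes {1..r}})"
    by (subst has_sum_reindex_bij_betw[OF bij_betw_permuted_decreasing_tuples])
  then have "((\<lambda>\<alpha>. fact r * F \<alpha>) has_sum S) (decreasing_tuples r)"
  proof (rule has_sum_SigmaD)
    fix \<alpha>
    have "(\<Sum>\<pi> | \<pi> permutes {1..r}. F (\<alpha> \<circ> \<pi>)) = (\<Sum>\<pi> | \<pi> permutes {1..r}. F \<alpha>)"
      using sym by (intro sum.cong) auto
    also have "\<dots> = fact r * F \<alpha>"
      by (simp add: card_permutations)
    finally show "((\<lambda>\<pi>. F (case (\<alpha>, \<pi>) of (\<alpha>, \<pi>) \<Rightarrow> \<alpha> \<circ> \<pi>)) has_sum fact r * F \<alpha>) {\<pi>. \<pi> permutes {1..r}}"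
      by (simp add: has_sum_finite_iff finite_permutations)
  qed
  then have "((\<lambda>\<alpha>. fact r * F \<alpha> * (1 / fact r)) has_sum S * (1 / fact r)) (decreasing_tuples r)"
    by (rule has_sum_cmult_left)
  then show ?thesis
    by simp
qed

text \<open>
  Expanding both determinants turns a sum over tuples of a product of two determinants into products
  of one-dimensional sums; this replaces the Cauchy-Binet formula.
\<close>

definition leibniz2 ::
    "nat \<Rightarrow> nat \<Rightarrow> nat \<Rightarrow> (nat \<Rightarrow> nat \<Rightarrow> real) \<Rightarrow> (nat \<Rightarrow> nat \<Rightarrow> real) \<Rightarrow> (nat \<Rightarrow> nat \<Rightarrow> real) \<Rightarrow> real" where
  "leibniz2 n m r x y \<Psi> = (\<Sum>\<sigma> | \<sigma> permutes {1..n}. \<Sum>\<tau> | \<tau> permutes {1..m}.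
     of_int (sign \<sigma>) * of_int (sign \<tau>) * (\<Prod>l = r+1..n. x l (\<sigma> l)) * (\<Prod>l = r+1..m. y l (\<tau> l)) *
     (\<Prod>l = 1..r. \<Psi> (\<sigma> l) (\<tau> l)))"

lemma prod_split_at:
  fixes f g :: "nat \<Rightarrow> real"
  assumes "r \<le> n"
  shows "(\<Prod>l = 1..n. if l \<le> r then f l else g l) = (\<Prod>l = 1..r. f l) * (\<Prod>l = r+1..n. g l)"
proof -
  have "{1..n} = {1..r} \<union> {r+1..n}"
    using assms by auto
  then have "(\<Prod>l = 1..n. if l \<le> r then f l else g l) =
      (\<Prod>l = 1..r. if l \<le> r then f l else g l) * (\<Prod>l = r+1..n. if l \<le> r then f l else g l)"
    by (simp add: prod.union_disjoint)
  also have "\<dots> = (\<Prod>l = 1..r. f l) * (\<Prod>l = r+1..n. g l)"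
    by (intro arg_cong2[of _ _ _ _ "(*)"] prod.cong) auto
  finally show ?thesis .
qed

lemma ldet_mult_ldet:
  assumes "r \<le> n" "r \<le> m"
  shows "(\<Prod>l = 1..r. w l) * ldet n (\<lambda>l i. if l \<le> r then a l i else x l i) * ldet m (\<lambda>l i. if l \<le> r then b l i else y l i) =
    (\<Sum>\<sigma> | \<sigma> permutes {1..n}. \<Sum>\<tau> | \<tau> permutes {1..m}.
     of_int (sign \<sigma>) * of_int (sign \<tau>) * (\<Prod>l = r+1..n. x l (\<sigma> l)) * (\<Prod>l = r+1..m. y l (\<tau> l)) *
     (\<Prod>l = 1..r. w l * a l (\<sigma> l) * b l (\<tau> l)))"
  unfolding ldet_def prod_split_at[OF assms(1)] prod_split_at[OF assms(2)]
  by (simp add: sum_distrib_left sum_distrib_right prod.distrib mult_ac sum.swap[of _ "{\<tau>. \<tau> permutes {1..m}}"])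

text \<open>Permuting the entries of \<open>Z\<close> multiplies both determinants by the same sign,
  so their product is symmetric, and a repeated entry gives two equal columns. Over all tuples each
  pair of Leibniz terms is then a product of one-dimensional sums \<Psi>.\<close>

lemma has_sum_ldet_mult_ldet:
  fixes w :: "nat \<Rightarrow> real"
  assumes r: "r \<le> n" "r \<le> m"
    and \<Psi>: "\<And>i j. ((\<lambda>z. w z * a z i * b z j) has_sum \<Psi> i j) UNIV"
  shows "((\<lambda>Z. (\<Prod>l = 1..r. w (Z l)) * ldet n (\<lambda>l i. if l \<le> r then a (Z l) i else x l i) *
      ldet m (\<lambda>l i. if l \<le> r then b (Z l) i else y l i)) has_sum leibniz2 n m r x y \<Psi> / fact r) (decreasing_tuples r)"
proof (rule has_sum_decreasing_tuples)
  show "((\<lambda>Z. (\<Prod>l = 1..r. w (Z l)) * ldet n (\<lambda>l i. if l \<le> r then a (Z l) i else x l i) *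
      ldet m (\<lambda>l i. if l \<le> r then b (Z l) i else y l i)) has_sum leibniz2 n m r x y \<Psi>) ({1..r} \<rightarrow>\<^sub>E UNIV)"
    unfolding ldet_mult_ldet[OF r] leibniz2_def
    by (intro has_sum_sum_real has_sum_cmult_right has_sum_prod_PiE_real \<Psi>) auto
next
  fix \<pi> and Z :: "nat \<Rightarrow> nat" assume \<pi>: "\<pi> permutes {1..r}"
  have ldet: "ldet k (\<lambda>l i. if l \<le> r then f ((Z \<circ> \<pi>) l) i else z l i) =
      of_int (sign \<pi>) * ldet k (\<lambda>l i. if l \<le> r then f (Z l) i else z l i)"
    if "r \<le> k" for k z and f :: "nat \<Rightarrow> nat \<Rightarrow> real"
  proof -
    have "\<pi> permutes {1..k}"
      using \<pi> by (rule permutes_subset) (use that in auto)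
    then have "ldet k (\<lambda>l i. if \<pi> l \<le> r then f (Z (\<pi> l)) i else z (\<pi> l) i) =
        of_int (sign \<pi>) * ldet k (\<lambda>l i. if l \<le> r then f (Z l) i else z l i)"
      by (rule ldet_permute)
    moreover have "ldet k (\<lambda>l i. if \<pi> l \<le> r then f (Z (\<pi> l)) i else z (\<pi> l) i) =
        ldet k (\<lambda>l i. if l \<le> r then f ((Z \<circ> \<pi>) l) i else z l i)"
    proof (rule ldet_cong)
      fix l i assume "l \<in> {1..k}"
      then show "(if \<pi> l \<le> r then f (Z (\<pi> l)) i else z (\<pi> l) i) = (if l \<le> r then f ((Z \<circ> \<pi>) l) i else z l i)"
        using permutes_in_image[OF \<pi>, of l] permutes_not_in[OF \<pi>, of l] by (cases "l \<le> r") auto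
    qed
    ultimately show ?thesis by simp
  qed
  have "(\<Prod>l = 1..r. w ((Z \<circ> \<pi>) l)) = (\<Prod>l = 1..r. w (Z l))"
    using prod.permute[OF \<pi>, of "\<lambda>l. w (Z l)"] by (simp add: o_def)
  moreover have "of_int (sign \<pi>) * of_int (sign \<pi>) = (1 :: real)"
    by (simp add: of_int_mult[symmetric] del: of_int_mult)
  ultimately show "(\<Prod>l = 1..r. w ((Z \<circ> \<pi>) l)) * ldet n (\<lambda>l i. if l \<le> r then a ((Z \<circ> \<pi>) l) i else x l i) *
      ldet m (\<lambda>l i. if l \<le> r then b ((Z \<circ> \<pi>) l) i else y l i) =
      (\<Prod>l = 1..r. w (Z l)) * ldet n (\<lambda>l i. if l \<le> r then a (Z l) i else x l i) *
      ldet m (\<lambda>l i. if l \<le> r then b (Z l) i else y l i)"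
    unfolding ldet[OF r(1)] ldet[OF r(2)] by (simp add: mult_ac)
next
  fix Z :: "nat \<Rightarrow> nat" assume "\<not> inj_on Z {1..r}"
  then obtain k l where "k \<in> {1..r}" "l \<in> {1..r}" "k \<noteq> l" "Z k = Z l"
    by (auto simp: inj_on_def)
  then have "ldet n (\<lambda>l i. if l \<le> r then a (Z l) i else x l i) = 0"
    using r by (intro ldet_zero[of k n l]) auto
  then show "(\<Prod>l = 1..r. w (Z l)) * ldet n (\<lambda>l i. if l \<le> r then a (Z l) i else x l i) *
      ldet m (\<lambda>l i. if l \<le> r then b (Z l) i else y l i) = 0"
    by simp
qed

section \<open>The generating function of half arrays\<close>

lemma ldet_tendsto:
  assumes "\<And>j i. j \<in> {1..n} \<Longrightarrow> i \<in> {1..n} \<Longrightarrow> (\<lambda>D. c D j i) \<longlonglongrightarrow> c' j i"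
  shows "(\<lambda>D. ldet n (c D)) \<longlonglongrightarrow> ldet n c'"
  unfolding ldet_def
proof (intro tendsto_sum tendsto_mult tendsto_const tendsto_prod)
  fix \<sigma> j assume "\<sigma> \<in> {\<sigma>. \<sigma> permutes {1..n}}" "j \<in> {1..n}"
  then show "(\<lambda>D. c D j (\<sigma> j)) \<longlonglongrightarrow> c' j (\<sigma> j)"
    using permutes_in_image assms by (metis mem_Collect_eq)
qed

text \<open>If Y_j = N_(\<sigma> j) for all j and both sequences decrease strictly, then \<sigma>
  preserves the order, so only the identity can contribute. This is the start of the induction, with
  arrays settled from the main diagonal on.\<close>

lemma ldet_kronecker:
  fixes Y N :: "nat \<Rightarrow> nat"
  assumes Y: "\<And>i. i \<in> {1..<n} \<Longrightarrow> Y (Suc i) < Y i" and N: "\<And>i. i \<in> {1..<n} \<Longrightarrow> N (Suc i) < N i"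
  shows "ldet n (\<lambda>j i. if Y j = N i then 1 else 0) = (if \<forall>i\<in>{1..n}. Y i = N i then 1 else 0)"
proof -
  have id: "\<sigma> = id" if \<sigma>: "\<sigma> permutes {1..n}" and eq: "\<And>j. j \<in> {1..n} \<Longrightarrow> Y j = N (\<sigma> j)" for \<sigma>
  proof (rule permutes_increasing_id[OF \<sigma>])
    fix j assume j: "j \<in> {1..<n}"
    have in_range: "\<sigma> j \<in> {1..n}" "\<sigma> (Suc j) \<in> {1..n}"
      using permutes_in_image[OF \<sigma>] j by auto
    have less: "N (\<sigma> (Suc j)) < N (\<sigma> j)"
      using Y[OF j] eq[of j] eq[of "Suc j"] j by simp
    show "\<sigma> j < \<sigma> (Suc j)"
    proof (cases "\<sigma> (Suc j)" "\<sigma> j" rule: linorder_cases)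
      case less': less
      have "N (\<sigma> j) < N (\<sigma> (Suc j))"
        by (rule strict_antimono_on_interval[where N = N and n = n]) (use N less' in_range in auto)
      then show ?thesis
        using less by simp
    qed (use less in auto)
  qed
  have prod: "(\<Prod>j = 1..n. if Y j = N (\<sigma> j) then 1 else 0 :: real) = (if \<forall>j\<in>{1..n}. Y j = N (\<sigma> j) then 1 else 0)" for \<sigma>
    by (auto intro: prod_zero)
  have "ldet n (\<lambda>j i. if Y j = N i then 1 else 0) =
      (\<Sum>\<sigma> | \<sigma> permutes {1..n}. if \<sigma> = id \<and> (\<forall>i\<in>{1..n}. Y i = N i) then 1 else 0)"
    unfolding ldet_def prod
  proof (rule sum.cong[OF refl])
    fix \<sigma> assume "\<sigma> \<in> {\<sigma>. \<sigma> permutes {1..n}}"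
    then have "\<sigma> = id" if "\<forall>j\<in>{1..n}. Y j = N (\<sigma> j)"
      using id that by blast
    then show "of_int (sign \<sigma>) * (if \<forall>j\<in>{1..n}. Y j = N (\<sigma> j) then 1 else 0) =
        (if \<sigma> = id \<and> (\<forall>i\<in>{1..n}. Y i = N i) then 1 else 0 :: real)"
      by (cases "\<forall>j\<in>{1..n}. Y j = N (\<sigma> j)") auto
  qed
  also have "\<dots> = (if \<forall>i\<in>{1..n}. Y i = N i then 1 else 0)"
  proof (cases "\<forall>i\<in>{1..n}. Y i = N i")
    case True
    then have "(\<Sum>\<sigma> | \<sigma> permutes {1..n}. if \<sigma> = id \<and> (\<forall>i\<in>{1..n}. Y i = N i) then 1 else 0 :: real) =
        (\<Sum>\<sigma> | \<sigma> permutes {1..n}. if id = \<sigma> then 1 else 0)"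
      by (intro sum.cong) auto
    also have "\<dots> = 1"
      by (simp add: sum.delta' finite_permutations permutes_id)
    finally show ?thesis
      using True by simp
  next
    case False
    show ?thesis
      unfolding if_not_P[OF False] by (rule sum.neutral) (use False in auto)
  qed
  finally show ?thesis .
qed

context q_parameter
begin

lemma q_powi_sum: "q powi (\<Sum>i\<in>I. f i) = (\<Prod>i\<in>I. q powi f i)"
  by (induction I rule: infinite_finite_induct) (simp_all add: q_powi_add)

text \<open>Diagonals 1 to s_l - 1 carry no weight in row l, but each of them multiplies all matrix
  rows i by q^(-N_i). The column of l accumulates these factors, and the power in front returns the
  q^(N_l) that each such diagonal took too much. The truncated \<open>s l - 1\<close> there makes
  rows with \<open>s l = 0\<close> contribute 1. The number \<open>c\<close> is the sum over an
  entry without upper bound.\<close>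

definition halfdet ::
    "nat \<Rightarrow> (nat \<Rightarrow> nat) \<Rightarrow> (nat \<Rightarrow> nat) \<Rightarrow> real \<Rightarrow> (int \<Rightarrow> real) \<Rightarrow> (nat \<Rightarrow> nat) \<Rightarrow> real" where
  "halfdet n s N c h Y = (\<Prod>l = 1..n. q ^ ((s l - 1) * N l)) *
     ldet n (\<lambda>l i. if s l = 0 then h (int (Y l) - int (N i)) else q powi (- ((int (s l) - 1) * int (N i))) * c)"

text \<open>The weight of diagonal 1 enters the determinant by scaling, q^(Z_k) in each finite
  column and q^(-N_i) in each row; the surplus from the infinite rows is what changes the exponents
  \<open>s - 1 - 1\<close> into \<open>s - 1\<close>.\<close>

lemma halfdet_factor:
  assumes "\<And>k i. k \<in> {1..n} \<Longrightarrow> i \<in> {1..n} \<Longrightarrow> d k i =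
      (if s k \<le> 1 then q powi (int (Z k) - int (N i)) * g (int (Z k) - int (N i))
       else q powi (- ((int (s k) - 1) * int (N i))) * c)"
  shows "q powi (\<Sum>i | i \<in> {1..n} \<and> s i \<le> 1. int (Z i) - int (N i)) * halfdet n (\<lambda>i. s i - 1) N c g Z =
    (\<Prod>l = 1..n. q ^ ((s l - 1) * N l)) * ldet n d"
proof -
  define u where "u k = (if s k \<le> 1 then q ^ Z k else 1)" for k
  define v where "v i = q powi (- int (N i))" for i
  define e where "e l i = (if s l - 1 = 0 then g (int (Z l) - int (N i))
    else q powi (- ((int (s l - 1) - 1) * int (N i))) * c)" for l i
  have "d k i = u k * v i * e k i" if "k \<in> {1..n}" "i \<in> {1..n}" for k i
  proof (cases "s k \<le> 1")
    case True
    have "q powi (int (Z k) - int (N i)) = q ^ Z k * q powi (- int (N i))"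
      using q_powi_add[of "int (Z k)" "- int (N i)"] by simp
    then show ?thesis
      using True by (simp add: assms[OF that] u_def v_def e_def)
  next
    case False
    have "- ((int (s k) - 1) * int (N i)) = - int (N i) + - ((int (s k - 1) - 1) * int (N i))"
      using False by (simp add: algebra_simps of_nat_diff)
    then have "q powi (- ((int (s k) - 1) * int (N i))) = v i * q powi (- ((int (s k - 1) - 1) * int (N i)))"
      unfolding v_def by (simp only: q_powi_add)
    then show ?thesis
      using False by (simp add: assms[OF that] u_def e_def)
  qed
  then have "ldet n d = ldet n (\<lambda>k i. u k * v i * e k i)"
    by (intro ldet_cong) auto
  then have ldet: "ldet n d = (\<Prod>k = 1..n. u k) * (\<Prod>i = 1..n. v i) * ldet n e"
    by (simp add: ldet_scale)
  have "q powi (\<Sum>i | i \<in> {1..n} \<and> s i \<le> 1. int (Z i) - int (N i)) =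
      (\<Prod>i = 1..n. if s i \<le> 1 then q powi (int (Z i) - int (N i)) else 1)"
    unfolding q_powi_sum by (subst prod.inter_filter[symmetric]) auto
  moreover have "(\<Prod>i = 1..n. if s i \<le> 1 then q powi (int (Z i) - int (N i)) else 1) *
      (\<Prod>l = 1..n. q ^ ((s l - 1 - 1) * N l)) =
      (\<Prod>l = 1..n. q ^ ((s l - 1) * N l)) * ((\<Prod>k = 1..n. u k) * (\<Prod>i = 1..n. v i))"
    unfolding prod.distrib[symmetric]
  proof (rule prod.cong[OF refl])
    fix l
    show "(if s l \<le> 1 then q powi (int (Z l) - int (N l)) else 1) * q ^ ((s l - 1 - 1) * N l) =
        q ^ ((s l - 1) * N l) * (u l * v l)"
    proof (cases "s l \<le> 1")
      case True
      then show ?thesis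
        using q_powi_add[of "int (Z l)" "- int (N l)"] by (simp add: u_def v_def)
    next
      case False
      then obtain t where t: "s l = Suc (Suc t)"
        by (metis One_nat_def Suc_le_D le_SucI not_less_eq_eq not_one_le_zero old.nat.exhaust)
      have "q ^ N l * v l = 1"
        using q_pos unfolding v_def by (simp add: power_int_minus)
      then show ?thesis
        by (simp add: t u_def power_add mult_ac)
    qed
  qed
  ultimately show ?thesis
    by (simp only: halfdet_def e_def[symmetric] ldet mult.assoc[symmetric])
qed

text \<open>For given \<open>Y\<close>, interlacing lets the Z_k range independently, each over an
  initial segment (or all naturals, if \<open>s k = 1\<close>) minus the initial segment up to
  Y_(k+1). Hence column k of the summed determinant is a difference of consecutive columns of the
  new one, and the subtraction does not change the determinant. The functions \<open>g\<close> and
  \<open>h\<close> are kept general to cover both \<open>gauss\<close> and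
  \<open>hq\<close>.\<close>

lemma halfdet_step:
  assumes s: "staircase n s" and Y: "admissible n s Y"
    and gh: "\<And>N y. (\<Sum>z\<le>y. q powi (int z - int N) * g (int z - int N)) = h (int y - int N)"
    and gc: "\<And>N. \<exists>l\<in>{1..n}. s l = 1 \<Longrightarrow> ((\<lambda>z. q powi (int z - int N) * g (int z - int N)) has_sum c) UNIV"
  shows "((\<lambda>Z. q powi (\<Sum>i | i \<in> {1..n} \<and> s i \<le> 1. int (Z i) - int (N i)) * halfdet n (\<lambda>i. s i - 1) N c g Z)
    has_sum halfdet n s N c h Y) (half_steps n s Y)"
proof -
  define K where "K = {k \<in> {1..n}. s k \<le> 1}"
  define J where "J = {k \<in> {1..<n}. s k \<le> 1}"
  define B where "B k = {z. s k = 0 \<longrightarrow> z \<le> Y k} - (if k < n then {..Y (Suc k)} else {})" for k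
  define w where "w k i z = q powi (int z - int (N i)) * g (int z - int (N i))" for k i z :: nat
  define e where "e k i = (if s k = 0 then h (int (Y k) - int (N i))
    else q powi (- ((int (s k) - 1) * int (N i))) * c)" for k i
  define d where "d k i = (if k \<in> J then e k i - e (Suc k) i else e k i)" for k i
  \<comment> \<open>Where a difference is formed, the neighbouring row is already finite on the main
    diagonal, so its column is given by \<open>h\<close>; this is the partial sum subtracted from
    column k.\<close>
  have next_0: "s (Suc k) = 0" if "k \<in> J" for k
  proof -
    have "s (Suc k) \<le> s k - 1"
      using s that unfolding staircase_def J_def by blast
    then show ?thesis
      using that by (simp add: J_def)
  qed
  have fin: "(w k i has_sum h (int y - int (N i))) {..y}" for k i y
    unfolding w_def gh[symmetric] by (intro has_sum_finite) simp
  have sum: "(w k i has_sum d k i) (B k)" if k: "k \<in> K" for k i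
  proof -
    have all: "(w k i has_sum e k i) {z. s k = 0 \<longrightarrow> z \<le> Y k}"
    proof (cases "s k = 0")
      case True
      then show ?thesis
        using fin[of k i "Y k"] by (simp add: e_def atMost_def)
    next
      case False
      then have "s k = 1"
        using k by (simp add: K_def)
      then show ?thesis
      proof -
        have "w k i = (\<lambda>z. q powi (int z - int (N i)) * g (int z - int (N i)))"
          by (auto simp: w_def)
        moreover have "\<exists>l\<in>{1..n}. s l = 1"
          using k \<open>s k = 1\<close> by (auto simp: K_def)
        ultimately show ?thesis
          using gc[of "N i"] \<open>s k = 1\<close> by (simp add: e_def)
      qed
    qed
    show ?thesis
    proof (cases "k < n")
      case True
      then have kJ: "k \<in> J"
        using k by (auto simp: K_def J_def)
      have "s k = 0 \<Longrightarrow> Y (Suc k) < Y k"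
        using Y k True unfolding admissible_def K_def by auto
      then have "{..Y (Suc k)} \<subseteq> {z. s k = 0 \<longrightarrow> z \<le> Y k}"
        by auto
      then have "(w k i has_sum (e k i - h (int (Y (Suc k)) - int (N i)))) (B k)"
        unfolding B_def using True by (simp add: has_sum_Diff[OF all fin])
      then show ?thesis
        using kJ next_0[OF kJ] by (simp add: d_def e_def)
    next
      case False
      then show ?thesis
        using all by (simp add: B_def d_def J_def)
    qed
  qed
  have "((\<lambda>Z. ldet n (\<lambda>k i. if k \<in> K then w k i (Z k) else d k i)) has_sum ldet n d) (PiE K B)"
    by (rule has_sum_ldet) (use sum in \<open>auto simp: K_def\<close>)
  moreover have "ldet n d = ldet n e"
    unfolding d_def by (rule ldet_column_differences) (auto simp: J_def)
  ultimately have "((\<lambda>Z. (\<Prod>l = 1..n. q ^ ((s l - 1) * N l)) * ldet n (\<lambda>k i. if k \<in> K then w k i (Z k) else d k i))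
      has_sum halfdet n s N c h Y) (PiE K B)"
    unfolding halfdet_def e_def by (intro has_sum_cmult_right) simp
  also have "?this \<longleftrightarrow> ?thesis"
  proof (rule has_sum_reindex_bij_witness[of _ "\<lambda>Z. restrict Z K" "\<lambda>Z i. if i \<in> K then Z i else 0"])
    fix Z assume Z: "Z \<in> PiE K B"
    then show "restrict (\<lambda>i. if i \<in> K then Z i else 0) K = Z"
      by (auto simp: fun_eq_iff PiE_def extensional_def)
    have "Z i \<in> B i" if "i \<in> K" for i
      using Z that by auto
    then show "(\<lambda>i. if i \<in> K then Z i else 0) \<in> half_steps n s Y"
      unfolding half_steps_def B_def K_def by fastforce
    show "q powi (\<Sum>i | i \<in> {1..n} \<and> s i \<le> 1. int (if i \<in> K then Z i else 0) - int (N i)) *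
        halfdet n (\<lambda>i. s i - 1) N c g (\<lambda>i. if i \<in> K then Z i else 0) =
        (\<Prod>l = 1..n. q ^ ((s l - 1) * N l)) * ldet n (\<lambda>k i. if k \<in> K then w k i (Z k) else d k i)"
      by (rule halfdet_factor) (auto simp: K_def w_def d_def J_def e_def)
  next
    fix Z assume Z: "Z \<in> half_steps n s Y"
    have "Z i = 0" if "i \<notin> K" for i
      using Z that unfolding half_steps_def K_def by auto
    then show "(\<lambda>i. if i \<in> K then restrict Z K i else 0) = Z"
      by auto
    show "restrict Z K \<in> PiE K B"
    proof (intro restrict_PiE[THEN iffD2] Pi_I)
      fix k assume "k \<in> K"
      then have k: "k \<in> {1..n}" "s k \<le> 1"
        by (auto simp: K_def)
      then have "s k = 0 \<longrightarrow> Z k \<le> Y k" "k < n \<longrightarrow> Y (Suc k) < Z k"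
        using Z unfolding half_steps_def by auto
      then show "Z k \<in> B k"
        by (auto simp: B_def)
    qed
  qed simp
  finally show ?thesis .
qed

text \<open>Settling by diagonal \<open>D\<close> leaves \<open>D\<close> summations. Applied to the
  Kronecker delta \<open>gauss 0\<close> of the settled array, they lead to
  \<open>gauss D\<close>.\<close>

lemma half_upto_has_sum:
  assumes N: "\<And>i. i \<in> {1..<n} \<Longrightarrow> N (Suc i) < N i" and s: "\<And>i. i \<in> {1..n} \<Longrightarrow> s i = 0"
    and Y: "admissible n s Y"
  shows "((\<lambda>b. q powi half_weight n s N b) has_sum halfdet n s N 0 (gauss D) Y) (half_arrays_upto n s N D Y)"
  using s Y
proof (induction D arbitrary: Y s)
  case 0
  have Y_dec: "Y (Suc i) < Y i" if "i \<in> {1..<n}" for i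
    using 0 that by (auto simp: admissible_def)
  have det: "halfdet n s N 0 (gauss 0) Y = (if \<forall>i\<in>{1..n}. Y i = N i then 1 else 0)"
  proof -
    have "halfdet n s N 0 (gauss 0) Y = ldet n (\<lambda>j i. if Y j = N i then 1 else 0)"
    proof -
      have "ldet n (\<lambda>l i. if s l = 0 then gauss 0 (int (Y l) - int (N i)) else q powi (- ((int (s l) - 1) * int (N i))) * 0) =
          ldet n (\<lambda>j i. if Y j = N i then 1 else 0)"
        by (rule ldet_cong) (use 0(1) in \<open>simp add: gauss_0\<close>)
      then show ?thesis
        using 0(1) by (simp add: halfdet_def)
    qed
    then show ?thesis
      using ldet_kronecker[of n Y N] Y_dec N by simp
  qed
  show ?case
  proof (cases "\<forall>i\<in>{1..n}. Y i = N i")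
    case True
    have "half_arrays_upto n s N 0 Y = {\<lambda>_ :: nat. Y}"
    proof (intro equalityI subsetI)
      fix b assume "b \<in> half_arrays_upto n s N 0 Y"
      then have "b k i = Y i" for k i
        using True 0(2) unfolding half_arrays_upto_def half_chains_def admissible_def
        by (cases "i \<in> {1..n}") auto
      then show "b \<in> {\<lambda>_. Y}"
        by auto
    next
      fix b assume "b \<in> {\<lambda>_ :: nat. Y}"
      then show "b \<in> half_arrays_upto n s N 0 Y"
        using True 0 N unfolding half_arrays_upto_def half_chains_def admissible_def by auto
    qed
    moreover have "half_weight n s N (\<lambda>_. Y) = 0"
      using True by (intro half_weight_0) auto
    ultimately show ?thesis
      using True by (simp add: det has_sum_finite_iff)
  next
    case False
    then have "half_arrays_upto n s N 0 Y = {}"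
      by (auto simp: half_arrays_upto_def half_chains_def)
    moreover have "halfdet n s N 0 (gauss 0) Y = 0"
      unfolding det using False by simp
    ultimately show ?thesis
      by simp
  qed
next
  case (Suc D)
  have stair: "staircase n s"
    using Suc.prems(1) by (auto simp: staircase_def)
  show ?case
  proof (rule has_sum_first_step[where S = "half_steps n s Y" and X' = "half_arrays_upto n (\<lambda>i. s i - 1) N D"])
    show "b \<in> half_arrays_upto n s N (Suc D) Y \<longleftrightarrow>
        b 0 = Y \<and> b 1 \<in> half_steps n s Y \<and> b \<circ> Suc \<in> half_arrays_upto n (\<lambda>i. s i - 1) N D (b 1)" for b
      by (rule half_arrays_upto_Suc_iff[OF Suc.prems(2)])
    show "b 0 = Z" if "b \<in> half_arrays_upto n (\<lambda>i. s i - 1) N D Z" for b Z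
      using that by (simp add: half_arrays_upto_def half_chains_def)
    show "q powi half_weight n s N b = q powi (\<Sum>i | i \<in> {1..n} \<and> s i \<le> 1. int (b 1 i) - int (N i)) *
        q powi half_weight n (\<lambda>i. s i - 1) N (b \<circ> Suc)" if "b \<in> half_arrays_upto n s N (Suc D) Y" for b
    proof -
      have "b \<in> half_arrays n s N Y"
        using that by (auto simp: half_arrays_eq_UN)
      then show ?thesis
        using half_weight_Suc[OF _ Suc.prems(2)] by (simp only: q_powi_add)
    qed
    show "((\<lambda>b. q powi half_weight n (\<lambda>i. s i - 1) N b) has_sum halfdet n (\<lambda>i. s i - 1) N 0 (gauss D) Z)
        (half_arrays_upto n (\<lambda>i. s i - 1) N D Z)" if "Z \<in> half_steps n s Y" for Z
      by (rule Suc.IH) (use Suc.prems half_steps_admissible[OF stair that] in auto)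
    show "((\<lambda>Z. q powi (\<Sum>i | i \<in> {1..n} \<and> s i \<le> 1. int (Z i) - int (N i)) *
        halfdet n (\<lambda>i. s i - 1) N 0 (gauss D) Z) has_sum halfdet n s N 0 (gauss (Suc D)) Y) (half_steps n s Y)"
      by (rule halfdet_step[OF stair Suc.prems(2) gauss_sum]) (use Suc.prems(1) in auto)
  qed (use q_pos in auto)
qed

text \<open>Induction on a bound for \<open>s\<close>: removing a diagonal lowers every positive
  \<open>s i\<close> by one, until all rows are finite. From there on no fixed number of diagonals
  suffices for all arrays, and the limit of the sums over \<open>half_arrays_upto\<close> takes
  over.\<close>

lemma half_has_sum:
  assumes N: "\<And>i. i \<in> {1..<n} \<Longrightarrow> N (Suc i) < N i" and "staircase n s" "admissible n s Y"
  shows "((\<lambda>b. q powi half_weight n s N b) has_sum halfdet n s N (1 / qpoch_inf) hq Y) (half_arrays n s N Y)"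
proof -
  have "((\<lambda>b. q powi half_weight n s N b) has_sum halfdet n s N (1 / qpoch_inf) hq Y) (half_arrays n s N Y)"
    if "\<And>i. i \<in> {1..n} \<Longrightarrow> s i \<le> K" "staircase n s" "admissible n s Y" for K
    using that
  proof (induction K arbitrary: s Y)
    case 0
    show ?case
      unfolding half_arrays_eq_UN
    proof (rule has_sum_increasing_union)
      show "half_arrays_upto n s N D Y \<subseteq> half_arrays_upto n s N (Suc D) Y" for D
        by (auto simp: half_arrays_upto_def)
      show "((\<lambda>b. q powi half_weight n s N b) has_sum halfdet n s N 0 (gauss D) Y) (half_arrays_upto n s N D Y)" for D
        by (rule half_upto_has_sum) (use 0 N in auto)
      show "(\<lambda>D. halfdet n s N 0 (gauss D) Y) \<longlonglongrightarrow> halfdet n s N (1 / qpoch_inf) hq Y"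
        unfolding halfdet_def
        by (intro tendsto_mult tendsto_const ldet_tendsto) (use 0(1) gauss_tendsto in auto)
    qed (use q_pos in auto)
  next
    case (Suc K)
    show ?case
    proof (rule has_sum_first_step[where S = "half_steps n s Y" and X' = "half_arrays n (\<lambda>i. s i - 1) N"])
      show "b \<in> half_arrays n s N Y \<longleftrightarrow>
          b 0 = Y \<and> b 1 \<in> half_steps n s Y \<and> b \<circ> Suc \<in> half_arrays n (\<lambda>i. s i - 1) N (b 1)" for b
        by (rule half_arrays_Suc_iff[OF Suc.prems(3)])
      show "b 0 = Z" if "b \<in> half_arrays n (\<lambda>i. s i - 1) N Z" for b Z
        using that by (simp add: half_arrays_def half_chains_def)
      show "q powi half_weight n s N b = q powi (\<Sum>i | i \<in> {1..n} \<and> s i \<le> 1. int (b 1 i) - int (N i)) *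
          q powi half_weight n (\<lambda>i. s i - 1) N (b \<circ> Suc)" if "b \<in> half_arrays n s N Y" for b
        using half_weight_Suc[OF that Suc.prems(3)] by (simp only: q_powi_add)
      show "((\<lambda>b. q powi half_weight n (\<lambda>i. s i - 1) N b) has_sum
          halfdet n (\<lambda>i. s i - 1) N (1 / qpoch_inf) hq Z) (half_arrays n (\<lambda>i. s i - 1) N Z)"
        if "Z \<in> half_steps n s Y" for Z
      proof (rule Suc.IH)
        show "s i - 1 \<le> K" if "i \<in> {1..n}" for i
          using Suc.prems(1)[OF that] by simp
        show "staircase n (\<lambda>i. s i - 1)"
          using Suc.prems(2) unfolding staircase_def by (metis diff_le_mono)
      qed (rule half_steps_admissible[OF Suc.prems(2) that])
      show "((\<lambda>Z. q powi (\<Sum>i | i \<in> {1..n} \<and> s i \<le> 1. int (Z i) - int (N i)) *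
          halfdet n (\<lambda>i. s i - 1) N (1 / qpoch_inf) hq Z) has_sum halfdet n s N (1 / qpoch_inf) hq Y) (half_steps n s Y)"
        by (rule halfdet_step[OF Suc.prems(2,3) hq_sum hq_has_sum])
    qed (use q_pos in auto)
  qed
  from this[of "Max (s ` {1..n})"] assms show ?thesis
    by simp
qed

end

section \<open>Splitting an array along its main diagonal\<close>

text \<open>The diagram contains the rectangle of n - r rows and m - r columns but not the cell (n -
  r + 1, m - r + 1), so up to (n, m) the main diagonal has exactly its last r cells finite.
  Formulated for a pair of conjugate shapes, the assumptions pass to the transposed picture, and
  every fact about the upper half serves for the lower half too.\<close>

locale pit_shape =
  fixes n m r :: nat and lam lam' :: "nat \<Rightarrow> nat"
  assumes transpose_iff: "\<And>i j. 1 \<le> i \<Longrightarrow> 1 \<le> j \<Longrightarrow> j \<le> lam i \<longleftrightarrow> i \<le> lam' j"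
    and lam_decreasing: "\<And>i. 1 \<le> i \<Longrightarrow> lam (Suc i) \<le> lam i"
    and r_le: "r \<le> n" "r \<le> m"
    and inner_corner: "\<And>i. 1 \<le> i \<Longrightarrow> i \<le> n - r \<Longrightarrow> m - r \<le> lam i"
    and outer_corner: "lam (n - r + 1) \<le> m - r"

text \<open>The first diagonal k whose column i + k + m - n exceeds \<lambda>_i. The truncation at 0
  covers the rows that are finite on the main diagonal already.\<close>

definition start :: "nat \<Rightarrow> nat \<Rightarrow> (nat \<Rightarrow> nat) \<Rightarrow> nat \<Rightarrow> nat" where
  "start n m lam i = lam i + n + 1 - (m + i)"

definition half_of :: "nat \<Rightarrow> nat \<Rightarrow> (nat \<Rightarrow> nat) \<Rightarrow> (nat \<times> nat \<Rightarrow> enat) \<Rightarrow> nat \<Rightarrow> nat \<Rightarrow> nat" where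
  "half_of n m lam a k i =
     (if i \<in> {1..n} \<and> start n m lam i \<le> k then the_enat (a (i, i + k + m - n)) + (n - i) else 0)"

text \<open>At the cell (i, j) = (n - r + k, m - r + k) the shift r - k equals both n - i and m - j,
  so one tuple serves both halves.\<close>

definition diagonal_of :: "nat \<Rightarrow> nat \<Rightarrow> nat \<Rightarrow> (nat \<times> nat \<Rightarrow> enat) \<Rightarrow> nat \<Rightarrow> nat" where
  "diagonal_of n m r a = (\<lambda>k\<in>{1..r}. the_enat (a (n - r + k, m - r + k)) + (r - k))"

definition place_diagonal :: "nat \<Rightarrow> nat \<Rightarrow> (nat \<Rightarrow> nat) \<Rightarrow> nat \<Rightarrow> nat" where
  "place_diagonal n r \<alpha> i = (if i \<in> {n - r + 1..n} then \<alpha> (i - (n - r)) else 0)"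

text \<open>The main diagonal is read from \<open>b\<close>. The value 0 is given to cells beyond
  both row n and column m: on either side of the main diagonal, leaving one range forces leaving the
  other.\<close>

definition array_of ::
    "nat \<Rightarrow> nat \<Rightarrow> (nat \<Rightarrow> nat) \<Rightarrow> (nat \<Rightarrow> nat \<Rightarrow> nat) \<Rightarrow> (nat \<Rightarrow> nat \<Rightarrow> nat) \<Rightarrow> nat \<times> nat \<Rightarrow> enat" where
  "array_of n m lam b b' = (\<lambda>(i, j)\<in>{1..} \<times> {1..}.
     if j \<le> lam i then \<infinity>
     else if i + m \<le> j + n then (if i \<le> n then enat (b (j + n - (i + m)) i - (n - i)) else 0)
     else (if j \<le> m then enat (b' (i + m - (j + n)) j - (m - j)) else 0))"

definition strict_part :: "nat \<Rightarrow> (nat \<Rightarrow> nat) \<Rightarrow> nat \<Rightarrow> nat" where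
  "strict_part n \<nu> i = \<nu> i + (n - i)"

context pit_shape
begin

lemma pit_shape_swap: "pit_shape m n r lam' lam"
proof
  show "1 \<le> i \<Longrightarrow> 1 \<le> j \<Longrightarrow> j \<le> lam' i \<longleftrightarrow> i \<le> lam j" for i j
    using transpose_iff by blast
  show "lam' (Suc j) \<le> lam' j" if "1 \<le> j" for j
  proof (cases "lam' (Suc j) = 0")
    case False
    then have "Suc j \<le> lam (lam' (Suc j))"
      using transpose_iff[of "lam' (Suc j)" "Suc j"] by simp
    then show ?thesis
      using transpose_iff[of "lam' (Suc j)" j] False that by simp
  qed simp
  show "n - r \<le> lam' j" if "1 \<le> j" "j \<le> m - r" for j
  proof (cases "n - r = 0")
    case False
    then have c: "1 \<le> n - r"
      by simp
    then have "j \<le> lam (n - r)"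
      using inner_corner[OF c order_refl] that by simp
    then show ?thesis
      using transpose_iff[OF c that(1)] by blast
  qed simp
  show "lam' (m - r + 1) \<le> n - r"
  proof (rule ccontr)
    assume "\<not> ?thesis"
    then show False
      using transpose_iff[of "n - r + 1" "m - r + 1"] outer_corner by simp
  qed
qed (rule r_le)+

lemma lam_antimono: "1 \<le> i \<Longrightarrow> i \<le> j \<Longrightarrow> lam j \<le> lam i"
proof (induction j)
  case (Suc j)
  then show ?case
    using lam_decreasing[of j] by (cases "i = Suc j") auto
qed simp

lemma start_eq_0_iff:
  assumes "i \<in> {1..n}"
  shows "start n m lam i = 0 \<longleftrightarrow> n - r < i"
proof (cases "n - r < i")
  case True
  then show ?thesis
    using lam_antimono[of "n - r + 1" i] outer_corner r_le by (simp add: start_def)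
next
  case False
  then show ?thesis
    using inner_corner[of i] assms r_le by (simp add: start_def)
qed

lemma start_le_iff:
  assumes "j + n = i + k + m"
  shows "start n m lam i \<le> k \<longleftrightarrow> \<not> j \<le> lam i"
  using assms by (simp add: start_def) linarith

lemma staircase_start: "staircase n (start n m lam)"
  unfolding staircase_def
proof
  fix i assume "i \<in> {1..<n}"
  then have "lam (Suc i) \<le> lam i"
    by (intro lam_decreasing) simp
  then show "start n m lam (Suc i) \<le> start n m lam i - 1"
    by (simp add: start_def)
qed

lemma admissible_place_diagonal:
  assumes "\<alpha> \<in> decreasing_tuples r"
  shows "admissible n (start n m lam) (place_diagonal n r \<alpha>)"
  unfolding admissible_def
proof (intro conjI allI ballI impI)
  show "place_diagonal n r \<alpha> i = 0" if "i \<notin> {1..n} \<or> 0 < start n m lam i" for i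
    using that start_eq_0_iff[of i] by (auto simp: place_diagonal_def)
  fix i assume i: "i \<in> {1..<n}" "start n m lam i = 0"
  then have "n - r < i"
    using start_eq_0_iff[of i] by simp
  then show "place_diagonal n r \<alpha> (Suc i) < place_diagonal n r \<alpha> i"
    using decreasing_tuplesD[OF assms, of "i - (n - r)" "Suc i - (n - r)"] i r_le by (simp add: place_diagonal_def)
qed

section \<open>From an array to its two halves\<close>

lemma pit_arrays_swap:
  assumes "a \<in> pit_arrays n m \<mu> \<nu> lam"
  shows "a \<circ> prod.swap \<in> pit_arrays m n \<nu> \<mu> lam'"
  using assms transpose_iff unfolding pit_arrays_def diagram_def by (auto simp: extensional_def)

lemma pit_arrays_0:
  assumes a: "a \<in> pit_arrays n m \<mu> \<nu> lam" and "n < i" "m < j"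
  shows "a (i, j) = 0"
proof -
  have dec: "a (i + 1, j) \<le> a (i, j)" "a (i, j + 1) \<le> a (i, j)" if "1 \<le> i" "1 \<le> j" for i j
    using a that by (auto simp: pit_arrays_def)
  have 1: "a (n + 1 + d, m + 1) = 0" for d
  proof (induction d)
    case 0
    then show ?case using a by (simp add: pit_arrays_def)
  next
    case (Suc d)
    then show ?case using dec(1)[of "n + 1 + d" "m + 1"] by simp
  qed
  have 2: "a (n + 1 + d, m + 1 + e) = 0" for d e
  proof (induction e)
    case 0
    then show ?case using 1[of d] by simp
  next
    case (Suc e)
    then show ?case using dec(2)[of "n + 1 + d" "m + 1 + e"] by simp
  qed
  show ?thesis
    using 2[of "i - (n + 1)" "j - (m + 1)"] assms(2,3) by simp
qed

lemma pit_arrays_finite: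
  assumes "a \<in> pit_arrays n m \<mu> \<nu> lam" "1 \<le> i" "1 \<le> j" "\<not> j \<le> lam i"
  shows "a (i, j) = enat (the_enat (a (i, j)))"
proof -
  have "a (i, j) \<noteq> \<infinity>"
    using assms by (simp add: pit_arrays_def diagram_def)
  then show ?thesis
    by (cases "a (i, j)") auto
qed

lemma pit_arrays_decreasing:
  assumes a: "a \<in> pit_arrays n m \<mu> \<nu> lam" and ij: "1 \<le> i" "1 \<le> j" "\<not> j \<le> lam i"
  shows "the_enat (a (i, j + 1)) \<le> the_enat (a (i, j))"
    and "the_enat (a (i + 1, j)) \<le> the_enat (a (i, j))"
proof -
  have "a (i, j + 1) \<le> a (i, j)" "a (i + 1, j) \<le> a (i, j)"
    using a ij by (auto simp: pit_arrays_def)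
  then show "the_enat (a (i, j + 1)) \<le> the_enat (a (i, j))" "the_enat (a (i + 1, j)) \<le> the_enat (a (i, j))"
    using pit_arrays_finite[OF a ij] by (metis enat_ile enat_ord_simps(1) the_enat.simps)+
qed

lemma half_of_mem:
  assumes a: "a \<in> pit_arrays n m \<mu> \<nu> lam"
  shows "half_of n m lam a \<in> half_arrays n (start n m lam) (strict_part n \<nu>) (place_diagonal n r (diagonal_of n m r a))"
proof -
  have cell: "1 \<le> i + k + m - n" "\<not> i + k + m - n \<le> lam i" "i + k + m - n + n = i + k + m"
    if "start n m lam i \<le> k" for i k
    using that by (auto simp: start_def)
  have 0: "half_of n m lam a 0 = place_diagonal n r (diagonal_of n m r a)"
  proof
    fix i
    show "half_of n m lam a 0 i = place_diagonal n r (diagonal_of n m r a) i"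
    proof (cases "i \<in> {1..n} \<and> n - r < i")
      case True
      define k where "k = i - (n - r)"
      have k: "k \<in> {1..r}" "i = n - r + k"
        using True r_le by (auto simp: k_def)
      have eqs: "i + m - n = m - r + k" "n - i = r - k"
        using k r_le by auto
      have "half_of n m lam a 0 i = the_enat (a (i, i + m - n)) + (n - i)"
        using True start_eq_0_iff[of i] by (simp add: half_of_def)
      also have "\<dots> = diagonal_of n m r a k"
        using k(1) unfolding eqs by (simp add: diagonal_of_def k(2))
      also have "\<dots> = place_diagonal n r (diagonal_of n m r a) i"
        using True by (simp add: place_diagonal_def k_def)
      finally show ?thesis .
    next
      case False
      then show ?thesis
        using start_eq_0_iff[of i] by (auto simp: half_of_def place_diagonal_def)
    qed
  qed
  have 1: "half_of n m lam a (Suc k) i \<le> half_of n m lam a k i" if "i \<in> {1..n}" "start n m lam i \<le> k" for k i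
    using pit_arrays_decreasing(1)[OF a _ cell(1,2)[OF that(2)]] cell(1)[OF that(2)] that
    by (simp add: half_of_def Suc_diff_le)
  have 2: "half_of n m lam a k (Suc i) < half_of n m lam a (Suc k) i"
    if i: "i \<in> {1..<n}" and k: "start n m lam i \<le> Suc k" for k i
  proof -
    have "start n m lam (Suc i) \<le> start n m lam i - 1"
      using staircase_start i unfolding staircase_def by blast
    then have "start n m lam (Suc i) \<le> k"
      using k by simp
    moreover have "the_enat (a (i + 1, i + Suc k + m - n)) \<le> the_enat (a (i, i + Suc k + m - n))"
      using pit_arrays_decreasing(2)[OF a _ cell(1,2)[OF k]] i by simp
    ultimately have "half_of n m lam a k (Suc i) \<le> the_enat (a (i, i + Suc k + m - n)) + (n - Suc i)"
      "half_of n m lam a (Suc k) i = the_enat (a (i, i + Suc k + m - n)) + (n - i)"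
      using i k by (simp_all add: half_of_def)
    moreover have "n - Suc i < n - i"
      using i by auto
    ultimately show ?thesis
      by linarith
  qed
  have 3: "\<forall>\<^sub>F k in sequentially. half_of n m lam a k i = strict_part n \<nu> i" if i: "i \<in> {1..n}" for i
  proof -
    have "\<forall>\<^sub>F j in sequentially. a (i, j) = enat (\<nu> i)"
      using a i by (simp add: pit_arrays_def)
    then obtain J where J: "\<And>j. J \<le> j \<Longrightarrow> a (i, j) = enat (\<nu> i)"
      unfolding eventually_sequentially by blast
    have "half_of n m lam a k i = strict_part n \<nu> i" if "J + n + start n m lam i \<le> k" for k
      using J[of "i + k + m - n"] that i by (simp add: half_of_def strict_part_def)
    then show ?thesis
      unfolding eventually_sequentially by blast
  qed
  show ?thesis
    unfolding half_arrays_def half_chains_def using 0 1 2 3 by (auto simp: half_of_def)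
qed

lemma diagonal_of_mem:
  assumes a: "a \<in> pit_arrays n m \<mu> \<nu> lam"
  shows "diagonal_of n m r a \<in> decreasing_tuples r"
proof -
  have le: "the_enat (a (n - r + Suc k, m - r + Suc k)) \<le> the_enat (a (n - r + k, m - r + k))" if k: "k \<in> {1..<r}" for k
  proof -
    have out: "\<not> m - r + k \<le> lam (n - r + k)"
      using lam_antimono[of "n - r + 1" "n - r + k"] outer_corner k by simp
    have "lam (n - r + k + 1) \<le> lam (n - r + k)"
      using lam_decreasing[of "n - r + k"] k by simp
    then have out': "\<not> m - r + k \<le> lam (n - r + k + 1)"
      using out by simp
    have "the_enat (a (n - r + k + 1, m - r + k + 1)) \<le> the_enat (a (n - r + k + 1, m - r + k))"
      by (rule pit_arrays_decreasing(1)[OF a _ _ out']) (use k in auto)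
    also have "\<dots> \<le> the_enat (a (n - r + k, m - r + k))"
      by (rule pit_arrays_decreasing(2)[OF a _ _ out]) (use k in auto)
    finally show ?thesis
      by simp
  qed
  show ?thesis
    unfolding decreasing_tuples_def
  proof (intro CollectI conjI ballI)
    fix k assume k: "k \<in> {1..<r}"
    then have "diagonal_of n m r a (Suc k) = the_enat (a (n - r + Suc k, m - r + Suc k)) + (r - Suc k)"
      "diagonal_of n m r a k = the_enat (a (n - r + k, m - r + k)) + (r - k)"
      by (auto simp: diagonal_of_def)
    moreover have "r - Suc k < r - k"
      using k by auto
    ultimately show "diagonal_of n m r a (Suc k) < diagonal_of n m r a k"
      using le[OF k] by linarith
  qed (simp add: diagonal_of_def)
qed

section \<open>From two halves back to the array\<close>

lemma diagonal_of_swap: "diagonal_of m n r (a \<circ> prod.swap) = diagonal_of n m r a"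
  by (simp add: diagonal_of_def)

text \<open>Transposition changes which half supplies the main diagonal. There the two agree, since
  both start from the same \<alpha> and n - i = m - j.\<close>

lemma array_of_swap:
  assumes "b 0 = place_diagonal n r \<alpha>" "b' 0 = place_diagonal m r \<alpha>"
  shows "array_of n m lam b b' \<circ> prod.swap = array_of m n lam' b' b"
proof
  fix p :: "nat \<times> nat"
  obtain j i where p: "p = (j, i)" by (cases p)
  show "(array_of n m lam b b' \<circ> prod.swap) p = array_of m n lam' b' b p"
  proof (cases "1 \<le> i \<and> 1 \<le> j \<and> \<not> j \<le> lam i \<and> i + m = j + n")
    case True
    have "n - r < i"
    proof (rule ccontr)
      assume "\<not> ?thesis"
      then show False
        using inner_corner[of i] True r_le by arith
    qed
    moreover have "m - r < j"
      using calculation True r_le by arith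
    moreover have "i - (n - r) = j - (m - r)" "n - i = m - j" if "i \<le> n"
      using calculation True r_le that by arith+
    ultimately have "b 0 i - (n - i) = b' 0 j - (m - j)" if "i \<le> n"
      using that True assms by (simp add: place_diagonal_def)
    then show ?thesis
      using True transpose_iff[of i j] by (auto simp: p array_of_def)
  next
    case False
    then show ?thesis
      using transpose_iff[of i j] by (auto simp: p array_of_def)
  qed
qed

text \<open>On and above the main diagonal this is the row condition of \<open>b\<close>; below it,
  neighbours in a row are neighbours in a column of the transposed half, so the column condition of
  \<open>b'\<close> applies. Monotonicity in columns is obtained by transposition.\<close>

lemma array_of_row_decreasing:
  assumes b: "b \<in> half_arrays n (start n m lam) N (place_diagonal n r \<alpha>)"
    and b': "b' \<in> half_arrays m (start m n lam') M (place_diagonal m r \<alpha>)"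
    and ij: "1 \<le> i" "1 \<le> j"
  shows "array_of n m lam b b' (i, j + 1) \<le> array_of n m lam b b' (i, j)"
proof (cases "j \<le> lam i")
  case True
  then show ?thesis
    using ij by (simp add: array_of_def)
next
  case out: False
  show ?thesis
  proof (cases "i + m \<le> j + n")
    case True
    define k where "k = j + n - (i + m)"
    have k: "j + n = i + k + m" "Suc j + n - (i + m) = Suc k"
      using True by (auto simp: k_def)
    then have "start n m lam i \<le> k"
      using start_le_iff[of j i k] out by simp
    then have "b (Suc k) i \<le> b k i" if "i \<le> n"
      using b that ij by (simp add: half_arrays_def half_chains_def)
    then show ?thesis
      using True out ij k by (auto simp: array_of_def k_def[symmetric] intro: diff_le_mono)
  next
    case False
    define k where "k = i + m - (Suc j + n)"
    have k: "i + m = Suc j + n + k" "i + m - (j + n) = Suc k"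
      using False by (auto simp: k_def)
    have "start m n lam' j \<le> Suc k"
      using pit_shape.start_le_iff[OF pit_shape_swap, of i j "Suc k"] k out transpose_iff[of i j] ij by simp
    then have lt: "b' k (Suc j) < b' (Suc k) j" if "j < m"
      using b' that ij by (simp add: half_arrays_def half_chains_def)
    show ?thesis
    proof (cases "k = 0")
      case True
      \<comment> \<open>The cell (i, j + 1) lies on the main diagonal and is read from
        \<open>b\<close>, while the inequality at hand is one for \<open>b'\<close>.\<close>
      have same: "b 0 i - (n - i) = b' 0 (Suc j) - (m - Suc j)" if "i \<le> n"
      proof -
        have "array_of n m lam b b' (i, Suc j) = array_of m n lam' b' b (Suc j, i)"
          using fun_cong[OF array_of_swap[of b \<alpha> b'], of "(Suc j, i)"] b b'
          by (simp add: half_arrays_def half_chains_def)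
        then show ?thesis
          using that k True out ij transpose_iff[of i "Suc j"] by (simp add: array_of_def)
      qed
      show ?thesis
        using k True out ij lt same False by (auto simp: array_of_def)
    next
      case False
      then show ?thesis
        using k out ij lt by (auto simp: array_of_def k_def[symmetric])
    qed
  qed
qed

lemma array_of_row_limit:
  assumes b: "b \<in> half_arrays n (start n m lam) (strict_part n \<nu>) Y" and "1 \<le> i" and \<nu>: "n < i \<Longrightarrow> \<nu> i = 0"
  shows "\<forall>\<^sub>F j in sequentially. array_of n m lam b b' (i, j) = enat (\<nu> i)"
proof (cases "i \<le> n")
  case True
  then have "\<forall>\<^sub>F k in sequentially. b k i = strict_part n \<nu> i"
    using b assms(2) by (simp add: half_arrays_def)
  then obtain K where K: "\<And>k. K \<le> k \<Longrightarrow> b k i = strict_part n \<nu> i"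
    unfolding eventually_sequentially by blast
  have "array_of n m lam b b' (i, j) = enat (\<nu> i)" if "lam i + i + m + K + 1 \<le> j" for j
    using K[of "j + n - (i + m)"] that True assms(2) by (simp add: array_of_def strict_part_def)
  then show ?thesis
    unfolding eventually_sequentially by blast
next
  case False
  have "array_of n m lam b b' (i, j) = enat (\<nu> i)" if "lam i + i + m + 1 \<le> j" for j
    using that False assms(2) \<nu> by (simp add: array_of_def zero_enat_def)
  then show ?thesis
    unfolding eventually_sequentially by blast
qed

lemma array_of_mem:
  assumes b: "b \<in> half_arrays n (start n m lam) (strict_part n \<nu>) (place_diagonal n r \<alpha>)"
    and b': "b' \<in> half_arrays m (start m n lam') (strict_part m \<mu>) (place_diagonal m r \<alpha>)"
    and \<nu>: "\<And>i. n < i \<Longrightarrow> \<nu> i = 0" and \<mu>: "\<And>j. m < j \<Longrightarrow> \<mu> j = 0"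
  shows "array_of n m lam b b' \<in> pit_arrays n m \<mu> \<nu> lam"
proof -
  have swap: "array_of n m lam b b' (i, j) = array_of m n lam' b' b (j, i)" for i j
    using fun_cong[OF array_of_swap[of b \<alpha> b'], of "(j, i)"] b b' by (simp add: half_arrays_def half_chains_def)
  have row: "array_of n m lam b b' (i, j + 1) \<le> array_of n m lam b b' (i, j)" if "1 \<le> i" "1 \<le> j" for i j
    by (rule array_of_row_decreasing[OF b b' that])
  have col: "array_of n m lam b b' (i + 1, j) \<le> array_of n m lam b b' (i, j)" if "1 \<le> i" "1 \<le> j" for i j
    unfolding swap by (rule pit_shape.array_of_row_decreasing[OF pit_shape_swap b' b that(2,1)])
  have row_lim: "\<forall>\<^sub>F j in sequentially. array_of n m lam b b' (i, j) = enat (\<nu> i)" if "1 \<le> i" for i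
    by (rule array_of_row_limit[OF b that]) (rule \<nu>)
  have col_lim: "\<forall>\<^sub>F i in sequentially. array_of n m lam b b' (i, j) = enat (\<mu> j)" if "1 \<le> j" for j
    unfolding swap by (rule pit_shape.array_of_row_limit[OF pit_shape_swap b' that]) (rule \<mu>)
  have "lam (n + 1) \<le> m"
    using lam_antimono[of "n - r + 1" "n + 1"] outer_corner by simp
  then have "array_of n m lam b b' (n + 1, m + 1) = 0"
    by (simp add: array_of_def)
  moreover have "array_of n m lam b b' (i, j) = \<infinity> \<longleftrightarrow> (i, j) \<in> diagram lam" if "1 \<le> i" "1 \<le> j" for i j
    using that by (auto simp: array_of_def diagram_def zero_enat_def)
  moreover have "array_of n m lam b b' \<in> extensional ({1..} \<times> {1..})"
    by (simp add: array_of_def)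
  ultimately show ?thesis
    unfolding pit_arrays_def using row col row_lim col_lim by blast
qed

lemma half_of_array_of:
  assumes b: "b \<in> half_arrays n (start n m lam) (strict_part n \<nu>) Y"
  shows "half_of n m lam (array_of n m lam b b') = b"
proof (intro ext)
  fix k i
  show "half_of n m lam (array_of n m lam b b') k i = b k i"
  proof (cases "i \<in> {1..n} \<and> start n m lam i \<le> k")
    case True
    then have j: "1 \<le> i + k + m - n" "i + k + m - n + n = i + k + m"
      by (auto simp: start_def)
    then have "\<not> i + k + m - n \<le> lam i"
      using True start_le_iff[of "i + k + m - n" i k] by blast
    moreover have "n - i \<le> b k i"
      using half_arrays_limit_le[OF b, of i k] True by (simp add: strict_part_def)
    ultimately show ?thesis
      using True j by (simp add: half_of_def array_of_def)
  next
    case False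
    have "b k i = 0" if "i \<notin> {1..n} \<or> k < start n m lam i"
      using b that unfolding half_arrays_def half_chains_def by blast
    then show ?thesis
      using False by (simp only: half_of_def if_not_P) auto
  qed
qed

lemma array_of_half_of:
  assumes a: "a \<in> pit_arrays n m \<mu> \<nu> lam"
  shows "array_of n m lam (half_of n m lam a) (half_of m n lam' (a \<circ> prod.swap)) = a"
proof
  fix p :: "nat \<times> nat"
  obtain i j where p: "p = (i, j)" by (cases p)
  consider "\<not> (1 \<le> i \<and> 1 \<le> j)" | "1 \<le> i" "1 \<le> j" "j \<le> lam i" | "1 \<le> i" "1 \<le> j" "\<not> j \<le> lam i"
    by blast
  then show "array_of n m lam (half_of n m lam a) (half_of m n lam' (a \<circ> prod.swap)) p = a p"
  proof cases
    case 1
    have "a \<in> extensional ({1..} \<times> {1..})"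
      using a unfolding pit_arrays_def by blast
    then have "a p = undefined"
      using 1 by (auto simp: p extensional_def)
    then show ?thesis
      using 1 by (auto simp: p array_of_def)
  next
    case 2
    then have "a p = \<infinity>"
      using a by (simp add: p pit_arrays_def diagram_def)
    then show ?thesis
      using 2 by (simp add: p array_of_def)
  next
    case 3
    note fin = pit_arrays_finite[OF a 3]
    show ?thesis
    proof (cases "i + m \<le> j + n")
      case True
      define k where "k = j + n - (i + m)"
      have k: "j + n = i + k + m" "i + k + m - n = j"
        using True by (auto simp: k_def)
      have "half_of n m lam a k i = the_enat (a (i, j)) + (n - i)" if "i \<le> n"
        using start_le_iff[OF k(1)] 3 that k by (simp add: half_of_def)
      moreover have "a (i, j) = 0" if "n < i"
        using pit_arrays_0[OF a that, of j] True that by simp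
      ultimately show ?thesis
        using True 3 fin by (auto simp: p array_of_def k_def[symmetric])
    next
      case False
      define k where "k = i + m - (j + n)"
      have k: "i + m = j + k + n" "j + k + n - m = i"
        using False by (auto simp: k_def)
      have "half_of m n lam' (a \<circ> prod.swap) k j = the_enat (a (i, j)) + (m - j)" if "j \<le> m"
        using pit_shape.start_le_iff[OF pit_shape_swap k(1)] 3 transpose_iff[of i j] that k by (simp add: half_of_def)
      moreover have "a (i, j) = 0" if "m < j"
        using pit_arrays_0[OF a _ that, of i] False that by simp
      ultimately show ?thesis
        using False 3 fin by (auto simp: p array_of_def k_def[symmetric])
    qed
  qed
qed

lemma place_diagonal_shift: "k \<in> {1..r} \<Longrightarrow> place_diagonal n r \<alpha> (n - r + k) = \<alpha> k"
  unfolding place_diagonal_def using r_le by (subst if_P) auto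

lemma place_diagonal_inj:
  assumes "\<alpha> \<in> decreasing_tuples r" "\<beta> \<in> decreasing_tuples r" "place_diagonal n r \<alpha> = place_diagonal n r \<beta>"
  shows "\<alpha> = \<beta>"
proof
  fix k
  show "\<alpha> k = \<beta> k"
  proof (cases "k \<in> {1..r}")
    case True
    then show ?thesis
      using fun_cong[OF assms(3), of "n - r + k"] by (simp only: place_diagonal_shift)
  next
    case False
    then show ?thesis
      using assms(1,2) by (auto simp: decreasing_tuples_def PiE_def extensional_def)
  qed
qed

text \<open>The tuple \<alpha> is recorded next to the two halves because it is all that couples
  them: for fixed \<alpha> they vary independently.\<close>

lemma bij_betw_pit_arrays:
  assumes \<nu>: "\<And>i. n < i \<Longrightarrow> \<nu> i = 0" and \<mu>: "\<And>j. m < j \<Longrightarrow> \<mu> j = 0"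
  shows "bij_betw (\<lambda>a. (diagonal_of n m r a, half_of n m lam a, half_of m n lam' (a \<circ> prod.swap)))
    (pit_arrays n m \<mu> \<nu> lam)
    (SIGMA \<alpha>:decreasing_tuples r. half_arrays n (start n m lam) (strict_part n \<nu>) (place_diagonal n r \<alpha>) \<times>
       half_arrays m (start m n lam') (strict_part m \<mu>) (place_diagonal m r \<alpha>))"
    (is "bij_betw ?f ?A ?B")
proof (rule bij_betw_byWitness[where f' = "\<lambda>(\<alpha>, b, b'). array_of n m lam b b'"])
  show "\<forall>a\<in>?A. (case ?f a of (\<alpha>, b, b') \<Rightarrow> array_of n m lam b b') = a"
    using array_of_half_of by simp
  have fwd: "?f a \<in> ?B" if a: "a \<in> ?A" for a
    using half_of_mem[OF a] diagonal_of_mem[OF a] pit_shape.half_of_mem[OF pit_shape_swap pit_arrays_swap[OF a]]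
    by (simp add: diagonal_of_swap)
  then show "?f ` ?A \<subseteq> ?B"
    by blast
  have mem: "array_of n m lam b b' \<in> ?A" if "(\<alpha>, b, b') \<in> ?B" for \<alpha> b b'
    using that \<nu> \<mu> by (intro array_of_mem[where \<alpha> = \<alpha>]) auto
  then show "(\<lambda>(\<alpha>, b, b'). array_of n m lam b b') ` ?B \<subseteq> ?A"
    by (intro image_subsetI) (metis (no_types, lifting) case_prod_conv prod_cases3)
  show "\<forall>p\<in>?B. ?f (case p of (\<alpha>, b, b') \<Rightarrow> array_of n m lam b b') = p"
  proof
    fix p assume "p \<in> ?B"
    then obtain \<alpha> b b' where p: "p = (\<alpha>, b, b')" and \<alpha>: "\<alpha> \<in> decreasing_tuples r"
      and b: "b \<in> half_arrays n (start n m lam) (strict_part n \<nu>) (place_diagonal n r \<alpha>)"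
      and b': "b' \<in> half_arrays m (start m n lam') (strict_part m \<mu>) (place_diagonal m r \<alpha>)"
      by auto
    have 0: "b 0 = place_diagonal n r \<alpha>" "b' 0 = place_diagonal m r \<alpha>"
      using b b' by (simp_all add: half_arrays_def half_chains_def)
    have 1: "half_of n m lam (array_of n m lam b b') = b"
      by (rule half_of_array_of[OF b])
    have 2: "half_of m n lam' (array_of n m lam b b' \<circ> prod.swap) = b'"
      unfolding array_of_swap[of b \<alpha> b', OF 0] by (rule pit_shape.half_of_array_of[OF pit_shape_swap b'])
    have a: "array_of n m lam b b' \<in> ?A"
      using mem \<alpha> b b' by simp
    have "b \<in> half_arrays n (start n m lam) (strict_part n \<nu>)
        (place_diagonal n r (diagonal_of n m r (array_of n m lam b b')))"
      using half_of_mem[OF a] by (simp only: 1)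
    then have "b 0 = place_diagonal n r (diagonal_of n m r (array_of n m lam b b'))"
      unfolding half_arrays_def half_chains_def by blast
    from trans[OF sym[OF this] 0(1)] have "diagonal_of n m r (array_of n m lam b b') = \<alpha>"
      by (rule place_diagonal_inj[OF diagonal_of_mem[OF a] \<alpha>])
    then show "?f (case p of (\<alpha>, b, b') \<Rightarrow> array_of n m lam b b') = p"
      by (simp add: p 1 2)
  qed
qed

text \<open>With \<delta> = 0 this is the upper half including the main diagonal; with \<delta> = 1
  and the transposed array it is the lower half without it. The shift by n - i occurs in both terms
  of the difference and cancels.\<close>

lemma infsum_region:
  assumes a: "a \<in> pit_arrays n m \<mu> \<nu> lam" and \<nu>: "\<And>i. n < i \<Longrightarrow> \<nu> i = 0"
  shows "(\<Sum>\<^sub>\<infinity>(i, j) \<in> {(i, j). 1 \<le> i \<and> 1 \<le> j \<and> int i - int n + int \<delta> \<le> int j - int m \<and> (i, j) \<notin> diagram lam}.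
      int (the_enat (a (i, j))) - int (\<nu> i)) =
    (\<Sum>\<^sub>\<infinity>(k, i) \<in> {(k, i). \<delta> \<le> k \<and> i \<in> {1..n} \<and> start n m lam i \<le> k}.
      int (half_of n m lam a k i) - int (strict_part n \<nu> i))"
    (is "infsum ?f ?R = infsum ?h ?C")
proof -
  define g where "g = (\<lambda>(k, i). (i, i + k + m - n))"
  have cell: "1 \<le> i + k + m - n \<and> i + k + m - n + n = i + k + m \<and> \<not> i + k + m - n \<le> lam i"
    if "start n m lam i \<le> k" for i k
    using that by (auto simp: start_def)
  have bij: "bij_betw g ?C (?R \<inter> {(i, j). i \<le> n})"
  proof (rule bij_betw_byWitness[where f' = "\<lambda>(i, j). (j + n - (i + m), i)"])
    show "\<forall>x\<in>?C. (case g x of (i, j) \<Rightarrow> (j + n - (i + m), i)) = x"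
      using cell by (auto simp: g_def)
    show "\<forall>y\<in>?R \<inter> {(i, j). i \<le> n}. g (case y of (i, j) \<Rightarrow> (j + n - (i + m), i)) = y"
      by (auto simp: g_def)
    show "g ` ?C \<subseteq> ?R \<inter> {(i, j). i \<le> n}"
    proof (intro subsetI, elim imageE)
      fix p x assume "x \<in> ?C" "p = g x"
      then obtain k i where "p = (i, i + k + m - n)" "\<delta> \<le> k" "i \<in> {1..n}" "start n m lam i \<le> k"
        by (auto simp: g_def)
      then show "p \<in> ?R \<inter> {(i, j). i \<le> n}"
        using cell[of i k] by (auto simp: diagram_def)
    qed
    show "(\<lambda>(i, j). (j + n - (i + m), i)) ` (?R \<inter> {(i, j). i \<le> n}) \<subseteq> ?C"
    proof (intro subsetI, elim imageE)
      fix p x assume x: "x \<in> ?R \<inter> {(i, j). i \<le> n}" and p: "p = (\<lambda>(i, j). (j + n - (i + m), i)) x"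
      obtain i j where ij: "x = (i, j)" by (cases x)
      have *: "1 \<le> i" "i \<le> n" "1 \<le> j" "int i - int n + int \<delta> \<le> int j - int m" "\<not> j \<le> lam i"
        using x by (auto simp: ij diagram_def)
      then have "start n m lam i \<le> j + n - (i + m)" "\<delta> \<le> j + n - (i + m)"
        using start_le_iff[of j i "j + n - (i + m)"] by auto
      then show "p \<in> ?C"
        using * by (simp add: p ij)
    qed
  qed
  have "infsum ?h ?C = (\<Sum>\<^sub>\<infinity>x\<in>?C. ?f (g x))"
    by (rule infsum_cong) (auto simp: g_def half_of_def strict_part_def)
  also have "\<dots> = infsum ?f (?R \<inter> {(i, j). i \<le> n})"
    by (rule infsum_reindex_bij_betw[OF bij])
  also have "\<dots> = infsum ?f ?R"
  proof (rule infsum_cong_neutral)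
    fix x assume x: "x \<in> ?R - ?R \<inter> {(i, j). i \<le> n}"
    obtain i j where ij: "x = (i, j)" by (cases x)
    have "n < i" "m < j"
      using x by (auto simp: ij)
    then show "?f x = 0"
      using pit_arrays_0[OF a, of i j] \<nu>[of i] by (simp add: ij zero_enat_def)
  qed auto
  finally show ?thesis ..
qed

lemma array_weight_eq:
  assumes a: "a \<in> pit_arrays n m \<mu> \<nu> lam"
    and \<nu>: "\<And>i. n < i \<Longrightarrow> \<nu> i = 0" and \<mu>: "\<And>j. m < j \<Longrightarrow> \<mu> j = 0"
  shows "array_weight n m \<mu> \<nu> lam a =
    (\<Sum>k = 1..r. int (diagonal_of n m r a k) - int (strict_part n \<nu> (n - r + k))) +
    half_weight n (start n m lam) (strict_part n \<nu>) (half_of n m lam a) +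
    half_weight m (start m n lam') (strict_part m \<mu>) (half_of m n lam' (a \<circ> prod.swap))"
proof -
  define b where "b = half_of n m lam a"
  define h where "h = (\<lambda>(k, i). int (b k i) - int (strict_part n \<nu> i))"
  have mem: "b \<in> half_arrays n (start n m lam) (strict_part n \<nu>) (place_diagonal n r (diagonal_of n m r a))"
    unfolding b_def by (rule half_of_mem[OF a])
  have "{(k, i). 0 \<le> k \<and> i \<in> {1..n} \<and> start n m lam i \<le> k} =
      Pair 0 ` {n - r + 1..n} \<union> half_cells n (start n m lam)" (is "?C = _")
  proof (intro equalityI subsetI)
    fix p assume p: "p \<in> ?C"
    then obtain k i where ki: "p = (k, i)" "i \<in> {1..n}" "start n m lam i \<le> k"
      by auto
    then show "p \<in> Pair 0 ` {n - r + 1..n} \<union> half_cells n (start n m lam)"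
      using start_eq_0_iff[of i] by (cases "k = 0") (auto simp: half_cells_def)
  next
    fix p assume "p \<in> Pair 0 ` {n - r + 1..n} \<union> half_cells n (start n m lam)"
    then show "p \<in> ?C"
      using start_eq_0_iff by (auto simp: half_cells_def)
  qed
  then have "infsum h ?C = infsum h (Pair 0 ` {n - r + 1..n} \<union> half_cells n (start n m lam))"
    by simp
  also have "\<dots> = infsum h (Pair 0 ` {n - r + 1..n}) + infsum h (half_cells n (start n m lam))"
    by (rule infsum_Un_disjoint) (use half_weight_summable[OF mem] in \<open>auto simp: h_def half_cells_def\<close>)
  also have "infsum h (half_cells n (start n m lam)) = half_weight n (start n m lam) (strict_part n \<nu>) b"
    by (simp add: half_weight_def h_def)
  also have "infsum h (Pair 0 ` {n - r + 1..n}) = (\<Sum>i = n - r + 1..n. int (b 0 i) - int (strict_part n \<nu> i))"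
    by (subst infsum_finite, simp, subst sum.reindex) (auto simp: inj_on_def h_def)
  also have "\<dots> = (\<Sum>k = 1..r. int (diagonal_of n m r a k) - int (strict_part n \<nu> (n - r + k)))"
  proof (rule sum.reindex_bij_witness[of _ "\<lambda>k. n - r + k" "\<lambda>i. i - (n - r)"])
    fix i assume i: "i \<in> {n - r + 1..n}"
    have "b 0 i = place_diagonal n r (diagonal_of n m r a) i"
      using mem by (simp add: half_arrays_def half_chains_def)
    then show "int (diagonal_of n m r a (i - (n - r))) - int (strict_part n \<nu> (n - r + (i - (n - r)))) =
        int (b 0 i) - int (strict_part n \<nu> i)"
      using i by (simp add: place_diagonal_def)
  qed (use r_le in auto)
  finally have right: "infsum h ?C = (\<Sum>k = 1..r. int (diagonal_of n m r a k) - int (strict_part n \<nu> (n - r + k))) +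
      half_weight n (start n m lam) (strict_part n \<nu>) b" .
  have R: "{(i, j). 1 \<le> i \<and> 1 \<le> j \<and> int i - int n \<le> int j - int m \<and> (i, j) \<notin> diagram lam} =
      {(i, j). 1 \<le> i \<and> 1 \<le> j \<and> int i - int n + int 0 \<le> int j - int m \<and> (i, j) \<notin> diagram lam}"
    by simp
  have first: "(\<Sum>\<^sub>\<infinity>(i, j) \<in> {(i, j). 1 \<le> i \<and> 1 \<le> j \<and> int i - int n \<le> int j - int m \<and> (i, j) \<notin> diagram lam}.
      int (the_enat (a (i, j))) - int (\<nu> i)) = infsum h ?C"
    unfolding R h_def b_def by (rule infsum_region[OF a \<nu>])
  have swap: "bij_betw prod.swap
      {(j, i). 1 \<le> j \<and> 1 \<le> i \<and> int j - int m + int 1 \<le> int i - int n \<and> (j, i) \<notin> diagram lam'}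
      {(i, j). 1 \<le> i \<and> 1 \<le> j \<and> int i - int n > int j - int m \<and> (i, j) \<notin> diagram lam}"
    by (rule bij_betw_byWitness[where f' = prod.swap]) (use transpose_iff in \<open>auto simp: diagram_def\<close>)
  have "(\<Sum>\<^sub>\<infinity>(i, j) \<in> {(i, j). 1 \<le> i \<and> 1 \<le> j \<and> int i - int n > int j - int m \<and> (i, j) \<notin> diagram lam}.
      int (the_enat (a (i, j))) - int (\<mu> j)) =
    (\<Sum>\<^sub>\<infinity>(j, i) \<in> {(j, i). 1 \<le> j \<and> 1 \<le> i \<and> int j - int m + int 1 \<le> int i - int n \<and> (j, i) \<notin> diagram lam'}.
      int (the_enat ((a \<circ> prod.swap) (j, i))) - int (\<mu> j))"
    by (subst infsum_reindex_bij_betw[OF swap, symmetric]) (simp add: case_prod_beta' prod.swap_def)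
  also have "\<dots> = half_weight m (start m n lam') (strict_part m \<mu>) (half_of m n lam' (a \<circ> prod.swap))"
    unfolding half_weight_def half_cells_def
    by (rule pit_shape.infsum_region[OF pit_shape_swap pit_arrays_swap[OF a] \<mu>])
  finally show ?thesis
    unfolding array_weight_def first right b_def by simp
qed

end

section \<open>The character as a sum over permutations\<close>

lemma prod_rotate_split:
  fixes f :: "nat \<Rightarrow> real"
  assumes "r \<le> n"
  shows "(\<Prod>i = 1..n. f i) = (\<Prod>i = 1..n - r. f i) * (\<Prod>k = 1..r. f (n - r + k))"
proof -
  have "(\<Prod>i = 1..n. f i) = (\<Prod>i = 1..n - r. f i) * (\<Prod>i = n - r + 1..n. f i)"
    using assms by (subst prod.union_disjoint[symmetric]) (auto intro!: prod.cong)
  also have "(\<Prod>i = n - r + 1..n. f i) = (\<Prod>k = 1..r. f (n - r + k))"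
    by (rule prod.reindex_bij_witness[of _ "\<lambda>k. n - r + k" "\<lambda>i. i - (n - r)"]) (use assms in auto)
  finally show ?thesis .
qed

text \<open>The n - r and m - r infinite columns give one factor 1/c each, and the r sums over the
  main diagonal give 1/c^2 each: n + m factors in total.\<close>

lemma leibniz2_scale:
  assumes "r \<le> n" "r \<le> m" "c \<noteq> 0"
  shows "leibniz2 n m r (\<lambda>l i. x l i * (1 / c)) (\<lambda>l i. y l i * (1 / c)) (\<lambda>i j. \<Psi> i j / c ^ 2) =
    leibniz2 n m r x y \<Psi> / c ^ (n + m)"
proof -
  have "c ^ (n - r) * (c ^ (m - r) * (c ^ 2) ^ r) = c ^ (n - r + (m - r) + 2 * r)"
    by (simp only: power_add power_mult mult.assoc)
  also have "n - r + (m - r) + 2 * r = n + m"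
    using assms by simp
  finally have c: "c ^ (n - r) * (c ^ (m - r) * (c ^ 2) ^ r) = c ^ (n + m)" .
  have x: "(\<Prod>l = r+1..n. x l (\<sigma> l) * (1 / c)) = (\<Prod>l = r+1..n. x l (\<sigma> l)) / c ^ (n - r)" for \<sigma>
    by (simp add: prod_dividef)
  have y: "(\<Prod>l = r+1..m. y l (\<sigma> l) * (1 / c)) = (\<Prod>l = r+1..m. y l (\<sigma> l)) / c ^ (m - r)" for \<sigma>
    by (simp add: prod_dividef)
  have \<Psi>: "(\<Prod>l = 1..r. \<Psi> (\<sigma> l) (\<tau> l) / c ^ 2) = (\<Prod>l = 1..r. \<Psi> (\<sigma> l) (\<tau> l)) / (c ^ 2) ^ r" for \<sigma> \<tau>
    by (simp add: prod_dividef)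
  show ?thesis
    unfolding leibniz2_def x y \<Psi> c[symmetric] by (simp add: sum_divide_distrib mult.assoc)
qed

context q_parameter
begin

lemma q_powi_diff: "q powi (int a - int b) = q ^ a * q powi (- int b)"
  using q_powi_add[of "int a" "- int b"] by simp

lemma halfdet_rotate:
  assumes r: "r \<le> n" and s: "\<And>i. i \<in> {1..n} \<Longrightarrow> s i = 0 \<longleftrightarrow> n - r < i"
  shows "halfdet n s N c h (place_diagonal n r \<alpha>) =
    (-1) ^ (r * (n - r)) * (\<Prod>i = 1..n - r. q ^ ((s i - 1) * N i)) *
    ldet n (\<lambda>l i. if l \<le> r then h (int (\<alpha> l) - int (N i)) else q powi (- ((int (s (l - r)) - 1) * int (N i))) * c)"
proof -
  define C where "C l i = (if s l = 0 then h (int (place_diagonal n r \<alpha> l) - int (N i))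
    else q powi (- ((int (s l) - 1) * int (N i))) * c)" for l i
  have prod: "(\<Prod>i = 1..n. q ^ ((s i - 1) * N i)) = (\<Prod>i = 1..n - r. q ^ ((s i - 1) * N i))"
  proof (rule prod.mono_neutral_right)
    show "\<forall>i\<in>{1..n} - {1..n - r}. q ^ ((s i - 1) * N i) = 1"
    proof
      fix i assume "i \<in> {1..n} - {1..n - r}"
      then have "s i = 0"
        using s[of i] by auto
      then show "q ^ ((s i - 1) * N i) = 1"
        by simp
    qed
  qed auto
  have "ldet n (\<lambda>l. C (rotation r n l)) = (-1) ^ (r * (n - r)) * ldet n C"
    using ldet_permute[OF rotation_permutes[OF r]] by (simp add: sign_rotation[OF r])
  then have "ldet n C = (-1) ^ (r * (n - r)) * ldet n (\<lambda>l. C (rotation r n l))"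
    by (simp add: mult.assoc[symmetric] power_mult_distrib[symmetric])
  also have "ldet n (\<lambda>l. C (rotation r n l)) =
      ldet n (\<lambda>l i. if l \<le> r then h (int (\<alpha> l) - int (N i)) else q powi (- ((int (s (l - r)) - 1) * int (N i))) * c)"
  proof (rule ldet_cong)
    fix l i assume l: "l \<in> {1..n}"
    show "C (rotation r n l) i = (if l \<le> r then h (int (\<alpha> l) - int (N i)) else q powi (- ((int (s (l - r)) - 1) * int (N i))) * c)"
    proof (cases "l \<le> r")
      case True
      then have range: "l + (n - r) \<in> {1..n}" "l + (n - r) \<in> {n - r + 1..n}"
        using l r by auto
      then have "s (l + (n - r)) = 0"
        using s[of "l + (n - r)"] by simp
      moreover have "place_diagonal n r \<alpha> (l + (n - r)) = \<alpha> l"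
        unfolding place_diagonal_def if_P[OF range(2)] by simp
      ultimately show ?thesis
        using True l by (simp add: C_def rotation_def)
    next
      case False
      then have range: "l - r \<in> {1..n}" "\<not> n - r < l - r"
        using l r by auto
      then have "s (l - r) \<noteq> 0"
        using s[OF range(1)] by simp
      then show ?thesis
        using False l by (simp add: C_def rotation_def)
    qed
  qed
  finally show ?thesis
    unfolding halfdet_def prod C_def[symmetric] by simp
qed

text \<open>The weight of the main diagonal is absorbed by scaling, q^(\<alpha>_l) in column l and
  q^(-N_i) in every row. In the infinite columns this raises the exponent from \<open>s - 1\<close>
  to \<open>s\<close>, the P + 1 of the formula.\<close>

lemma ldet_diagonal_weight:
  assumes r: "r \<le> n" and s: "\<And>i. i \<in> {1..n - r} \<Longrightarrow> 0 < s i"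
  shows "q powi (\<Sum>k = 1..r. int (\<alpha> k) - int (N (n - r + k))) * ((\<Prod>i = 1..n - r. q ^ ((s i - 1) * N i)) *
      ldet n (\<lambda>l i. if l \<le> r then h (int (\<alpha> l) - int (N i)) else q powi (- ((int (s (l - r)) - 1) * int (N i))) * c)) =
    (\<Prod>i = 1..n - r. q ^ (s i * N i)) *
    ldet n (\<lambda>l i. if l \<le> r then q powi (int (\<alpha> l) - int (N i)) * h (int (\<alpha> l) - int (N i))
      else q powi (- (int (s (l - r)) * int (N i))) * c)"
proof -
  define u where "u l = (if l \<le> r then q ^ \<alpha> l else 1)" for l
  define v where "v i = q powi (- int (N i))" for i
  define e where "e l i = (if l \<le> r then h (int (\<alpha> l) - int (N i))
    else q powi (- ((int (s (l - r)) - 1) * int (N i))) * c)" for l i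
  have "ldet n (\<lambda>l i. if l \<le> r then q powi (int (\<alpha> l) - int (N i)) * h (int (\<alpha> l) - int (N i))
      else q powi (- (int (s (l - r)) * int (N i))) * c) = ldet n (\<lambda>l i. u l * v i * e l i)"
  proof (rule ldet_cong)
    fix l i
    have "- (int (s (l - r)) * int (N i)) = - int (N i) + - ((int (s (l - r)) - 1) * int (N i))"
      by (simp add: algebra_simps)
    then have "q powi (- (int (s (l - r)) * int (N i))) = v i * q powi (- ((int (s (l - r)) - 1) * int (N i)))"
      unfolding v_def by (simp only: q_powi_add)
    then show "(if l \<le> r then q powi (int (\<alpha> l) - int (N i)) * h (int (\<alpha> l) - int (N i))
        else q powi (- (int (s (l - r)) * int (N i))) * c) = u l * v i * e l i"
      by (simp add: u_def e_def v_def q_powi_diff)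
  qed
  then have ldet: "ldet n (\<lambda>l i. if l \<le> r then q powi (int (\<alpha> l) - int (N i)) * h (int (\<alpha> l) - int (N i))
      else q powi (- (int (s (l - r)) * int (N i))) * c) = (\<Prod>l = 1..n. u l) * (\<Prod>i = 1..n. v i) * ldet n e"
    by (simp add: ldet_scale)
  have u: "(\<Prod>l = 1..n. u l) = (\<Prod>l = 1..r. q ^ \<alpha> l)"
    unfolding u_def using prod_split_at[OF r, of "\<lambda>l. q ^ \<alpha> l" "\<lambda>_. 1"] by simp
  have v: "(\<Prod>i = 1..n. v i) = (\<Prod>i = 1..n - r. v i) * (\<Prod>k = 1..r. v (n - r + k))"
    by (rule prod_rotate_split[OF r])
  have w: "q powi (\<Sum>k = 1..r. int (\<alpha> k) - int (N (n - r + k))) = (\<Prod>l = 1..r. q ^ \<alpha> l) * (\<Prod>k = 1..r. v (n - r + k))"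
    unfolding q_powi_sum q_powi_diff v_def prod.distrib ..
  have "(\<Prod>i = 1..n - r. q ^ ((s i - 1) * N i)) = (\<Prod>i = 1..n - r. q ^ (s i * N i)) * (\<Prod>i = 1..n - r. v i)"
    unfolding prod.distrib[symmetric]
  proof (rule prod.cong[OF refl])
    fix i assume "i \<in> {1..n - r}"
    then obtain t where t: "s i = Suc t"
      using s gr0_conv_Suc by blast
    have "q ^ N i * v i = 1"
      using q_pos unfolding v_def by (simp add: power_int_minus)
    then show "q ^ ((s i - 1) * N i) = q ^ (s i * N i) * v i"
      by (simp add: t power_add mult_ac)
  qed
  then show ?thesis
    unfolding ldet u v w e_def by (simp only: mult_ac)
qed

text \<open>A partial theta function: the summation runs over the naturals only.\<close>

definition theta :: "int \<Rightarrow> real" where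
  "theta c = (\<Sum>\<^sub>\<infinity>A. theta_coeff A * q powi (int A * c))"

lemma theta_has_sum: "((\<lambda>A. theta_coeff A * q powi (int A * c)) has_sum theta c) UNIV"
proof -
  have "(\<lambda>A. theta_coeff A * q powi (int A * c)) summable_on UNIV"
    using theta_summable_on[of c] by (metis summable_on_iff_abs_summable_on_real)
  then show ?thesis
    unfolding theta_def by (rule has_sum_infsum)
qed

lemma array_weight_has_sum:
  fixes \<nu> \<mu> :: "nat \<Rightarrow> nat"
  assumes shape: "pit_shape n m r lam lam'"
    and \<nu>: "\<And>i. 1 \<le> i \<Longrightarrow> \<nu> (Suc i) \<le> \<nu> i" "\<And>i. n < i \<Longrightarrow> \<nu> i = 0"
    and \<mu>: "\<And>j. 1 \<le> j \<Longrightarrow> \<mu> (Suc j) \<le> \<mu> j" "\<And>j. m < j \<Longrightarrow> \<mu> j = 0"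
  defines "N \<equiv> strict_part n \<nu>" and "M \<equiv> strict_part m \<mu>"
    and "s \<equiv> start n m lam" and "s' \<equiv> start m n lam'"
  shows "((\<lambda>a. q powi array_weight n m \<mu> \<nu> lam a) has_sum
    ((-1) ^ (r * (n - r)) * (-1) ^ (r * (m - r)) *
     (\<Prod>i = 1..n - r. q ^ (s i * N i)) * (\<Prod>i = 1..m - r. q ^ ((s' i - 1) * M i)) *
     (leibniz2 n m r (\<lambda>l i. q powi (- (int (s (l - r)) * int (N i))))
        (\<lambda>l i. q powi (- ((int (s' (l - r)) - 1) * int (M i)))) (\<lambda>i j. theta (int (N i) - int (M j))) /
      qpoch_inf ^ (n + m) / fact r))) (pit_arrays n m \<mu> \<nu> lam)"
proof -
  interpret S: pit_shape n m r lam lam'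
    by (rule shape)
  interpret S': pit_shape m n r lam' lam
    by (rule S.pit_shape_swap)
  note r = S.r_le
  define c where "c = 1 / qpoch_inf"
  define g where "g \<alpha> = q powi (\<Sum>k = 1..r. int (\<alpha> k) - int (N (n - r + k)))" for \<alpha> :: "nat \<Rightarrow> nat"
  define C where "C = (-1) ^ (r * (n - r)) * (-1) ^ (r * (m - r)) *
     (\<Prod>i = 1..n - r. q ^ (s i * N i)) * (\<Prod>i = 1..m - r. q ^ ((s' i - 1) * M i))"
  define x where "x l i = q powi (- (int (s (l - r)) * int (N i)))" for l i
  define y where "y l i = q powi (- ((int (s' (l - r)) - 1) * int (M i)))" for l i
  define H where "H \<alpha> = ldet n (\<lambda>l i. if l \<le> r then q powi (int (\<alpha> l) - int (N i)) * hq (int (\<alpha> l) - int (N i)) else x l i * c) *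
    ldet m (\<lambda>l i. if l \<le> r then hq (int (\<alpha> l) - int (M i)) else y l i * c)" for \<alpha>
  have N: "N (Suc i) < N i" if "i \<in> {1..<n}" for i
    using \<nu>(1)[of i] that unfolding N_def strict_part_def by (auto intro: add_le_less_mono)
  have M: "M (Suc i) < M i" if "i \<in> {1..<m}" for i
    using \<mu>(1)[of i] that unfolding M_def strict_part_def by (auto intro: add_le_less_mono)
  define W where "W = (\<lambda>(\<alpha>, b, b'). g \<alpha> * (q powi half_weight n s N b * q powi half_weight m s' M b'))"
  define X where "X \<alpha> = half_arrays n s N (place_diagonal n r \<alpha>) \<times> half_arrays m s' M (place_diagonal m r \<alpha>)" for \<alpha>
  have inner: "((\<lambda>p. W (\<alpha>, p)) has_sum C * H \<alpha>) (X \<alpha>)" if \<alpha>: "\<alpha> \<in> decreasing_tuples r" for \<alpha>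
  proof -
    have "((\<lambda>(b, b'). q powi half_weight n s N b * q powi half_weight m s' M b') has_sum
        halfdet n s N c hq (place_diagonal n r \<alpha>) * halfdet m s' M c hq (place_diagonal m r \<alpha>)) (X \<alpha>)"
      unfolding X_def c_def s_def s'_def
      by (intro has_sum_times_real half_has_sum N M S.staircase_start S'.staircase_start
            S.admissible_place_diagonal S'.admissible_place_diagonal \<alpha>)
    then have "((\<lambda>p. g \<alpha> * (case p of (b, b') \<Rightarrow> q powi half_weight n s N b * q powi half_weight m s' M b')) has_sum
        g \<alpha> * (halfdet n s N c hq (place_diagonal n r \<alpha>) * halfdet m s' M c hq (place_diagonal m r \<alpha>))) (X \<alpha>)"
      by (rule has_sum_cmult_right)
    moreover have "(\<lambda>p. W (\<alpha>, p)) = (\<lambda>p. g \<alpha> * (case p of (b, b') \<Rightarrow> q powi half_weight n s N b * q powi half_weight m s' M b'))"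
      by (auto simp: W_def)
    moreover have "g \<alpha> * (halfdet n s N c hq (place_diagonal n r \<alpha>) * halfdet m s' M c hq (place_diagonal m r \<alpha>)) = C * H \<alpha>"
    proof -
      have n: "halfdet n s N c hq (place_diagonal n r \<alpha>) =
          (-1) ^ (r * (n - r)) * ((\<Prod>i = 1..n - r. q ^ ((s i - 1) * N i)) *
          ldet n (\<lambda>l i. if l \<le> r then hq (int (\<alpha> l) - int (N i)) else q powi (- ((int (s (l - r)) - 1) * int (N i))) * c))"
        using halfdet_rotate[OF r(1), of s N c hq \<alpha>] S.start_eq_0_iff unfolding s_def by (simp only: mult.assoc)
      have m: "halfdet m s' M c hq (place_diagonal m r \<alpha>) =
          (-1) ^ (r * (m - r)) * ((\<Prod>i = 1..m - r. q ^ ((s' i - 1) * M i)) *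
          ldet m (\<lambda>l i. if l \<le> r then hq (int (\<alpha> l) - int (M i)) else y l i * c))"
        using halfdet_rotate[OF r(2), of s' M c hq \<alpha>] S'.start_eq_0_iff unfolding s'_def y_def by (simp only: mult.assoc)
      have pos: "0 < s i" if "i \<in> {1..n - r}" for i
      proof -
        have "i \<in> {1..n}" "\<not> n - r < i"
          using that by auto
        then show ?thesis
          using S.start_eq_0_iff[of i] unfolding s_def by blast
      qed
      have gn: "g \<alpha> * ((\<Prod>i = 1..n - r. q ^ ((s i - 1) * N i)) *
          ldet n (\<lambda>l i. if l \<le> r then hq (int (\<alpha> l) - int (N i)) else q powi (- ((int (s (l - r)) - 1) * int (N i))) * c)) =
        (\<Prod>i = 1..n - r. q ^ (s i * N i)) *
          ldet n (\<lambda>l i. if l \<le> r then q powi (int (\<alpha> l) - int (N i)) * hq (int (\<alpha> l) - int (N i)) else x l i * c)"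
        unfolding g_def x_def by (rule ldet_diagonal_weight[OF r(1) pos])
      define D where "D = (\<Prod>i = 1..n - r. q ^ ((s i - 1) * N i)) *
          ldet n (\<lambda>l i. if l \<le> r then hq (int (\<alpha> l) - int (N i)) else q powi (- ((int (s (l - r)) - 1) * int (N i))) * c)"
      define E where "E = (\<Prod>i = 1..m - r. q ^ ((s' i - 1) * M i)) *
          ldet m (\<lambda>l i. if l \<le> r then hq (int (\<alpha> l) - int (M i)) else y l i * c)"
      have "g \<alpha> * (halfdet n s N c hq (place_diagonal n r \<alpha>) * halfdet m s' M c hq (place_diagonal m r \<alpha>)) =
          (-1) ^ (r * (n - r)) * (-1) ^ (r * (m - r)) * (g \<alpha> * D) * E"
        unfolding n m D_def[symmetric] E_def[symmetric] by (simp only: mult_ac)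
      then show ?thesis
        unfolding D_def gn E_def C_def H_def by (simp only: mult_ac)
    qed
    ultimately show ?thesis
      by simp
  qed
  have "(H has_sum (leibniz2 n m r x y (\<lambda>i j. theta (int (N i) - int (M j))) / qpoch_inf ^ (n + m) / fact r)) (decreasing_tuples r)"
  proof -
    \<comment> \<open>The weight per entry is 1, since q^(\<alpha> - N) already stands in the first
      determinant.\<close>
    have "((\<lambda>z. 1 * (q powi (int z - int (N i)) * hq (int z - int (N i))) * hq (int z - int (M j))) has_sum
        theta (int (N i) - int (M j)) / qpoch_inf ^ 2) UNIV" for i j
      using has_sum_hq_hq[of "N i" "M j"] by (simp add: theta_def)
    from has_sum_ldet_mult_ldet[OF r this, where x = "\<lambda>l i. x l i * c" and y = "\<lambda>l i. y l i * c"]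
    show ?thesis
      unfolding H_def c_def leibniz2_scale[OF r qpoch_inf_nonzero] by simp
  qed
  then have outer: "((\<lambda>\<alpha>. C * H \<alpha>) has_sum
      C * (leibniz2 n m r x y (\<lambda>i j. theta (int (N i) - int (M j))) / qpoch_inf ^ (n + m) / fact r)) (decreasing_tuples r)"
    by (rule has_sum_cmult_right)
  have "(W has_sum C * (leibniz2 n m r x y (\<lambda>i j. theta (int (N i) - int (M j))) / qpoch_inf ^ (n + m) / fact r))
      (Sigma (decreasing_tuples r) X)"
  proof (rule has_sum_SigmaI[OF inner outer])
    show "W summable_on Sigma (decreasing_tuples r) X"
    proof (rule summable_on_SigmaI[OF inner has_sum_imp_summable[OF outer]])
      show "0 \<le> W (\<alpha>, p)" for \<alpha> p
        using q_pos by (cases p) (simp add: W_def g_def)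
    qed
  qed
  also have "?this \<longleftrightarrow> ((\<lambda>a. W (diagonal_of n m r a, half_of n m lam a, half_of m n lam' (a \<circ> prod.swap))) has_sum
      C * (leibniz2 n m r x y (\<lambda>i j. theta (int (N i) - int (M j))) / qpoch_inf ^ (n + m) / fact r)) (pit_arrays n m \<mu> \<nu> lam)"
    using has_sum_reindex_bij_betw[OF S.bij_betw_pit_arrays[OF \<nu>(2) \<mu>(2)], where f = W]
    unfolding X_def N_def M_def s_def s'_def by simp
  also have "\<dots> \<longleftrightarrow> ((\<lambda>a. q powi array_weight n m \<mu> \<nu> lam a) has_sum
      C * (leibniz2 n m r x y (\<lambda>i j. theta (int (N i) - int (M j))) / qpoch_inf ^ (n + m) / fact r)) (pit_arrays n m \<mu> \<nu> lam)"
  proof (rule has_sum_cong)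
    fix a assume a: "a \<in> pit_arrays n m \<mu> \<nu> lam"
    show "W (diagonal_of n m r a, half_of n m lam a, half_of m n lam' (a \<circ> prod.swap)) = q powi array_weight n m \<mu> \<nu> lam a"
    proof -
      have "array_weight n m \<mu> \<nu> lam a =
          (\<Sum>k = 1..r. int (diagonal_of n m r a k) - int (N (n - r + k))) +
          half_weight n s N (half_of n m lam a) + half_weight m s' M (half_of m n lam' (a \<circ> prod.swap))"
        unfolding N_def M_def s_def s'_def by (rule S.array_weight_eq[OF a]) (use \<nu>(2) \<mu>(2) in auto)
      then show ?thesis
        by (simp only: q_powi_add W_def g_def prod.case mult.assoc)
    qed
  qed
  finally show ?thesis
    unfolding C_def x_def y_def .
qed

end

section \<open>The Maya diagram and the index set\<close>

lemma partition_antimono: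
  assumes "is_partition p" "1 \<le> k" "k \<le> l"
  shows "p l \<le> p k"
  using assms(3)
proof (induction l rule: dec_induct)
  case (step l)
  have "p (Suc l) \<le> p l"
    using assms(1,2) step.hyps by (simp add: is_partition_def)
  then show ?case
    using step.IH by simp
qed simp

lemma transposed_iff:
  assumes lam: "is_partition lam" and "1 \<le> i" "1 \<le> j"
  shows "j \<le> lam i \<longleftrightarrow> i \<le> transposed lam j"
proof -
  define S where "S = {i. 1 \<le> i \<and> j \<le> lam i}"
  have fin: "finite S"
    by (rule finite_subset[of _ "{i. 1 \<le> i \<and> lam i \<noteq> 0}"]) (use lam assms(3) in \<open>auto simp: S_def is_partition_def\<close>)
  note anti = partition_antimono[OF lam]
  have card: "transposed lam j = card S"
    by (simp add: transposed_def S_def)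
  show ?thesis
  proof
    assume "j \<le> lam i"
    then have "{1..i} \<subseteq> S"
      using anti[of _ i] by (force simp: S_def)
    then have "card {1..i} \<le> card S"
      by (rule card_mono[OF fin])
    then show "i \<le> transposed lam j"
      by (simp add: card)
  next
    assume i: "i \<le> transposed lam j"
    show "j \<le> lam i"
    proof (rule ccontr)
      assume "\<not> j \<le> lam i"
      have "S \<subseteq> {1..<i}"
      proof
        fix k assume k: "k \<in> S"
        have "k < i"
        proof (rule ccontr)
          assume "\<not> k < i"
          then have "lam k \<le> lam i"
            using assms(2) by (intro anti) auto
          then show False
            using k \<open>\<not> j \<le> lam i\<close> by (simp add: S_def)
        qed
        then show "k \<in> {1..<i}"
          using k by (simp add: S_def)
      qed
      then have "card S \<le> card {1..<i}"
        by (intro card_mono) auto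
      then show False
        using i assms(2) by (simp add: card)
    qed
  qed
qed

text \<open>That r satisfies its defining inequality gives the rectangle; that r - 1 violates it
  keeps out the cell beyond the corner. For r = 0 the hypothesis on \<open>lam (n + 1)\<close> does
  the latter.\<close>

lemma pit_shape_pit_rank:
  assumes lam: "is_partition lam" and pit: "lam (n + 1) < m + 1"
  shows "pit_shape n m (pit_rank n m lam) lam (transposed lam)"
proof -
  define P where "P t \<longleftrightarrow> enat (m - t) \<le> (if n - t = 0 then \<infinity> else enat (lam (n - t)))" for t
  define r where "r = pit_rank n m lam"
  have r: "r = (LEAST t. P t)"
    by (simp add: r_def pit_rank_def P_def)
  have Pn: "P n" and Pm: "P m"
    by (simp_all add: P_def zero_enat_def[symmetric])
  have rn: "r \<le> n" and rm: "r \<le> m"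
    unfolding r using Pn Pm by (auto intro: Least_le)
  have Pr: "P r"
    unfolding r using Pn by (rule LeastI)
  have step: "lam (Suc i) \<le> lam i" if "1 \<le> i" for i
    using lam that by (simp add: is_partition_def)
  note anti = partition_antimono[OF lam]
  show ?thesis
    unfolding r_def[symmetric]
  proof
    show "j \<le> lam i \<longleftrightarrow> i \<le> transposed lam j" if "1 \<le> i" "1 \<le> j" for i j
      by (rule transposed_iff[OF lam that])
    show "m - r \<le> lam i" if i: "1 \<le> i" "i \<le> n - r" for i
    proof -
      have "m - r \<le> lam (n - r)"
        using Pr i by (auto simp: P_def split: if_splits)
      then show ?thesis
        using anti[OF i] by simp
    qed
    show "lam (n - r + 1) \<le> m - r"
    proof (cases r)
      case 0
      then show ?thesis
        using pit by simp
    next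
      case (Suc t)
      then have "\<not> P t"
        using not_less_Least[of t P] unfolding r[symmetric] by simp
      moreover have "n - t = n - r + 1" "m - t = m - r + 1"
        using Suc rn rm by auto
      ultimately show ?thesis
        by (simp add: P_def)
    qed
  qed (fact step rn rm)+
qed

context pit_shape
begin

section \<open>The numbers -L_k and the tuples A\<close>

lemma neg_pit_L_strict_mono:
  assumes "1 \<le> k" "k < l"
  shows "- pit_L n m lam k < - pit_L n m lam l"
  using lam_antimono[of k l] assms by (simp add: pit_L_def)

text \<open>At the corner \<lambda>_t changes from at least to at most m - r. So the condition that
  all s_i exceed n - r says precisely that the entries of \<open>A\<close> are natural
  numbers.\<close>

lemma neg_pit_L_nonneg_iff:
  assumes "1 \<le> t"
  shows "0 \<le> - pit_L n m lam t \<longleftrightarrow> n - r < t"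
proof (cases "n - r < t")
  case True
  then show ?thesis
    using lam_antimono[of "n - r + 1" t] outer_corner r_le by (simp add: pit_L_def)
next
  case False
  then have "m - r \<le> lam t"
    using inner_corner[of t] assms by simp
  then show ?thesis
    using False r_le by (simp add: pit_L_def)
qed

text \<open>In these rows the subtraction in \<open>start\<close> is not truncated, which identifies
  it with P_i + 1 and, after transposition, with Q_j + 1.\<close>

lemma start_eq:
  assumes "i \<in> {1..n - r}"
  shows "int (start n m lam i) = int (lam i) + int n + 1 - (int m + int i)"
proof -
  have "start n m lam i \<noteq> 0"
    using start_eq_0_iff[of i] assms by auto
  then show ?thesis
    by (simp add: start_def of_nat_diff)
qed

text \<open>
  The numbers \<open>t - \<lambda>\<^sub>t\<close> and \<open>\<lambda>'\<^sub>j - j + 1\<close> partition the integers (the Maya diagram of \<open>\<lambda>\<close>). Since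
  \<open>start m n lam' j = Q\<^sub>j + 1\<close> for \<open>j \<le> m - r\<close>, the admissible entries of \<open>A\<close> are the naturals other than the \<open>Q\<^sub>j\<close>.
\<close>

lemma maya_complement:
  "(\<exists>t>n - r. int z = - pit_L n m lam t) \<longleftrightarrow> (\<forall>j\<in>{1..m - r}. int z \<noteq> int (start m n lam' j) - 1)"
proof
  assume "\<exists>t>n - r. int z = - pit_L n m lam t"
  then obtain t where t: "n - r < t" "int z = - pit_L n m lam t"
    by blast
  show "\<forall>j\<in>{1..m - r}. int z \<noteq> int (start m n lam' j) - 1"
  proof
    fix j assume j: "j \<in> {1..m - r}"
    have "int t - int (lam t) - 1 \<noteq> int (lam' j) - int j"
      using transpose_iff[of t j] t j by (cases "j \<le> lam t") auto
    then show "int z \<noteq> int (start m n lam' j) - 1"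
      unfolding t(2) pit_shape.start_eq[OF pit_shape_swap j] by (simp add: pit_L_def)
  qed
next
  assume Q: "\<forall>j\<in>{1..m - r}. int z \<noteq> int (start m n lam' j) - 1"
  \<comment> \<open>Chosen so that z = -L_t means t - \<lambda>_t = v.\<close>
  define v where "v = int z + int n - int m + 1"
  define R where "R t \<longleftrightarrow> 1 \<le> t \<and> v \<le> int t - int (lam t)" for t
  define T where "T = nat v + lam 1 + 1"
  have "lam T \<le> lam 1" "v \<le> int (nat v)" "int T = int (nat v) + int (lam 1) + 1"
    using lam_antimono[of 1 T] by (auto simp: T_def)
  moreover have "1 \<le> T"
    by (simp add: T_def)
  ultimately have "R T"
    by (simp add: R_def)
  then obtain t where t: "R t" and least: "\<And>k. k < t \<Longrightarrow> \<not> R k"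
    using exists_least_iff[of R] by blast
  have "v = int t - int (lam t)"
  proof (rule ccontr)
    assume "v \<noteq> int t - int (lam t)"
    then have less: "v < int t - int (lam t)"
      using t by (simp add: R_def)
    \<comment> \<open>Here t - \<lambda>_t jumps over v: it exceeds v at t and, if t > 1, is below v
      at t - 1. Then j = t - v satisfies \<lambda>_t < j \<le> \<lambda>_(t-1), so column j has
      height t - 1, and v = \<lambda>'_j - j + 1.\<close>
    define j where "j = nat (int t - v)"
    have j: "int j = int t - v" "1 \<le> j" "lam t < j"
      using less by (auto simp: j_def)
    have "lam' j = t - 1"
    proof (rule antisym)
      have "\<not> t \<le> lam' j"
        using transpose_iff[of t j] t j by (simp add: R_def)
      then show "lam' j \<le> t - 1"
        by simp
      show "t - 1 \<le> lam' j"
      proof (cases "t = 1")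
        case False
        then have "\<not> R (t - 1)"
          using t by (intro least) (simp add: R_def)
        moreover have "1 \<le> t - 1" "int (t - 1) = int t - 1"
          using False t by (auto simp: R_def)
        ultimately have "\<not> v \<le> int t - 1 - int (lam (t - 1))"
          unfolding R_def by metis
        then have "j \<le> lam (t - 1)"
          using j by linarith
        then show ?thesis
          using transpose_iff[of "t - 1" j] False t j by (simp add: R_def)
      qed simp
    qed
    then have z: "int z = int (lam' j) + int m - int n - int j"
      using t j by (simp add: v_def R_def of_nat_diff)
    \<comment> \<open>A column beyond m - r has height at most n - r and would make z
      negative.\<close>
    have "j \<in> {1..m - r}"
    proof (rule ccontr)
      assume "j \<notin> {1..m - r}"
      then have "m - r + 1 \<le> j"
        using j by auto
      then have "lam' j \<le> n - r"
        using pit_shape.lam_antimono[OF pit_shape_swap, of "m - r + 1" j]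
          pit_shape.outer_corner[OF pit_shape_swap] by simp
      then show False
        using z \<open>m - r + 1 \<le> j\<close> r_le by linarith
    qed
    then show False
      using Q z pit_shape.start_eq[OF pit_shape_swap, of j] by force
  qed
  then have "int z = - pit_L n m lam t"
    by (simp add: v_def pit_L_def)
  moreover have "1 \<le> t"
    using t by (simp add: R_def)
  ultimately show "\<exists>t>n - r. int z = - pit_L n m lam t"
    using neg_pit_L_nonneg_iff[of t] by (metis of_nat_0_le_iff)
qed

definition surviving_tuples :: "(nat \<Rightarrow> nat) set" where
  "surviving_tuples = {A \<in> decreasing_tuples r.
     \<forall>l\<in>{1..r}. \<forall>j\<in>{1..m - r}. int (A l) \<noteq> int (start m n lam' j) - 1}"

text \<open>The reversed index r - i + 1 turns an increasing s into a decreasing \<open>A\<close>,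
  because -L_k increases strictly; for the same reason s can be recovered from \<open>A\<close>.
  Integer and natural entries correspond since those of \<open>A\<close> are nonnegative.\<close>

lemma bij_betw_pit_Theta:
  assumes r: "r = pit_rank n m lam"
  shows "bij_betw (\<lambda>(\<sigma>, \<tau>, A). (\<sigma>, \<tau>, \<lambda>i\<in>{1..r}. int (A i)))
    ({\<sigma>. \<sigma> permutes {1..n}} \<times> {\<tau>. \<tau> permutes {1..m}} \<times> surviving_tuples) (pit_Theta n m lam)"
    (is "bij_betw ?f ?S ?T")
proof (rule bij_betw_byWitness[where f' = "\<lambda>(\<sigma>, \<tau>, A). (\<sigma>, \<tau>, \<lambda>i\<in>{1..r}. nat (A i))"])
  have T: "(\<sigma>, \<tau>, A) \<in> ?T \<longleftrightarrow> \<sigma> permutes {1..n} \<and> \<tau> permutes {1..m} \<and> A \<in> extensional {1..r} \<and>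
      (\<exists>s. strict_mono_on {1..r} s \<and> (\<forall>i\<in>{1..r}. n - r < s i \<and> A (r - i + 1) = - pit_L n m lam (s i)))" for \<sigma> \<tau> A
    by (simp add: pit_Theta_def r[symmetric] Let_def)
  have nonneg: "0 \<le> A i" if T': "(\<sigma>, \<tau>, A) \<in> ?T" and i: "i \<in> {1..r}" for \<sigma> \<tau> A i
  proof -
    obtain s where s: "\<forall>i\<in>{1..r}. n - r < s i \<and> A (r - i + 1) = - pit_L n m lam (s i)"
      using T' unfolding T by blast
    have "r - i + 1 \<in> {1..r}" "r - (r - i + 1) + 1 = i"
      using i by auto
    then have "n - r < s (r - i + 1)" "A i = - pit_L n m lam (s (r - i + 1))"
      using s by metis+
    then show ?thesis
      using neg_pit_L_nonneg_iff[of "s (r - i + 1)"] by simp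
  qed
  show "\<forall>x\<in>?S. (case ?f x of (\<sigma>, \<tau>, A) \<Rightarrow> (\<sigma>, \<tau>, \<lambda>i\<in>{1..r}. nat (A i))) = x"
  proof
    fix x assume "x \<in> ?S"
    then obtain \<sigma> \<tau> A where x: "x = (\<sigma>, \<tau>, A)" and "A \<in> surviving_tuples"
      by auto
    then have "A \<in> extensional {1..r}"
      by (simp add: surviving_tuples_def decreasing_tuples_def PiE_def)
    then have "(\<lambda>i\<in>{1..r}. nat ((\<lambda>i\<in>{1..r}. int (A i)) i)) = A"
      by (auto simp: fun_eq_iff extensional_def)
    then show "(case ?f x of (\<sigma>, \<tau>, A) \<Rightarrow> (\<sigma>, \<tau>, \<lambda>i\<in>{1..r}. nat (A i))) = x"
      by (simp add: x)
  qed
  show "\<forall>x\<in>?T. ?f (case x of (\<sigma>, \<tau>, A) \<Rightarrow> (\<sigma>, \<tau>, \<lambda>i\<in>{1..r}. nat (A i))) = x"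
  proof
    fix x assume "x \<in> ?T"
    then obtain \<sigma> \<tau> A where x': "x = (\<sigma>, \<tau>, A)" and x: "(\<sigma>, \<tau>, A) \<in> ?T"
      by (cases x) auto
    have "(\<lambda>i\<in>{1..r}. int ((\<lambda>i\<in>{1..r}. nat (A i)) i)) = A"
      using nonneg[OF x] x unfolding T by (auto simp: fun_eq_iff extensional_def)
    then show "?f (case x of (\<sigma>, \<tau>, A) \<Rightarrow> (\<sigma>, \<tau>, \<lambda>i\<in>{1..r}. nat (A i))) = x"
      by (simp add: x')
  qed
  show "?f ` ?S \<subseteq> ?T"
  proof (intro image_subsetI)
    fix x assume "x \<in> ?S"
    then obtain \<sigma> \<tau> A where x: "x = (\<sigma>, \<tau>, A)" "\<sigma> permutes {1..n}" "\<tau> permutes {1..m}" and A: "A \<in> surviving_tuples"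
      by auto
    have dec: "A \<in> decreasing_tuples r"
      using A by (simp add: surviving_tuples_def)
    have "\<forall>i\<in>{1..r}. \<exists>t>n - r. int (A (r - i + 1)) = - pit_L n m lam t"
    proof
      fix i assume "i \<in> {1..r}"
      then have "r - i + 1 \<in> {1..r}"
        by auto
      then show "\<exists>t>n - r. int (A (r - i + 1)) = - pit_L n m lam t"
        using A unfolding maya_complement surviving_tuples_def by blast
    qed
    then obtain s where s: "\<And>i. i \<in> {1..r} \<Longrightarrow> n - r < s i \<and> int (A (r - i + 1)) = - pit_L n m lam (s i)"
      by metis
    have "strict_mono_on {1..r} s"
    proof (rule strict_mono_onI)
      fix i j assume ij: "i \<in> {1..r}" "j \<in> {1..r}" "i < j"
      then have "A (r - i + 1) < A (r - j + 1)"
        by (intro decreasing_tuplesD[OF dec]) auto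
      then have less: "- pit_L n m lam (s i) < - pit_L n m lam (s j)"
        using s[of i] s[of j] ij by simp
      show "s i < s j"
      proof (rule ccontr)
        assume "\<not> s i < s j"
        then show False
          using neg_pit_L_strict_mono[of "s j" "s i"] s[of j] ij less by (cases "s i = s j") auto
      qed
    qed
    moreover have "\<forall>i\<in>{1..r}. n - r < s i \<and> (\<lambda>i\<in>{1..r}. int (A i)) (r - i + 1) = - pit_L n m lam (s i)"
      using s by auto
    ultimately have "\<exists>s. strict_mono_on {1..r} s \<and>
        (\<forall>i\<in>{1..r}. n - r < s i \<and> (\<lambda>i\<in>{1..r}. int (A i)) (r - i + 1) = - pit_L n m lam (s i))"
      by blast
    then show "?f x \<in> ?T"
      unfolding x(1) prod.case T using x by simp
  qed
  show "(\<lambda>(\<sigma>, \<tau>, A). (\<sigma>, \<tau>, \<lambda>i\<in>{1..r}. nat (A i))) ` ?T \<subseteq> ?S"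
  proof (intro image_subsetI)
    fix x assume x: "x \<in> ?T"
    then obtain \<sigma> \<tau> A where x': "x = (\<sigma>, \<tau>, A)"
      by (cases x)
    note xT = x[unfolded x']
    obtain s where perm: "\<sigma> permutes {1..n}" "\<tau> permutes {1..m}" and mono: "strict_mono_on {1..r} s"
      and s: "\<And>i. i \<in> {1..r} \<Longrightarrow> n - r < s i \<and> A (r - i + 1) = - pit_L n m lam (s i)"
      using xT unfolding T by blast
    have A: "n - r < s (r - i + 1) \<and> A i = - pit_L n m lam (s (r - i + 1))" if "i \<in> {1..r}" for i
    proof -
      have "r - i + 1 \<in> {1..r}" "r - (r - i + 1) + 1 = i"
        using that by auto
      then show ?thesis
        using s[of "r - i + 1"] by simp
    qed
    define B where "B = (\<lambda>i\<in>{1..r}. nat (A i))"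
    have B: "int (B i) = A i" if "i \<in> {1..r}" for i
      using nonneg[OF xT that] that by (simp add: B_def)
    have "B \<in> decreasing_tuples r"
      unfolding decreasing_tuples_def
    proof (intro CollectI conjI ballI)
      show "B \<in> {1..r} \<rightarrow>\<^sub>E UNIV"
        by (simp add: B_def)
      fix i assume i: "i \<in> {1..<r}"
      have "s (r - Suc i + 1) < s (r - i + 1)"
        using mono i by (intro strict_mono_onD[OF mono]) auto
      then have "A (Suc i) < A i"
        using A[of i] A[of "Suc i"] i neg_pit_L_strict_mono[of "s (r - Suc i + 1)" "s (r - i + 1)"] by auto
      then show "B (Suc i) < B i"
        using B[of i] B[of "Suc i"] i by simp
    qed
    moreover have "\<forall>j\<in>{1..m - r}. int (B l) \<noteq> int (start m n lam' j) - 1" if "l \<in> {1..r}" for l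
    proof -
      have "\<exists>t>n - r. int (B l) = - pit_L n m lam t"
        using A[OF that] B[OF that] by metis
      then show ?thesis
        by (simp only: maya_complement)
    qed
    ultimately have "B \<in> surviving_tuples"
      by (simp add: surviving_tuples_def)
    then show "(case x of (\<sigma>, \<tau>, A) \<Rightarrow> (\<sigma>, \<tau>, \<lambda>i\<in>{1..r}. nat (A i))) \<in> ?S"
      using perm by (simp add: x' B_def)
  qed
qed

end

section \<open>Evaluation of the character at real q\<close>

lemma has_sum_finite_times:
  fixes f :: "'a \<Rightarrow> 'b \<Rightarrow> real"
  assumes "finite F" "\<And>x. x \<in> F \<Longrightarrow> (f x has_sum g x) B"
  shows "((\<lambda>(x, y). f x y) has_sum (\<Sum>x\<in>F. g x)) (F \<times> B)"
  using assms
proof (induction F rule: finite_induct)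
  case (insert x F)
  have "((\<lambda>(x, y). f x y) has_sum g x) (Pair x ` B)"
    by (subst has_sum_reindex) (use insert.prems in \<open>auto simp: inj_on_def o_def\<close>)
  moreover have "((\<lambda>(x, y). f x y) has_sum (\<Sum>x\<in>F. g x)) (F \<times> B)"
    using insert by auto
  ultimately have "((\<lambda>(x, y). f x y) has_sum (g x + (\<Sum>x\<in>F. g x))) (Pair x ` B \<union> F \<times> B)"
    using insert.hyps by (intro has_sum_Un_disjoint) auto
  moreover have "Pair x ` B \<union> F \<times> B = insert x F \<times> B"
    by auto
  ultimately show ?case
    unfolding sum.insert[OF insert.hyps] by simp
qed (simp add: has_sum_0)

lemma prod_shift_index:
  fixes f :: "nat \<Rightarrow> real"
  assumes "r \<le> n"
  shows "(\<Prod>i = r+1..n. f (i - r)) = (\<Prod>i = 1..n - r. f i)"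
  by (rule prod.reindex_bij_witness[of _ "\<lambda>i. i + r" "\<lambda>i. i - r"]) (use assms in auto)

lemma strict_part_shifted_part: "i \<le> n \<Longrightarrow> shifted_part n \<nu> i = int (strict_part n \<nu> i)"
  by (simp add: shifted_part_def strict_part_def of_nat_diff)

context pit_shape
begin

lemma pit_P_eq:
  assumes "r = pit_rank n m lam" "i \<in> {1..n - r}"
  shows "pit_P n m lam i + 1 = int (start n m lam i)"
  using start_eq[OF assms(2)] by (simp add: pit_P_def assms(1)[symmetric] Let_def)

lemma pit_Q_eq:
  assumes "r = pit_rank n m lam" "lam' = transposed lam" "j \<in> {1..m - r}"
  shows "pit_Q n m lam j = int (start m n lam' j) - 1"
  using pit_shape.start_eq[OF pit_shape_swap assms(3)]
  by (simp add: pit_Q_def assms(1)[symmetric] assms(2)[symmetric] Let_def)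

end

context q_parameter
begin

lemma theta_coeff_powers:
  "theta_coeff z * q ^ (z * a) * q powi (- (int z * int b)) = theta_coeff z * q powi (int z * (int a - int b))"
  by (simp add: q_powi_mult_diff)

text \<open>The corrections N_(i-r) and M_(i-r) in the exponent are the powers in front of the two
  determinants; everything else is one pair of Leibniz terms.\<close>

lemma q_powi_pit_Delta:
  fixes \<nu> \<mu> :: "nat \<Rightarrow> nat"
  assumes shape: "pit_shape n m r lam lam'" and r: "r = pit_rank n m lam" and lam': "lam' = transposed lam"
    and \<sigma>: "\<sigma> permutes {1..n}" and \<tau>: "\<tau> permutes {1..m}"
  defines "N \<equiv> strict_part n \<nu>" and "M \<equiv> strict_part m \<mu>"
    and "s \<equiv> start n m lam" and "s' \<equiv> start m n lam'"
  shows "q powi pit_Delta n m \<mu> \<nu> lam \<sigma> \<tau> (\<lambda>i\<in>{1..r}. int (A i)) =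
    (\<Prod>i = 1..n - r. q ^ (s i * N i)) * (\<Prod>i = 1..m - r. q ^ ((s' i - 1) * M i)) *
    ((\<Prod>l = r+1..n. q powi (- (int (s (l - r)) * int (N (\<sigma> l))))) *
     (\<Prod>l = r+1..m. q powi (- ((int (s' (l - r)) - 1) * int (M (\<tau> l))))) *
     (\<Prod>l = 1..r. q ^ (A l * (A l + 1) div 2) * q ^ (A l * N (\<sigma> l)) * q powi (- (int (A l) * int (M (\<tau> l))))))"
proof -
  interpret S: pit_shape n m r lam lam'
    by (rule shape)
  interpret S': pit_shape m n r lam' lam
    by (rule S.pit_shape_swap)
  note rle = S.r_le
  have N: "shifted_part n \<nu> i = int (N i)" if "i \<in> {1..n}" for i
    using that by (simp add: N_def strict_part_shifted_part)
  have M: "shifted_part m \<mu> i = int (M i)" if "i \<in> {1..m}" for i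
    using that by (simp add: M_def strict_part_shifted_part)
  have \<sigma>_in: "\<sigma> i \<in> {1..n}" if "i \<in> {1..n}" for i
    using permutes_in_image[OF \<sigma>] that by blast
  have \<tau>_in: "\<tau> i \<in> {1..m}" if "i \<in> {1..m}" for i
    using permutes_in_image[OF \<tau>] that by blast
  define A' where "A' = (\<lambda>i\<in>{1..r}. int (A i))"
  define D1 where "D1 = (\<Sum>i = 1..r. A' i * (A' i + 1) div 2 + A' i * (shifted_part n \<nu> (\<sigma> i) - shifted_part m \<mu> (\<tau> i)))"
  define D2 where "D2 = (\<Sum>i = r+1..n. - ((pit_P n m lam (i - r) + 1) * (shifted_part n \<nu> (\<sigma> i) - shifted_part n \<nu> (i - r))))"
  define D3 where "D3 = (\<Sum>i = r+1..m. - (pit_Q n m lam (i - r) * (shifted_part m \<mu> (\<tau> i) - shifted_part m \<mu> (i - r))))"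
  have "pit_Delta n m \<mu> \<nu> lam \<sigma> \<tau> A' = D1 + D2 + D3"
    unfolding pit_Delta_def Let_def r[symmetric] D1_def D2_def D3_def sum_negf by simp
  then have delta: "q powi pit_Delta n m \<mu> \<nu> lam \<sigma> \<tau> A' = q powi D1 * q powi D2 * q powi D3"
    by (simp only: q_powi_add)
  have D1: "q powi D1 = (\<Prod>l = 1..r. q ^ (A l * (A l + 1) div 2) * q ^ (A l * N (\<sigma> l)) * q powi (- (int (A l) * int (M (\<tau> l)))))"
    unfolding D1_def q_powi_sum
  proof (rule prod.cong[OF refl])
    fix l assume l: "l \<in> {1..r}"
    have "int (A l) * (int (A l) + 1) div 2 = int (A l * (A l + 1) div 2)"
      by (simp add: zdiv_int algebra_simps)
    moreover have "q powi (int (A l) * (int (N (\<sigma> l)) - int (M (\<tau> l)))) = q ^ (A l * N (\<sigma> l)) * q powi (- (int (A l) * int (M (\<tau> l))))"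
      using q_powi_mult_diff[of "A l" "N (\<sigma> l)" "int (M (\<tau> l))"] by simp
    ultimately show "q powi (A' l * (A' l + 1) div 2 + A' l * (shifted_part n \<nu> (\<sigma> l) - shifted_part m \<mu> (\<tau> l))) =
        q ^ (A l * (A l + 1) div 2) * q ^ (A l * N (\<sigma> l)) * q powi (- (int (A l) * int (M (\<tau> l))))"
      using l rle N[OF \<sigma>_in, of l] M[OF \<tau>_in, of l] by (simp add: A'_def q_powi_add)
  qed
  have D2: "q powi D2 = (\<Prod>i = 1..n - r. q ^ (s i * N i)) * (\<Prod>l = r+1..n. q powi (- (int (s (l - r)) * int (N (\<sigma> l)))))"
    unfolding D2_def q_powi_sum prod_shift_index[OF rle(1), symmetric] prod.distrib[symmetric]
  proof (rule prod.cong[OF refl])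
    fix l assume l: "l \<in> {r+1..n}"
    then have "pit_P n m lam (l - r) + 1 = int (s (l - r))"
      unfolding s_def by (intro S.pit_P_eq[OF r]) auto
    moreover have "shifted_part n \<nu> (\<sigma> l) = int (N (\<sigma> l))" "shifted_part n \<nu> (l - r) = int (N (l - r))"
      using l by (auto intro!: N \<sigma>_in simp del: atLeastAtMost_iff) auto
    ultimately have "- ((pit_P n m lam (l - r) + 1) * (shifted_part n \<nu> (\<sigma> l) - shifted_part n \<nu> (l - r))) =
        int (s (l - r)) * int (N (l - r)) + - (int (s (l - r)) * int (N (\<sigma> l)))"
      by (simp add: algebra_simps)
    then show "q powi (- ((pit_P n m lam (l - r) + 1) * (shifted_part n \<nu> (\<sigma> l) - shifted_part n \<nu> (l - r)))) =
        q ^ (s (l - r) * N (l - r)) * q powi (- (int (s (l - r)) * int (N (\<sigma> l))))"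
      by (simp only: q_powi_add q_powi_of_nat_mult)
  qed
  have D3: "q powi D3 = (\<Prod>i = 1..m - r. q ^ ((s' i - 1) * M i)) * (\<Prod>l = r+1..m. q powi (- ((int (s' (l - r)) - 1) * int (M (\<tau> l)))))"
    unfolding D3_def q_powi_sum prod_shift_index[OF rle(2), symmetric] prod.distrib[symmetric]
  proof (rule prod.cong[OF refl])
    fix l assume l: "l \<in> {r+1..m}"
    then have lr: "l - r \<in> {1..m - r}"
      by auto
    then have e1: "pit_Q n m lam (l - r) = int (s' (l - r)) - 1"
      unfolding s'_def by (rule S.pit_Q_eq[OF r lam'])
    have e2: "shifted_part m \<mu> (\<tau> l) = int (M (\<tau> l))" "shifted_part m \<mu> (l - r) = int (M (l - r))"
      using l by (auto intro!: M \<tau>_in simp del: atLeastAtMost_iff) auto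
    have e3: "int (s' (l - r) - 1) = int (s' (l - r)) - 1"
    proof -
      have "l - r \<in> {1..m}" "\<not> m - r < l - r"
        using lr by auto
      then have "s' (l - r) \<noteq> 0"
        unfolding s'_def using S'.start_eq_0_iff by blast
      then show ?thesis
        by (simp add: of_nat_diff)
    qed
    have "- (pit_Q n m lam (l - r) * (shifted_part m \<mu> (\<tau> l) - shifted_part m \<mu> (l - r))) =
        int (s' (l - r) - 1) * int (M (l - r)) + - ((int (s' (l - r)) - 1) * int (M (\<tau> l)))"
      unfolding e1 e2 e3 by (simp add: algebra_simps)
    then show "q powi (- (pit_Q n m lam (l - r) * (shifted_part m \<mu> (\<tau> l) - shifted_part m \<mu> (l - r)))) =
        q ^ ((s' (l - r) - 1) * M (l - r)) * q powi (- ((int (s' (l - r)) - 1) * int (M (\<tau> l))))"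
      by (simp only: q_powi_add q_powi_of_nat_mult)
  qed
  show ?thesis
    unfolding A'_def[symmetric] delta D1 D2 D3 by (simp only: mult_ac)
qed

text \<open>The determinants are used as such to discard tuples and expanded afterwards. Each
  expanded term \<open>t \<sigma> \<tau>\<close> is summable by itself, being a product of theta
  series over all tuples. Its sum over the surviving tuples is kept as an \<open>infsum\<close>;
  only the total over \<sigma> and \<tau> is evaluated.\<close>

lemma pit_Theta_has_sum:
  fixes \<nu> \<mu> :: "nat \<Rightarrow> nat"
  assumes shape: "pit_shape n m r lam lam'" and r: "r = pit_rank n m lam" and lam': "lam' = transposed lam"
  defines "N \<equiv> strict_part n \<nu>" and "M \<equiv> strict_part m \<mu>"
    and "s \<equiv> start n m lam" and "s' \<equiv> start m n lam'"
  shows "((\<lambda>(\<sigma>, \<tau>, A). (-1) powi (int (inversions n \<sigma>) + int (inversions m \<tau>) + (\<Sum>i = 1..r. A i)) *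
      q powi pit_Delta n m \<mu> \<nu> lam \<sigma> \<tau> A) has_sum
    ((\<Prod>i = 1..n - r. q ^ (s i * N i)) * (\<Prod>i = 1..m - r. q ^ ((s' i - 1) * M i)) *
     (leibniz2 n m r (\<lambda>l i. q powi (- (int (s (l - r)) * int (N i))))
        (\<lambda>l i. q powi (- ((int (s' (l - r)) - 1) * int (M i)))) (\<lambda>i j. theta (int (N i) - int (M j))) / fact r)))
    (pit_Theta n m lam)"
proof -
  interpret S: pit_shape n m r lam lam'
    by (rule shape)
  note rle = S.r_le
  define C where "C = (\<Prod>i = 1..n - r. q ^ (s i * N i)) * (\<Prod>i = 1..m - r. q ^ ((s' i - 1) * M i))"
  define x where "x l i = q powi (- (int (s (l - r)) * int (N i)))" for l i
  define y where "y l i = q powi (- ((int (s' (l - r)) - 1) * int (M i)))" for l i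
  define a where "a z i = q ^ (z * N i)" for z i
  define b where "b z i = q powi (- (int z * int (M i)))" for z i
  define L where "L = leibniz2 n m r x y (\<lambda>i j. theta (int (N i) - int (M j))) / fact r"
  define D where "D Z = (\<Prod>l = 1..r. theta_coeff (Z l)) * ldet n (\<lambda>l i. if l \<le> r then a (Z l) i else x l i) *
      ldet m (\<lambda>l i. if l \<le> r then b (Z l) i else y l i)" for Z
  define t where "t \<sigma> \<tau> Z = of_int (sign \<sigma>) * of_int (sign \<tau>) * (\<Prod>l = r+1..n. x l (\<sigma> l)) * (\<Prod>l = r+1..m. y l (\<tau> l)) *
     (\<Prod>l = 1..r. theta_coeff (Z l) * a (Z l) (\<sigma> l) * b (Z l) (\<tau> l))" for \<sigma> \<tau> Z
  let ?P = "{\<sigma>. \<sigma> permutes {1..n}}" and ?Q = "{\<tau>. \<tau> permutes {1..m}}"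
  have term_sum: "((\<lambda>z. theta_coeff z * a z i * b z j) has_sum theta (int (N i) - int (M j))) UNIV" for i j
    unfolding a_def b_def theta_coeff_powers by (rule theta_has_sum)
  have "(D has_sum L) (decreasing_tuples r)"
    unfolding D_def L_def by (rule has_sum_ldet_mult_ldet[OF rle term_sum])
  also have "?this \<longleftrightarrow> (D has_sum L) S.surviving_tuples"
  proof (rule has_sum_cong_neutral)
    fix Z assume Z: "Z \<in> decreasing_tuples r - S.surviving_tuples"
    then obtain l j where l: "l \<in> {1..r}" and j: "j \<in> {1..m - r}" and eq: "int (Z l) = int (s' j) - 1"
      unfolding S.surviving_tuples_def s'_def by blast
    \<comment> \<open>For Z_l = Q_j the column q^(-Z_l M_i) coincides with the infinite column at r
      + j.\<close>
    have "ldet m (\<lambda>l i. if l \<le> r then b (Z l) i else y l i) = 0"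
    proof (rule ldet_zero[of l m "r + j"])
      show "(if l \<le> r then b (Z l) i else y l i) = (if r + j \<le> r then b (Z (r + j)) i else y (r + j) i)" for i
        using l j eq by (simp add: b_def y_def)
    qed (use l j rle in auto)
    then show "D Z = 0"
      by (simp add: D_def)
  qed (auto simp: S.surviving_tuples_def)
  finally have D: "(D has_sum L) S.surviving_tuples" .
  have D_eq: "D Z = (\<Sum>\<sigma>\<in>?P. \<Sum>\<tau>\<in>?Q. t \<sigma> \<tau> Z)" for Z
    unfolding D_def t_def by (rule ldet_mult_ldet[OF rle])
  have t_sum: "(t \<sigma> \<tau> has_sum infsum (t \<sigma> \<tau>) S.surviving_tuples) S.surviving_tuples" for \<sigma> \<tau>
  proof (rule has_sum_infsum)
    have "(t \<sigma> \<tau> has_sum of_int (sign \<sigma>) * of_int (sign \<tau>) * (\<Prod>l = r+1..n. x l (\<sigma> l)) * (\<Prod>l = r+1..m. y l (\<tau> l)) *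
        (\<Prod>l = 1..r. theta (int (N (\<sigma> l)) - int (M (\<tau> l))))) ({1..r} \<rightarrow>\<^sub>E UNIV)"
      unfolding t_def by (intro has_sum_cmult_right has_sum_prod_PiE_real term_sum) auto
    then have "t \<sigma> \<tau> summable_on ({1..r} \<rightarrow>\<^sub>E UNIV)"
      by (rule has_sum_imp_summable)
    then show "t \<sigma> \<tau> summable_on S.surviving_tuples"
      by (rule summable_on_subset_banach) (auto simp: S.surviving_tuples_def decreasing_tuples_def)
  qed
  have "((\<lambda>(\<sigma>, \<tau>, Z). t \<sigma> \<tau> Z) has_sum (\<Sum>\<sigma>\<in>?P. \<Sum>\<tau>\<in>?Q. infsum (t \<sigma> \<tau>) S.surviving_tuples)) (?P \<times> ?Q \<times> S.surviving_tuples)"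
    by (intro has_sum_finite_times t_sum finite_permutations) auto
  moreover have "(D has_sum (\<Sum>\<sigma>\<in>?P. \<Sum>\<tau>\<in>?Q. infsum (t \<sigma> \<tau>) S.surviving_tuples)) S.surviving_tuples"
    unfolding D_eq by (intro has_sum_sum_real t_sum)
  then have "(\<Sum>\<sigma>\<in>?P. \<Sum>\<tau>\<in>?Q. infsum (t \<sigma> \<tau>) S.surviving_tuples) = L"
    using D by (rule has_sum_unique)
  ultimately have "((\<lambda>(\<sigma>, \<tau>, Z). t \<sigma> \<tau> Z) has_sum L) (?P \<times> ?Q \<times> S.surviving_tuples)"
    by simp
  then have CL: "((\<lambda>p. C * (case p of (\<sigma>, \<tau>, Z) \<Rightarrow> t \<sigma> \<tau> Z)) has_sum C * L) (?P \<times> ?Q \<times> S.surviving_tuples)"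
    by (rule has_sum_cmult_right)
  define T where "T = (\<lambda>(\<sigma>, \<tau>, A). (-1) powi (int (inversions n \<sigma>) + int (inversions m \<tau>) + (\<Sum>i = 1..r. A i)) *
      q powi pit_Delta n m \<mu> \<nu> lam \<sigma> \<tau> A)"
  define g where "g = (\<lambda>(\<sigma> :: nat \<Rightarrow> nat, \<tau> :: nat \<Rightarrow> nat, A :: nat \<Rightarrow> nat). (\<sigma>, \<tau>, \<lambda>i\<in>{1..r}. int (A i)))"
  have T: "C * t \<sigma> \<tau> A = T (g (\<sigma>, \<tau>, A))" if \<sigma>: "\<sigma> permutes {1..n}" and \<tau>: "\<tau> permutes {1..m}" for \<sigma> \<tau> A
  proof -
    have "int (inversions n \<sigma>) + int (inversions m \<tau>) + (\<Sum>i = 1..r. (\<lambda>i\<in>{1..r}. int (A i)) i) =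
        int (inversions n \<sigma> + inversions m \<tau> + (\<Sum>i = 1..r. A i))"
      by simp
    then have sg: "(-1 :: real) powi (int (inversions n \<sigma>) + int (inversions m \<tau>) + (\<Sum>i = 1..r. (\<lambda>i\<in>{1..r}. int (A i)) i)) =
        of_int (sign \<sigma>) * of_int (sign \<tau>) * (\<Prod>i = 1..r. (-1) ^ A i)"
      by (simp only: power_int_of_nat power_add power_sum sign_eq_inversions[OF \<sigma>] sign_eq_inversions[OF \<tau>]
          of_int_power of_int_minus of_int_1)
    have theta: "(\<Prod>l = 1..r. theta_coeff (A l) * a (A l) (\<sigma> l) * b (A l) (\<tau> l)) =
        (\<Prod>i = 1..r. (-1) ^ A i) *
        (\<Prod>l = 1..r. q ^ (A l * (A l + 1) div 2) * q ^ (A l * N (\<sigma> l)) * q powi (- (int (A l) * int (M (\<tau> l)))))"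
      unfolding prod.distrib[symmetric] theta_coeff_def a_def b_def by (simp only: mult.assoc)
    show ?thesis
      unfolding T_def g_def prod.case sg q_powi_pit_Delta[OF shape r lam' \<sigma> \<tau>]
      unfolding t_def theta C_def x_def y_def N_def M_def s_def s'_def by (simp only: mult_ac)
  qed
  have "((\<lambda>p. C * (case p of (\<sigma>, \<tau>, Z) \<Rightarrow> t \<sigma> \<tau> Z)) has_sum C * L) (?P \<times> ?Q \<times> S.surviving_tuples)"
    by (fact CL)
  also have "?this \<longleftrightarrow> ((\<lambda>p. T (g p)) has_sum C * L) (?P \<times> ?Q \<times> S.surviving_tuples)"
    by (rule has_sum_cong) (use T in auto)
  also have "\<dots> \<longleftrightarrow> (T has_sum C * L) (pit_Theta n m lam)"
    unfolding g_def by (rule has_sum_reindex_bij_betw[OF S.bij_betw_pit_Theta[OF r]])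
  finally show ?thesis
    unfolding T_def C_def L_def x_def y_def .
qed

lemma pit_character_real:
  fixes \<nu> \<mu> :: "nat \<Rightarrow> nat"
  assumes lam: "is_partition lam" "lam (n + 1) < m + 1"
    and \<nu>: "\<And>i. 1 \<le> i \<Longrightarrow> \<nu> (Suc i) \<le> \<nu> i" "\<And>i. n < i \<Longrightarrow> \<nu> i = 0"
    and \<mu>: "\<And>j. 1 \<le> j \<Longrightarrow> \<mu> (Suc j) \<le> \<mu> j" "\<And>j. m < j \<Longrightarrow> \<mu> j = 0"
  defines "r \<equiv> pit_rank n m lam"
  obtains S where "((\<lambda>(\<sigma>, \<tau>, A). (-1) powi (int (inversions n \<sigma>) + int (inversions m \<tau>) + (\<Sum>i = 1..r. A i)) *
      q powi pit_Delta n m \<mu> \<nu> lam \<sigma> \<tau> A) has_sum S) (pit_Theta n m lam)"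
    and "((\<lambda>a. q powi array_weight n m \<mu> \<nu> lam a) has_sum (-1) ^ (r * (m + n)) * S / qpoch_inf ^ (n + m)) (pit_arrays n m \<mu> \<nu> lam)"
proof -
  have shape: "pit_shape n m r lam (transposed lam)"
    unfolding r_def by (rule pit_shape_pit_rank[OF lam])
  have rle: "r \<le> n" "r \<le> m"
    using shape by (auto simp: pit_shape_def)
  \<comment> \<open>The even summand 2 r^2 completes the exponent to r (m + n).\<close>
  have "(-1 :: real) ^ (r * (n - r)) * (-1) ^ (r * (m - r)) = (-1) ^ (r * (n - r) + r * (m - r) + 2 * (r * r))"
    by (simp only: power_add power_mult) simp
  also have "r * (n - r) + r * (m - r) + 2 * (r * r) = r * ((n - r) + (m - r) + 2 * r)"
    by (simp only: distrib_left mult.assoc mult.left_commute)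
  also have "(n - r) + (m - r) + 2 * r = m + n"
    using rle by simp
  finally have sg: "(-1 :: real) ^ (r * (n - r)) * (-1) ^ (r * (m - r)) = (-1) ^ (r * (m + n))" .
  define T where "T = (\<lambda>(\<sigma>, \<tau>, A). (-1) powi (int (inversions n \<sigma>) + int (inversions m \<tau>) + (\<Sum>i = 1..r. A i)) *
      q powi pit_Delta n m \<mu> \<nu> lam \<sigma> \<tau> A)"
  note T = pit_Theta_has_sum[OF shape r_def[THEN meta_eq_to_obj_eq] refl, of \<mu> \<nu>, folded T_def]
  show thesis
  proof (rule that[folded T_def])
    show "(T has_sum infsum T (pit_Theta n m lam)) (pit_Theta n m lam)"
      by (rule has_sum_infsum[OF has_sum_imp_summable[OF T]])
    show "((\<lambda>a. q powi array_weight n m \<mu> \<nu> lam a) has_sum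
        (-1) ^ (r * (m + n)) * infsum T (pit_Theta n m lam) / qpoch_inf ^ (n + m)) (pit_arrays n m \<mu> \<nu> lam)"
      using array_weight_has_sum[where n = n and m = m and \<nu> = \<nu> and \<mu> = \<mu>, OF shape \<nu> \<mu>]
      unfolding infsumI[OF T] sg by (simp add: mult_ac)
  qed
qed

end

section \<open>From real to formal series\<close>

definition real_fps :: "rat fps \<Rightarrow> real fps" where
  "real_fps f = Abs_fps (\<lambda>k. of_rat (fps_nth f k))"

text \<open>Values on the open interval (0, 1) are all that the q-series identities provide; the
  limit q \<rightarrow> 0 still recovers the coefficients from them.\<close>

definition unit_series :: "rat fps \<Rightarrow> (real \<Rightarrow> real) \<Rightarrow> bool" where
  "unit_series f \<phi> \<longleftrightarrow> (\<forall>q. 0 < q \<and> q < 1 \<longrightarrow> (\<lambda>k. of_rat (fps_nth f k) * q ^ k) sums \<phi> q)"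

lemma real_fps_mult: "real_fps (f * g) = real_fps f * real_fps g"
  by (simp add: real_fps_def fps_eq_iff fps_mult_nth of_rat_sum of_rat_mult)

lemma real_fps_diff: "real_fps (f - g) = real_fps f - real_fps g"
  by (simp add: real_fps_def fps_eq_iff of_rat_diff)

lemma unit_series_conv_radius:
  fixes q :: real
  assumes "unit_series f \<phi>" "0 < q" "q < 1"
  shows "ereal (norm q) < fps_conv_radius (real_fps f)"
proof -
  define p where "p = (q + 1) / 2"
  have p: "0 < p" "p < 1" "q < p"
    using assms by (auto simp: p_def field_simps)
  have "summable (\<lambda>k. fps_nth (real_fps f) k * p ^ k)"
    using assms(1) p by (auto simp: unit_series_def real_fps_def dest!: spec[of _ p] intro: sums_summable)
  then have "ereal (norm p) \<le> fps_conv_radius (real_fps f)"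
    unfolding fps_conv_radius_def by (rule conv_radius_geI)
  moreover have "ereal (norm q) < ereal (norm p)"
    using p assms by simp
  ultimately show ?thesis
    by (rule less_le_trans[rotated])
qed

lemma unit_series_eval:
  assumes "unit_series f \<phi>" "0 < q" "q < 1"
  shows "eval_fps (real_fps f) q = \<phi> q"
proof -
  have "(\<lambda>k. fps_nth (real_fps f) k * q ^ k) sums \<phi> q"
    using assms by (simp add: unit_series_def real_fps_def)
  then show ?thesis
    unfolding eval_fps_def by (rule sums_unique[symmetric])
qed

lemma unit_seriesI_eval:
  assumes "\<And>q. 0 < q \<Longrightarrow> q < 1 \<Longrightarrow> ereal (norm q) < fps_conv_radius (real_fps f) \<and> eval_fps (real_fps f) q = \<phi> q"
  shows "unit_series f \<phi>"
  unfolding unit_series_def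
proof (intro allI impI, elim conjE)
  fix q :: real assume q: "0 < q" "q < 1"
  have "(\<lambda>k. fps_nth (real_fps f) k * q ^ k) sums eval_fps (real_fps f) q"
    by (rule sums_eval_fps) (use assms[OF q] in simp)
  then show "(\<lambda>k. of_rat (fps_nth f k) * q ^ k) sums \<phi> q"
    using assms[OF q] by (simp add: real_fps_def)
qed

lemma unit_series_mult:
  assumes f: "unit_series f \<phi>" and g: "unit_series g \<psi>"
  shows "unit_series (f * g) (\<lambda>q. \<phi> q * \<psi> q)"
proof (rule unit_seriesI_eval)
  fix q :: real assume q: "0 < q" "q < 1"
  note rf = unit_series_conv_radius[OF f q] and rg = unit_series_conv_radius[OF g q]
  have "ereal (norm q) < min (fps_conv_radius (real_fps f)) (fps_conv_radius (real_fps g))"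
    using rf rg by (simp only: min_less_iff_conj)
  also have "\<dots> \<le> fps_conv_radius (real_fps f * real_fps g)"
    by (rule fps_conv_radius_mult)
  finally have "ereal (norm q) < fps_conv_radius (real_fps (f * g))"
    by (simp only: real_fps_mult)
  moreover have "eval_fps (real_fps (f * g)) q = \<phi> q * \<psi> q"
    unfolding real_fps_mult using eval_fps_mult[OF rf rg] unit_series_eval[OF f q] unit_series_eval[OF g q] by simp
  ultimately show "ereal (norm q) < fps_conv_radius (real_fps (f * g)) \<and> eval_fps (real_fps (f * g)) q = \<phi> q * \<psi> q"
    by blast
qed

lemma unit_series_X_power: "unit_series (fps_X ^ K) (\<lambda>q. q ^ K)"
  unfolding unit_series_def
proof (intro allI impI)
  fix q :: real
  have "(\<lambda>k. if k = K then q ^ k else 0) sums q ^ K"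
    by (rule sums_single)
  moreover have "(\<lambda>k. of_rat (fps_nth (fps_X ^ K) k) * q ^ k) = (\<lambda>k. if k = K then q ^ k else 0)"
    by auto
  ultimately show "(\<lambda>k. of_rat (fps_nth (fps_X ^ K) k) * q ^ k) sums q ^ K"
    by simp
qed

lemma unit_series_power:
  assumes "unit_series f \<phi>"
  shows "unit_series (f ^ p) (\<lambda>q. \<phi> q ^ p)"
proof (induction p)
  case 0
  then show ?case using unit_series_X_power[of 0] by simp
next
  case (Suc p)
  then show ?case using unit_series_mult[OF assms Suc] by simp
qed

text \<open>A nonzero difference, divided by q^d with d its subdegree, would vanish on (0, 1) and
  yet tend to its nonzero lowest coefficient as q decreases to 0.\<close>

lemma unit_series_unique:
  assumes f: "unit_series f \<phi>" and g: "unit_series g \<phi>"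
  shows "f = g"
proof (rule ccontr)
  assume "f \<noteq> g"
  define h where "h = real_fps (f - g)"
  have "h \<noteq> 0"
    using \<open>f \<noteq> g\<close> by (auto simp: h_def real_fps_def fps_eq_iff)
  have h: "ereal (norm q) < fps_conv_radius h" "eval_fps h q = 0" if q: "0 < q" "q < 1" for q
  proof -
    note rf = unit_series_conv_radius[OF f q] and rg = unit_series_conv_radius[OF g q]
    have "ereal (norm q) < min (fps_conv_radius (real_fps f)) (fps_conv_radius (real_fps g))"
      using rf rg by (simp only: min_less_iff_conj)
    also have "\<dots> \<le> fps_conv_radius (real_fps f - real_fps g)"
      by (rule fps_conv_radius_diff)
    finally show "ereal (norm q) < fps_conv_radius h"
      by (simp only: h_def real_fps_diff)
    show "eval_fps h q = 0"
      unfolding h_def real_fps_diff using eval_fps_diff[OF rf rg] unit_series_eval[OF f q] unit_series_eval[OF g q] by simp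
  qed
  define d where "d = subdegree h"
  define u where "u = fps_shift d h"
  have u0: "fps_nth u 0 \<noteq> 0"
    using \<open>h \<noteq> 0\<close> by (simp add: u_def d_def)
  have radius: "fps_conv_radius u = fps_conv_radius h"
    by (simp add: u_def)
  have u: "eval_fps u q = 0" if q: "0 < q" "q < 1" for q
    unfolding u_def using h[OF q] q by (subst eval_fps_shift) (auto simp: d_def)
  have "ereal 0 < fps_conv_radius u"
    using h(1)[of "1/2"] unfolding radius by (simp add: less_trans[rotated])
  then have "continuous (at 0 within {0<..}) (eval_fps u)"
    by (intro continuous_eval_fps) (simp add: eball_def zero_ereal_def)
  then have "(eval_fps u \<longlongrightarrow> fps_nth u 0) (at_right 0)"
    by (simp add: continuous_within eval_fps_at_0)
  moreover have "(eval_fps u \<longlongrightarrow> 0) (at_right 0)"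
  proof (rule tendsto_eventually)
    show "\<forall>\<^sub>F q in at_right 0. eval_fps u q = 0"
      unfolding eventually_at_right[OF zero_less_one] using u by (intro exI[of _ 1]) auto
  qed
  ultimately show False
    using u0 tendsto_unique[OF trivial_limit_at_right_real] by blast
qed

text \<open>An absolutely convergent sum has only finitely many terms of modulus at least q^N.
  Convergence at a single real q thus gives the finiteness behind formal summability.\<close>

lemma finite_small_exponents:
  fixes e :: "'a \<Rightarrow> int" and sg :: "'a \<Rightarrow> rat" and q :: real
  assumes sg: "\<And>a. a \<in> A \<Longrightarrow> sg a = 1 \<or> sg a = -1" and q: "0 < q" "q < 1"
    and sum: "(\<lambda>a. of_rat (sg a) * q powi e a) summable_on A"
  shows "finite {a \<in> A. e a \<le> N}"
proof -
  have "(\<lambda>a. norm (of_rat (sg a) * q powi e a)) summable_on A"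
    using sum by (metis summable_on_iff_abs_summable_on_real)
  also have "?this \<longleftrightarrow> (\<lambda>a. q powi e a) summable_on A"
    using sg q by (intro summable_on_cong) (force simp: abs_mult)
  finally have s: "(\<lambda>a. q powi e a) summable_on A" .
  define B where "B = infsum (\<lambda>a. q powi e a) A"
  define C where "C = nat \<lceil>B / q powi N\<rceil>"
  have qN: "0 < q powi N"
    using q by simp
  have "card G \<le> C" if G: "G \<subseteq> {a \<in> A. e a \<le> N}" "finite G" for G
  proof -
    have "real (card G) * q powi N = (\<Sum>a\<in>G. q powi N)"
      by simp
    also have "\<dots> \<le> (\<Sum>a\<in>G. q powi e a)"
      using G q by (intro sum_mono power_int_decreasing) auto
    also have "\<dots> \<le> B"
      unfolding B_def using G q by (intro finite_sum_le_infsum s) auto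
    finally have "real (card G) \<le> B / q powi N"
      using qN by (simp add: pos_le_divide_eq)
    then show ?thesis
      unfolding C_def by linarith
  qed
  then show ?thesis
    using finite_if_finite_subsets_card_bdd by blast
qed

text \<open>Regroups the sum by exponent; finite fibres make the coefficients finite sums.\<close>

lemma unit_series_of_has_sum:
  fixes w :: "'a \<Rightarrow> nat" and sg :: "'a \<Rightarrow> rat"
  assumes fin: "\<And>k. finite {a \<in> A. w a = k}"
    and sum: "\<And>q. 0 < q \<Longrightarrow> q < 1 \<Longrightarrow> ((\<lambda>a. of_rat (sg a) * q ^ w a) has_sum \<phi> q) A"
  shows "unit_series (Abs_fps (\<lambda>k. \<Sum>a | a \<in> A \<and> w a = k. sg a)) \<phi>"
  unfolding unit_series_def
proof (intro allI impI, elim conjE)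
  fix q :: real assume q: "0 < q" "q < 1"
  have bij: "bij_betw snd (SIGMA k:UNIV. {a \<in> A. w a = k}) A"
    by (rule bij_betw_byWitness[where f' = "\<lambda>a. (w a, a)"]) auto
  have "((\<lambda>p. of_rat (sg (snd p)) * q ^ w (snd p)) has_sum \<phi> q) (SIGMA k:UNIV. {a \<in> A. w a = k})"
    using sum[OF q] by (subst has_sum_reindex_bij_betw[OF bij])
  then have "((\<lambda>k. of_rat (\<Sum>a | a \<in> A \<and> w a = k. sg a) * q ^ k) has_sum \<phi> q) UNIV"
  proof (rule has_sum_SigmaD)
    fix k
    show "((\<lambda>a. of_rat (sg (snd (k, a))) * q ^ w (snd (k, a))) has_sum
        of_rat (\<Sum>a | a \<in> A \<and> w a = k. sg a) * q ^ k) {a \<in> A. w a = k}"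
      unfolding has_sum_finite_iff[OF fin] by (simp add: of_rat_sum sum_distrib_right)
  qed
  then show "(\<lambda>k. of_rat (fps_nth (Abs_fps (\<lambda>k. \<Sum>a | a \<in> A \<and> w a = k. sg a)) k) * q ^ k) sums \<phi> q"
    by (simp add: has_sum_imp_sums)
qed

lemma fps_X_powers_has_sum:
  fixes w :: "'a \<Rightarrow> nat"
  assumes fin: "\<And>k. finite {a \<in> A. w a = k}"
  shows "((\<lambda>a. fps_X ^ w a :: rat fps) has_sum Abs_fps (\<lambda>k. \<Sum>a | a \<in> A \<and> w a = k. 1)) A"
  unfolding has_sum_def
proof (rule tendsto_fpsI)
  fix k
  show "\<forall>\<^sub>F S in finite_subsets_at_top A. fps_nth (\<Sum>a\<in>S. fps_X ^ w a) k =
      fps_nth (Abs_fps (\<lambda>k. \<Sum>a | a \<in> A \<and> w a = k. 1) :: rat fps) k"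
    unfolding eventually_finite_subsets_at_top
  proof (intro exI[of _ "{a \<in> A. w a = k}"] conjI allI impI)
    fix S assume S: "finite S \<and> {a \<in> A. w a = k} \<subseteq> S \<and> S \<subseteq> A"
    then have "{a \<in> S. w a = k} = {a \<in> A. w a = k}"
      by auto
    moreover have "fps_nth (\<Sum>a\<in>S. fps_X ^ w a :: rat fps) k = (\<Sum>a\<in>S. if w a = k then 1 else 0)"
      unfolding fps_sum_nth by (intro sum.cong) auto
    moreover have "\<dots> = (\<Sum>a | a \<in> S \<and> w a = k. 1 :: rat)"
      using S by (simp only: sum.inter_filter)
    ultimately show "fps_nth (\<Sum>a\<in>S. fps_X ^ w a) k = fps_nth (Abs_fps (\<lambda>k. \<Sum>a | a \<in> A \<and> w a = k. 1) :: rat fps) k"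
      by simp
  qed (use fin in auto)
qed

text \<open>The value \<epsilon> = -1 gives the partial products of (q)_inf, and \<epsilon> = 1 a
  majorant for the absolute values of their coefficients.\<close>

definition fps_factors :: "real \<Rightarrow> nat \<Rightarrow> real fps" where
  "fps_factors \<epsilon> n = (\<Prod>j<n. 1 + fps_const \<epsilon> * fps_X ^ Suc j)"

lemma fps_factors_Suc_nth:
  "fps_nth (fps_factors \<epsilon> (Suc n)) k = fps_nth (fps_factors \<epsilon> n) k +
     (if k < Suc n then 0 else \<epsilon> * fps_nth (fps_factors \<epsilon> n) (k - Suc n))"
proof -
  have "fps_factors \<epsilon> (Suc n) = fps_factors \<epsilon> n + fps_const \<epsilon> * (fps_factors \<epsilon> n * fps_X ^ Suc n)"
    by (simp add: fps_factors_def algebra_simps)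
  then show ?thesis
    by (simp add: fps_X_power_mult_right_nth del: power_Suc)
qed

lemma fps_factors_sums: "(\<lambda>k. fps_nth (fps_factors \<epsilon> n) k * q ^ k) sums (\<Prod>j<n. 1 + \<epsilon> * q ^ Suc j)"
proof (induction n)
  case 0
  have "(\<lambda>k. if k = 0 then q ^ k else 0) sums q ^ 0"
    by (rule sums_single)
  moreover have "(\<lambda>k. fps_nth (fps_factors \<epsilon> 0) k * q ^ k) = (\<lambda>k. if k = 0 then q ^ k else 0)"
    by (auto simp: fps_factors_def)
  ultimately show ?case
    by simp
next
  case (Suc n)
  define c where "c k = (if k < Suc n then 0 else \<epsilon> * fps_nth (fps_factors \<epsilon> n) (k - Suc n)) * q ^ k" for k
  have "(\<lambda>k. c (k + Suc n)) sums (\<epsilon> * q ^ Suc n * (\<Prod>j<n. 1 + \<epsilon> * q ^ Suc j))"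
    using sums_mult[OF Suc, of "\<epsilon> * q ^ Suc n"] by (simp add: c_def power_add mult_ac)
  then have "c sums (\<epsilon> * q ^ Suc n * (\<Prod>j<n. 1 + \<epsilon> * q ^ Suc j))"
    by (subst (asm) sums_zero_iff_shift) (simp_all add: c_def)
  from sums_add[OF Suc this] show ?case
    by (simp add: fps_factors_Suc_nth c_def algebra_simps)
qed

lemma fps_factors_stable: "k \<le> n \<Longrightarrow> fps_nth (fps_factors \<epsilon> n) k = fps_nth (fps_factors \<epsilon> k) k"
proof (induction n rule: dec_induct)
  case (step n)
  then show ?case by (simp add: fps_factors_Suc_nth)
qed simp

lemma fps_factors_nonneg: "0 \<le> fps_nth (fps_factors 1 n) k"
proof (induction n arbitrary: k)
  case 0
  then show ?case by (simp add: fps_factors_def)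
next
  case (Suc n)
  then show ?case by (simp add: fps_factors_Suc_nth)
qed

lemma fps_factors_abs_le: "\<bar>fps_nth (fps_factors (-1) n) k\<bar> \<le> fps_nth (fps_factors 1 n) k"
proof (induction n arbitrary: k)
  case 0
  then show ?case by (simp add: fps_factors_def)
next
  case (Suc n)
  show ?case
    using Suc[of k] Suc[of "k - Suc n"] by (auto simp: fps_factors_Suc_nth)
qed

lemma fps_factors_mono: "n \<le> m \<Longrightarrow> fps_nth (fps_factors 1 n) k \<le> fps_nth (fps_factors 1 m) k"
proof (induction m rule: dec_induct)
  case (step m)
  then show ?case
    using fps_factors_nonneg[of m "k - Suc m"] by (simp add: fps_factors_Suc_nth)
qed simp

text \<open>Coefficient k grows with n up to n = k and is constant from there on, which yields a
  bound uniform in n.\<close>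

lemma fps_factors_le_diagonal: "fps_nth (fps_factors 1 n) k \<le> fps_nth (fps_factors 1 k) k"
  using fps_factors_mono[of n k k] fps_factors_stable[of k n 1] by (cases "n \<le> k") auto

section \<open>The infinite product as a formal and as a real function\<close>

definition q_poly :: "nat \<Rightarrow> rat fps" where
  "q_poly n = (\<Prod>j<n. 1 - fps_X ^ (j + 1))"

lemma real_fps_q_poly: "real_fps (q_poly n) = fps_factors (-1) n"
proof (induction n)
  case 0
  then show ?case by (simp add: q_poly_def fps_factors_def real_fps_def fps_eq_iff)
next
  case (Suc n)
  have "real_fps (1 - fps_X ^ (n + 1)) = 1 + fps_const (-1) * fps_X ^ Suc n"
    by (simp add: real_fps_def fps_eq_iff del: power_Suc)
  then show ?case
    using Suc by (simp add: q_poly_def fps_factors_def real_fps_mult del: power_Suc)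
qed

lemma q_poly_stable: "k \<le> n \<Longrightarrow> fps_nth (q_poly n) k = fps_nth (q_poly k) k"
proof -
  assume "k \<le> n"
  then have "fps_nth (real_fps (q_poly n)) k = fps_nth (real_fps (q_poly k)) k"
    unfolding real_fps_q_poly by (rule fps_factors_stable)
  then show ?thesis
    by (simp add: real_fps_def)
qed

lemma q_infinity_nth: "fps_nth q_infinity k = fps_nth (q_poly k) k"
proof -
  define E where "E = Abs_fps (\<lambda>k. fps_nth (q_poly k) k)"
  have "(\<lambda>n. q_poly (Suc n)) \<longlonglongrightarrow> E"
  proof (rule tendsto_fpsI)
    fix k
    show "\<forall>\<^sub>F n in sequentially. fps_nth (q_poly (Suc n)) k = fps_nth E k"
      unfolding eventually_sequentially E_def fps_nth_Abs_fps
      by (intro exI[of _ k] allI impI q_poly_stable) simp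
  qed
  then have "(\<lambda>n. \<Prod>i\<le>n. 1 - fps_X ^ (i + 0 + 1)) \<longlonglongrightarrow> E"
    by (simp add: q_poly_def lessThan_Suc_atMost)
  \<comment> \<open>Convergence of a product in the sense of \<open>has_prod\<close> includes that
    the limit is nonzero.\<close>
  moreover have "fps_nth E 0 = 1"
    by (simp add: E_def q_poly_def)
  then have "E \<noteq> 0"
    by auto
  ultimately have "(\<lambda>i. 1 - fps_X ^ (i + 1)) has_prod E"
    unfolding has_prod_def raw_has_prod_def by blast
  then have "q_infinity = E"
    unfolding q_infinity_def by (rule has_prod_unique[symmetric])
  then have "fps_nth q_infinity k = fps_nth E k"
    by (simp only:)
  also have "\<dots> = fps_nth (q_poly k) k"
    unfolding E_def fps_nth_Abs_fps ..
  finally show ?thesis .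
qed

text \<open>Coefficients and values are both limits of those of the partial products, and the two
  limits have to be exchanged. Tannery's theorem applies with the coefficients of the product of the
  1 + q^j as majorant, whose sum is bounded by the exponential of a geometric series.\<close>

lemma unit_series_q_infinity: "unit_series q_infinity q_parameter.qpoch_inf"
  unfolding unit_series_def
proof (intro allI impI, elim conjE)
  fix q :: real assume q: "0 < q" "q < 1"
  interpret q_parameter q
    by unfold_locales (use q in auto)
  define a where "a k n = fps_nth (fps_factors (-1) n) k * q ^ k" for k n
  define b where "b k = of_rat (fps_nth q_infinity k) * q ^ k" for k
  define M where "M k = fps_nth (fps_factors 1 k) k * q ^ k" for k
  have b: "b k = fps_nth (fps_factors (-1) k) k * q ^ k" for k
    unfolding b_def q_infinity_nth real_fps_q_poly[symmetric] by (simp add: real_fps_def)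
  have M: "summable M"
  proof (rule summableI_nonneg_bounded)
    show "0 \<le> M k" for k
      using fps_factors_nonneg q by (simp add: M_def)
    show "(\<Sum>k<T. M k) \<le> exp (\<Sum>j. q ^ Suc j)" for T
    proof -
      have "(\<Sum>k<T. M k) = (\<Sum>k<T. fps_nth (fps_factors 1 T) k * q ^ k)"
        unfolding M_def by (intro sum.cong refl arg_cong2[of _ _ _ _ "(*)"] fps_factors_stable[symmetric]) simp
      also have "\<dots> \<le> (\<Sum>k. fps_nth (fps_factors 1 T) k * q ^ k)"
        by (rule sum_le_suminf[OF sums_summable[OF fps_factors_sums]]) (use fps_factors_nonneg q in auto)
      also have "\<dots> = (\<Prod>j<T. 1 + 1 * q ^ Suc j)"
        by (rule sums_unique[OF fps_factors_sums, symmetric])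
      also have "\<dots> \<le> (\<Prod>j<T. exp (q ^ Suc j))"
        using q by (intro prod_mono) (auto intro: exp_ge_add_one_self add_nonneg_nonneg)
      also have "\<dots> = exp (\<Sum>j<T. q ^ Suc j)"
        by (simp add: exp_sum)
      also have "\<dots> \<le> exp (\<Sum>j. q ^ Suc j)"
        using q by (simp only: exp_le_cancel_iff) (intro sum_le_suminf q_summable, auto)
      finally show ?thesis .
    qed
  qed
  have tannery: "summable (\<lambda>k. norm (b k)) \<and> ((\<lambda>n. suminf (\<lambda>k. a k n)) \<longlonglongrightarrow> suminf b)"
  proof (rule conjunct2[OF tannerys_theorem])
    show "(\<lambda>n. a k n) \<longlonglongrightarrow> b k" for k
    proof (rule tendsto_eventually)
      show "\<forall>\<^sub>F n in sequentially. a k n = b k"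
        unfolding eventually_sequentially a_def b
        by (intro exI[of _ k] allI impI arg_cong2[of _ _ _ _ "(*)"] fps_factors_stable refl)
    qed
    show "\<forall>\<^sub>F (k, n) in sequentially \<times>\<^sub>F sequentially. norm (a k n) \<le> M k"
    proof (rule always_eventually, safe)
      fix k n
      have "\<bar>fps_nth (fps_factors (-1) n) k\<bar> \<le> fps_nth (fps_factors 1 k) k"
        using fps_factors_abs_le fps_factors_le_diagonal by (rule order_trans)
      then show "norm (a k n) \<le> M k"
        using q by (simp add: a_def M_def abs_mult mult_right_mono)
    qed
  qed (use M in auto)
  have "suminf (\<lambda>k. a k n) = qpoch n" for n
    unfolding a_def using sums_unique[OF fps_factors_sums[of "-1" n q]] by (simp add: qpoch_def)
  then have "qpoch \<longlonglongrightarrow> suminf b"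
    using tannery by simp
  then have "suminf b = qpoch_inf"
    using qpoch_tendsto LIMSEQ_unique by blast
  moreover have "summable b"
    using tannery summable_norm_cancel by blast
  ultimately show "(\<lambda>k. of_rat (fps_nth q_infinity k) * q ^ k) sums qpoch_inf"
    unfolding b_def[symmetric] by (metis summable_sums)
qed

section \<open>Convergence of formal Laurent series\<close>

lemma dist_fls_le:
  fixes f g :: "'a :: group_add fls"
  assumes "\<And>k. k < int N \<Longrightarrow> fls_nth (f - g) k = 0"
  shows "dist f g \<le> (1 / 2) ^ N"
proof (cases "f = g")
  case False
  then have "int N \<le> fls_subdegree (f - g)"
    using assms by (intro fls_subdegree_geI) auto
  then obtain d where d: "fls_subdegree (f - g) = int (N + d)"
    by (metis add.commute nonneg_int_cases of_nat_add order_trans of_nat_0_le_iff zle_iff_zadd)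
  have "dist f g = (1 / 2) ^ (N + d)"
    using False by (simp add: dist_fls_def d power_one_over inverse_eq_divide del: of_nat_add)
  also have "\<dots> \<le> (1 / 2) ^ N"
    by (intro power_decreasing) auto
  finally show ?thesis .
qed simp

lemma fls_X_powers_has_sum:
  fixes e :: "'a \<Rightarrow> int" and sg :: "'a \<Rightarrow> rat" and H c :: "rat fls"
  assumes fin: "\<And>N. finite {a \<in> A. e a \<le> N}"
    and H: "\<And>k. fls_nth H k = (\<Sum>a | a \<in> A \<and> e a = k. sg a)"
  shows "((\<lambda>a. fls_const (sg a) * fls_X powi e a * c) has_sum H * c) A"
  unfolding has_sum_def tendsto_iff
proof (intro allI impI)
  fix \<epsilon> :: real assume "0 < \<epsilon>"
  then obtain N where N: "(1 / 2) ^ N < \<epsilon>"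
    using real_arch_pow_inv[of \<epsilon> "1 / 2"] by auto
  \<comment> \<open>Multiplication by \<open>c\<close> moves orders by its subdegree, so agreement
    up to \<open>D\<close> before it gives agreement below \<open>N\<close> after it.\<close>
  define D where "D = int N - fls_subdegree c"
  show "\<forall>\<^sub>F S in finite_subsets_at_top A. dist (\<Sum>a\<in>S. fls_const (sg a) * fls_X powi e a * c) (H * c) < \<epsilon>"
    unfolding eventually_finite_subsets_at_top
  proof (intro exI[of _ "{a \<in> A. e a \<le> D}"] conjI allI impI fin)
    fix S assume S: "finite S \<and> {a \<in> A. e a \<le> D} \<subseteq> S \<and> S \<subseteq> A"
    define P where "P = (\<Sum>a\<in>S. fls_const (sg a) * fls_X powi e a) - H"
    have P0: "fls_nth P k = 0" if "k \<le> D" for k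
    proof -
      have "{a \<in> S. e a = k} = {a \<in> A. e a = k}"
        using S that by auto
      moreover have "fls_nth (\<Sum>a\<in>S. fls_const (sg a) * fls_X powi e a) k = (\<Sum>a\<in>S. if e a = k then sg a else 0)"
        unfolding fls_nth_sum by (intro sum.cong) auto
      moreover have "\<dots> = (\<Sum>a | a \<in> S \<and> e a = k. sg a)"
        using S by (simp only: sum.inter_filter)
      ultimately show ?thesis
        by (simp add: P_def H)
    qed
    have "(\<Sum>a\<in>S. fls_const (sg a) * fls_X powi e a * c) - H * c = P * c"
      unfolding P_def sum_distrib_right[symmetric] by (simp add: left_diff_distrib)
    moreover have "fls_nth (P * c) k = 0" if "k < int N" for k
    proof (cases "P = 0")
      case False
      then have "D \<le> fls_subdegree P"
        using P0 by (intro fls_subdegree_geI) auto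
      then show ?thesis
        using that by (intro fls_times_nth_eq0) (simp add: D_def)
    qed simp
    ultimately have "dist (\<Sum>a\<in>S. fls_const (sg a) * fls_X powi e a * c) (H * c) \<le> (1 / 2) ^ N"
      by (intro dist_fls_le) simp
    then show "dist (\<Sum>a\<in>S. fls_const (sg a) * fls_X powi e a * c) (H * c) < \<epsilon>"
      using N by simp
  qed auto
qed

lemma partition_zero:
  assumes \<nu>: "is_partition \<nu>" and "partition_length \<nu> \<le> n" "n < i"
  shows "\<nu> i = 0"
proof (rule ccontr)
  assume "\<nu> i \<noteq> 0"
  have "{1..i} \<subseteq> {k. 1 \<le> k \<and> \<nu> k \<noteq> 0}"
  proof
    fix k assume "k \<in> {1..i}"
    then show "k \<in> {k. 1 \<le> k \<and> \<nu> k \<noteq> 0}"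
      using partition_antimono[OF \<nu>, of k i] \<open>\<nu> i \<noteq> 0\<close> by auto
  qed
  then have "card {1..i} \<le> partition_length \<nu>"
    unfolding partition_length_def using \<nu> by (intro card_mono) (auto simp: is_partition_def)
  then show False
    using assms by simp
qed

theorem theorem3:
  fixes n m :: nat and \<nu> \<mu> lam :: "nat \<Rightarrow> nat"
  assumes "is_partition \<nu>" and "is_partition \<mu>" and "is_partition lam"
    and "partition_length \<nu> \<le> n" and "partition_length \<mu> \<le> m"
    and "lam (n + 1) < m + 1"
  shows "(\<lambda>a. fps_X ^ nat (array_weight n m \<mu> \<nu> lam a) :: rat fps) summable_on pit_arrays n m \<mu> \<nu> lam \<and>
    (let r = pit_rank n m lam;
         f = (\<lambda>(\<sigma>, \<tau>, A).
               (-1) powi (int (inversions n \<sigma>) + int (inversions m \<tau>) + (\<Sum>i=1..r. A i)) *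
               (fls_X powi pit_Delta n m \<mu> \<nu> lam \<sigma> \<tau> A / fps_to_fls q_infinity ^ (n + m)))
     in f summable_on pit_Theta n m lam \<and>
        fps_to_fls (pit_character n m \<mu> \<nu> lam) =
          (-1) ^ (r * (m + n)) * (\<Sum>\<^sub>\<infinity>\<theta> \<in> pit_Theta n m lam. f \<theta>))"
proof -
  define r where "r = pit_rank n m lam"
  define p where "p = n + m"
  define \<A> where "\<A> = pit_arrays n m \<mu> \<nu> lam"
  define \<Theta> where "\<Theta> = pit_Theta n m lam"
  define w where "w a = nat (array_weight n m \<mu> \<nu> lam a)" for a
  define e where "e = (\<lambda>(\<sigma>, \<tau>, A). pit_Delta n m \<mu> \<nu> lam \<sigma> \<tau> A)"
  define ex where "ex = (\<lambda>(\<sigma>, \<tau>, A). int (inversions n \<sigma>) + int (inversions m \<tau>) + (\<Sum>i=1..r. A i))"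
  define sg :: "(nat \<Rightarrow> nat) \<times> (nat \<Rightarrow> nat) \<times> (nat \<Rightarrow> int) \<Rightarrow> rat" where "sg \<theta> = (-1) powi ex \<theta>" for \<theta>
  have sg: "sg \<theta> = 1 \<or> sg \<theta> = -1" for \<theta>
    by (simp add: sg_def power_int_minus_left)
  have sg_real: "of_rat (sg \<theta>) = ((-1) powi ex \<theta> :: real)" for \<theta>
    by (simp add: sg_def power_int_minus_left)
  have \<nu>: "\<And>i. 1 \<le> i \<Longrightarrow> \<nu> (Suc i) \<le> \<nu> i" "\<And>i. n < i \<Longrightarrow> \<nu> i = 0"
    using assms(1,4) partition_zero by (auto simp: is_partition_def)
  have \<mu>: "\<And>i. 1 \<le> i \<Longrightarrow> \<mu> (Suc i) \<le> \<mu> i" "\<And>i. m < i \<Longrightarrow> \<mu> i = 0"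
    using assms(2,5) partition_zero by (auto simp: is_partition_def)
  \<comment> \<open>Both sums are tied to one number \<open>S\<close>, so that a single choice per q
    keeps them related.\<close>
  define P where "P q S \<longleftrightarrow> ((\<lambda>\<theta>. of_rat (sg \<theta>) * q powi e \<theta>) has_sum S) \<Theta> \<and>
      ((\<lambda>a. of_rat 1 * q ^ w a) has_sum (-1) ^ (r * (m + n)) * S / q_parameter.qpoch_inf q ^ p) \<A>" for q S :: real
  have real: "\<exists>S. P q S"
    if q: "0 < q" "q < 1" for q :: real
  proof -
    interpret q_parameter q
      by unfold_locales (use q in auto)
    obtain S where S: "((\<lambda>(\<sigma>, \<tau>, A). (-1) powi (int (inversions n \<sigma>) + int (inversions m \<tau>) + (\<Sum>i=1..r. A i)) *
        q powi pit_Delta n m \<mu> \<nu> lam \<sigma> \<tau> A) has_sum S) \<Theta>"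
      "((\<lambda>a. q powi array_weight n m \<mu> \<nu> lam a) has_sum (-1) ^ (r * (m + n)) * S / qpoch_inf ^ p) \<A>"
      unfolding r_def p_def \<Theta>_def \<A>_def
      by (rule pit_character_real[where \<nu> = \<nu> and \<mu> = \<mu>, OF assms(3,6) \<nu> \<mu>])
    have "(\<lambda>(\<sigma>, \<tau>, A). (-1) powi (int (inversions n \<sigma>) + int (inversions m \<tau>) + (\<Sum>i=1..r. A i)) *
        q powi pit_Delta n m \<mu> \<nu> lam \<sigma> \<tau> A) = (\<lambda>\<theta>. of_rat (sg \<theta>) * q powi e \<theta>)"
      unfolding sg_real by (auto simp: ex_def e_def)
    moreover have "((\<lambda>a. q powi array_weight n m \<mu> \<nu> lam a) has_sum x) \<A> \<longleftrightarrow>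
        ((\<lambda>a. of_rat 1 * q ^ w a) has_sum x) \<A>" for x
    proof (rule has_sum_cong)
      fix a assume "a \<in> \<A>"
      then have "0 \<le> array_weight n m \<mu> \<nu> lam a"
        unfolding \<A>_def by (rule array_weight_nonneg)
      then show "q powi array_weight n m \<mu> \<nu> lam a = of_rat 1 * q ^ w a"
        by (simp add: w_def power_int_def)
    qed
    ultimately show ?thesis
      using S unfolding P_def by auto
  qed
  define S where "S q = (SOME S. P q S)" for q
  have PS: "P q (S q)" if "0 < q" "q < 1" for q
    unfolding S_def by (rule someI_ex[OF real[OF that]])
  have S: "((\<lambda>\<theta>. of_rat (sg \<theta>) * q powi e \<theta>) has_sum S q) \<Theta>"
    and chi: "((\<lambda>a. of_rat 1 * q ^ w a) has_sum (-1) ^ (r * (m + n)) * S q / q_parameter.qpoch_inf q ^ p) \<A>"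
    if "0 < q" "q < 1" for q
    using PS[OF that] unfolding P_def by blast+
  \<comment> \<open>Convergence at q = 1/2 alone implies that each weight is attained finitely
    often.\<close>
  have fin_w: "finite {a \<in> \<A>. w a = k}" for k
  proof -
    have "(\<lambda>a. of_rat 1 * (1 / 2 :: real) ^ w a) summable_on \<A>"
      using chi[of "1 / 2"] by (auto intro: has_sum_imp_summable)
    then have "finite {a \<in> \<A>. int (w a) \<le> int k}"
      by (intro finite_small_exponents[where sg = "\<lambda>_. 1" and q = "1 / 2"]) auto
    then show ?thesis
      by (rule rev_finite_subset) auto
  qed
  have fin_e: "finite {\<theta> \<in> \<Theta>. e \<theta> \<le> N}" for N
    using S[of "1 / 2"] sg by (intro finite_small_exponents[where sg = sg and q = "1 / 2"]) (auto intro: has_sum_imp_summable)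
  \<comment> \<open>Exponents may be negative, but only finitely many are at most 0, so they are
    bounded below; the factor q^K then makes the sum over \<Theta> a power series.\<close>
  obtain K :: nat where K: "\<And>\<theta>. \<theta> \<in> \<Theta> \<Longrightarrow> 0 \<le> e \<theta> + int K"
  proof -
    define B where "B = Max (insert 0 ((\<lambda>\<theta>. - e \<theta>) ` {\<theta> \<in> \<Theta>. e \<theta> \<le> 0}))"
    have B: "- e \<theta> \<le> B \<and> 0 \<le> B" if "\<theta> \<in> \<Theta>" for \<theta>
    proof (cases "e \<theta> \<le> 0")
      case True
      then show ?thesis
        unfolding B_def using that fin_e[of 0] by (intro conjI Max_ge) auto
    next
      case False
      moreover have "0 \<le> B"
        unfolding B_def using fin_e[of 0] by (intro Max_ge) auto
      ultimately show ?thesis by simp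
    qed
    then have "0 \<le> e \<theta> + int (nat B)" if "\<theta> \<in> \<Theta>" for \<theta>
      using B[OF that] by simp
    then show thesis
      by (rule that)
  qed
  define F where "F = Abs_fps (\<lambda>k. \<Sum>a | a \<in> \<A> \<and> w a = k. 1 :: rat)"
  define G where "G = Abs_fps (\<lambda>k. \<Sum>\<theta> | \<theta> \<in> \<Theta> \<and> nat (e \<theta> + int K) = k. sg \<theta>)"
  define \<epsilon> :: "rat fps" where "\<epsilon> = (-1) ^ (r * (m + n))"
  have G_fin: "finite {\<theta> \<in> \<Theta>. nat (e \<theta> + int K) = k}" for k
    by (rule finite_subset[OF _ fin_e[of "int k"]]) auto
  have F: "unit_series F (\<lambda>q. (-1) ^ (r * (m + n)) * S q / q_parameter.qpoch_inf q ^ p)"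
    unfolding F_def by (rule unit_series_of_has_sum[OF fin_w chi])
  have G: "unit_series G (\<lambda>q. q ^ K * S q)"
    unfolding G_def
  proof (rule unit_series_of_has_sum[OF G_fin])
    fix q :: real assume q: "0 < q" "q < 1"
    have "((\<lambda>\<theta>. q ^ K * (of_rat (sg \<theta>) * q powi e \<theta>)) has_sum q ^ K * S q) \<Theta>"
      by (rule has_sum_cmult_right[OF S[OF q]])
    also have "?this \<longleftrightarrow> ((\<lambda>\<theta>. of_rat (sg \<theta>) * q ^ nat (e \<theta> + int K)) has_sum q ^ K * S q) \<Theta>"
    proof (rule has_sum_cong)
      fix \<theta> assume "\<theta> \<in> \<Theta>"
      then have "q ^ nat (e \<theta> + int K) = q powi (e \<theta> + int K)"
        using K by (simp add: power_int_def)
      then show "q ^ K * (of_rat (sg \<theta>) * q powi e \<theta>) = of_rat (sg \<theta>) * q ^ nat (e \<theta> + int K)"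
        using q by (simp add: power_int_add)
    qed
    finally show "((\<lambda>\<theta>. of_rat (sg \<theta>) * q ^ nat (e \<theta> + int K)) has_sum q ^ K * S q) \<Theta>" .
  qed
  \<comment> \<open>The comparison is made after clearing (q)_inf^(n+m) and multiplying by q^K,
    where both sides are ordinary power series.\<close>
  have "unit_series (F * fps_X ^ K * q_infinity ^ p) (\<lambda>q. (-1) ^ (r * (m + n)) * (q ^ K * S q))"
  proof -
    have s: "unit_series (F * fps_X ^ K * q_infinity ^ p)
        (\<lambda>q. (-1) ^ (r * (m + n)) * S q / q_parameter.qpoch_inf q ^ p * q ^ K * q_parameter.qpoch_inf q ^ p)"
      by (intro unit_series_mult unit_series_power unit_series_X_power F unit_series_q_infinity)
    have "(-1) ^ (r * (m + n)) * S q / q_parameter.qpoch_inf q ^ p * q ^ K * q_parameter.qpoch_inf q ^ p =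
        (-1) ^ (r * (m + n)) * (q ^ K * S q)" if "0 < q" "q < 1" for q
    proof -
      have "q_parameter.qpoch_inf q \<noteq> 0"
        by (rule q_parameter.qpoch_inf_nonzero) (unfold_locales, use that in auto)
      then show ?thesis
        by simp
    qed
    then show ?thesis
      using s unfolding unit_series_def by auto
  qed
  moreover have "unit_series (\<epsilon> * G) (\<lambda>q. (-1) ^ (r * (m + n)) * (q ^ K * S q))"
  proof -
    have "fps_nth (\<epsilon> * G) k = (-1) ^ (r * (m + n)) * fps_nth G k" for k
      unfolding \<epsilon>_def by (cases "even (r * (m + n))") auto
    then show ?thesis
      using G unfolding unit_series_def by (auto simp: of_rat_mult of_rat_power of_rat_minus mult.assoc intro: sums_mult)
  qed
  ultimately have identity: "F * fps_X ^ K * q_infinity ^ p = \<epsilon> * G"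
    by (rule unit_series_unique)
  have arrays: "((\<lambda>a. fps_X ^ w a :: rat fps) has_sum F) \<A>"
    unfolding F_def by (rule fps_X_powers_has_sum[OF fin_w])
  then have character: "pit_character n m \<mu> \<nu> lam = F"
    unfolding pit_character_def w_def \<A>_def by (rule infsumI)
  define c where "c = fps_to_fls q_infinity ^ p"
  have "c \<noteq> 0"
  proof -
    have "fps_nth q_infinity 0 = 1"
      by (simp add: q_infinity_nth q_poly_def)
    then have "q_infinity \<noteq> 0"
      by auto
    then show ?thesis
      by (simp add: c_def)
  qed
  \<comment> \<open>Taking the shift by \<open>K\<close> back gives the formal sum over \<Theta>
    with its true exponents.\<close>
  define H where "H = fls_X powi (- int K) * fps_to_fls G"
  have H_nth: "fls_nth H k = (\<Sum>\<theta> | \<theta> \<in> \<Theta> \<and> e \<theta> = k. sg \<theta>)" for k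
  proof -
    have "H = fls_shift (int K) (fps_to_fls G)"
      using fls_X_intpow_times_conv_shift(1)[of "- int K" "fps_to_fls G"] by (simp add: H_def)
    then have "fls_nth H k = fls_nth (fps_to_fls G) (k + int K)"
      by simp
    also have "\<dots> = (\<Sum>\<theta> | \<theta> \<in> \<Theta> \<and> e \<theta> = k. sg \<theta>)"
    proof (cases "0 \<le> k + int K")
      case True
      have "{\<theta> \<in> \<Theta>. nat (e \<theta> + int K) = nat (k + int K)} = {\<theta> \<in> \<Theta>. e \<theta> = k}"
        using K True by force
      then show ?thesis
        using True by (simp add: G_def)
    next
      case False
      then have "{\<theta> \<in> \<Theta>. e \<theta> = k} = {}"
        using K by force
      then show ?thesis
        using False by (simp only: sum.empty) simp
    qed
    finally show ?thesis .
  qed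
  have "((\<lambda>\<theta>. fls_const (sg \<theta>) * fls_X powi e \<theta> * (1 / c)) has_sum H * (1 / c)) \<Theta>"
    by (rule fls_X_powers_has_sum[OF fin_e H_nth])
  moreover have "(\<lambda>\<theta>. fls_const (sg \<theta>) * fls_X powi e \<theta> * (1 / c)) =
      (\<lambda>(\<sigma>, \<tau>, A). (-1) powi (int (inversions n \<sigma>) + int (inversions m \<tau>) + (\<Sum>i=1..r. A i)) *
         (fls_X powi pit_Delta n m \<mu> \<nu> lam \<sigma> \<tau> A / c))" (is "_ = ?f")
    by (auto simp: sg_def ex_def e_def power_int_minus_left)
  ultimately have f: "(?f has_sum H * (1 / c)) \<Theta>"
    by simp
  have "fps_to_fls F = (-1) ^ (r * (m + n)) * (H * (1 / c))"
  proof -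
    have X: "(fls_X :: rat fls) ^ K * fls_X powi (- int K) = 1"
      by (metis fls_X_nonzero power_int_minus power_int_of_nat right_inverse power_not_zero)
    have eq: "fps_to_fls F * fls_X ^ K * c = (-1) ^ (r * (m + n)) * fps_to_fls G"
      using arg_cong[OF identity, of fps_to_fls]
      by (simp add: fls_times_fps_to_fls fps_to_fls_power c_def \<epsilon>_def)
    have "fps_to_fls F * (fls_X ^ K * fls_X powi (- int K)) * c =
        fps_to_fls F * fls_X ^ K * c * fls_X powi (- int K)"
      by (simp only: mult_ac)
    also have "\<dots> = (-1) ^ (r * (m + n)) * H"
      unfolding eq H_def by (simp only: mult_ac)
    finally show ?thesis
      using \<open>c \<noteq> 0\<close> unfolding X by (simp add: field_simps)
  qed
  then show ?thesis
    using arrays f character infsumI[OF f]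
    unfolding Let_def r_def[symmetric] p_def[symmetric] c_def[symmetric] w_def[symmetric] \<A>_def[symmetric] \<Theta>_def[symmetric]
    by (auto intro: has_sum_imp_summable)
qed

end
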